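(* Fix an increasing weight $W:[0,\infty)\to[1,\infty)$, with $W>1$ on $[1,\infty)$, such that: (1) for every $\alpha>0$, $W^\alpha$ has the PLS property; (2) there is a constant $C_{\mathrm{doub}}$ such that $\log W(et)\le C_{\mathrm{doub}}\log W(t)$, and $\log W(t)\le t/4$, for every $t>1$. For every $\Lambda>0$, $\gamma>0$ and $\sigma>0$, there is a constant $C=C(C_{\mathrm{doub}},W,\Lambda,\gamma,\sigma)$ such that for every $W$-sparse set $Q\subset\mathbb{R}$ with $\|Q\|_W\le\Lambda$, every $(\gamma,1)$-relatively dense set $E\subset\mathbb{R}$, and every $f\in L^2(\mathbb{R})$ with $\operatorname{supp}(\widehat f)\subset Q$, $$\|f\|_{L^2(\mathbb{R})}\le C\|f\|_{L^2(E_\sigma)}.$$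
   Context: $\mathbb{N}=\{1,2,3,\dots\}$ and $m_d$ is Lebesgue measure on $\mathbb{R}^d$. The Fourier transform on $L^2(\mathbb{R}^d)$ is the extension of $\widehat f(\xi)=\int_{\mathbb{R}^d}f(t)e^{-2\pi i\xi\cdot t}\,dm_d(t)$. A Borel set $E\subset\mathbb{R}^d$ is $(\gamma,\ell)$-relatively dense if $m_d(E\cap Q)\ge\gamma$ for any cube $Q\subset\mathbb{R}^d$ of side-length $\ell$. For $\sigma>0$, $E_\sigma$ is the open $\sigma$-neighborhood of $E$. A weight $V:[0,\infty)\to[0,\infty]$ has the PLS property if, for every $d\in\mathbb{N}$, $\gamma\in(0,1)$, $\ell>0$, and $C_V>0$, there exists a finite constant $C=C(d,V,C_V,\gamma,\ell)>0$ such that if $f\in L^2(\mathbb{R}^d)$ satisfies $\int_{\mathbb{R}^d}|\widehat f(\xi)V(|\xi|)|^2dm_d(\xi)\le C_V^2\|f\|^2_{L^2(\mathbb{R}^d)}$ and $E\subset\mathbb{R}^d$ is $(\gamma,\ell)$-relatively dense, then $\|f\|_{L^2(\mathbb{R}^d)}\le C\|f\|_{L^2(E)}$. For a weight $W:[0,\infty)\to[0,\infty)$ with $W>1$ on $[1,\infty)$: a family $\{\mathcal{J}_n\}_{n\in\mathbb{N}}$ is a $W$-short cover of a set $Q\subset\mathbb{R}$ if for every $n\in\mathbb{N}$, $\mathcal{J}_n$ is a collection of intervals of length $\Omega_n=\log W(e^n)$ such that $\bigcup_{J\in\mathcal{J}_n}J\supset Q\cap([-e^{n+1},-e^n]\cup[e^n,e^{n+1}])$,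 and $$\|\{\mathcal{J}_n\}_n\|_W:=\sum_{n\in\mathbb{N}}\Bigl(\frac{\Omega_n}{e^n}\Bigr)^2\operatorname{card}(\mathcal{J}_n)<\infty.$$ A set $Q\subset\mathbb{R}$ is $W$-sparse if for every $t\in\mathbb{R}$ the set $Q-t$ has a $W$-short cover, and moreover $$\|Q\|_W:=\sup_{t\in\mathbb{R}}\ \inf\bigl\{\|\{\mathcal{J}^{(t)}_n\}_n\|_W:\ \{\mathcal{J}_n^{(t)}\}_n\text{ a }W\text{-short cover of }Q-t\bigr\}<\infty.$$ *)

theory Defs
  imports "HOL-Analysis.Analysis"
begin

text \<open>
  The dimension is quantified inside the definition of the PLS property, so Euclidean space
  of dimension \<open>d\<close> is rendered with an explicit carrier: the extensional functions on
  \<open>{..<d}\<close> with the product of \<open>d\<close> copies of Lebesgue--Borel measure. The definitions below that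
  are needed both there and on the type \<^typ>\<open>real\<close> take the measure \<open>M\<close>, the bilinear pairing
  \<open>p\<close> in the exponential, and the collection of cubes as parameters.
\<close>

definition lebesgue_Rd :: "nat \<Rightarrow> (nat \<Rightarrow> real) measure" where
  "lebesgue_Rd d = (\<Pi>\<^sub>M i\<in>{..<d}. lborel)"

definition inner_Rd :: "nat \<Rightarrow> (nat \<Rightarrow> real) \<Rightarrow> (nat \<Rightarrow> real) \<Rightarrow> real" where
  "inner_Rd d x y = (\<Sum>i<d. x i * y i)"

definition norm_Rd :: "nat \<Rightarrow> (nat \<Rightarrow> real) \<Rightarrow> real" where
  "norm_Rd d x = L2_set x {..<d}"

definition cubes_Rd :: "nat \<Rightarrow> real \<Rightarrow> (nat \<Rightarrow> real) set set" where
  "cubes_Rd d l = {(\<Pi>\<^sub>E i\<in>{..<d}. {a i..a i + l}) | a. True}"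

definition cubes_R :: "real \<Rightarrow> real set set" where
  "cubes_R l = {{a..a + l} | a. True}"

definition L2_space :: "'a measure \<Rightarrow> ('a \<Rightarrow> complex) set" where
  "L2_space M = {f \<in> borel_measurable M. integrable M (\<lambda>x. (cmod (f x))\<^sup>2)}"

definition L2_norm_on :: "'a measure \<Rightarrow> 'a set \<Rightarrow> ('a \<Rightarrow> complex) \<Rightarrow> real" where
  "L2_norm_on M A f = sqrt (LINT x:A|M. (cmod (f x))\<^sup>2)"

abbreviation L2_norm :: "'a measure \<Rightarrow> ('a \<Rightarrow> complex) \<Rightarrow> real" where
  "L2_norm M f \<equiv> L2_norm_on M (space M) f"

definition L2_tendsto :: "'a measure \<Rightarrow> (nat \<Rightarrow> 'a \<Rightarrow> complex) \<Rightarrow> ('a \<Rightarrow> complex) \<Rightarrow> bool" where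
  "L2_tendsto M h f \<longleftrightarrow> (\<lambda>k. \<integral>\<^sup>+ x. ennreal ((cmod (h k x - f x))\<^sup>2) \<partial>M) \<longlonglongrightarrow> 0"

definition fourier_L1 :: "'a measure \<Rightarrow> ('a \<Rightarrow> 'a \<Rightarrow> real) \<Rightarrow> ('a \<Rightarrow> complex) \<Rightarrow> 'a \<Rightarrow> complex" where
  "fourier_L1 M p f \<xi> = (LINT t|M. f t * exp (- 2 * of_real pi * \<i> * of_real (p \<xi> t)))"

text \<open>
  The extension by continuity of the integral formula from \<open>L\<^sup>1 \<inter> L\<^sup>2\<close> to \<open>L\<^sup>2\<close>. It is given
  as a relation because the transform \<open>g\<close> of \<open>f\<close> is determined only up to null sets.
\<close>

definition has_fourier_transform ::
  "'a measure \<Rightarrow> ('a \<Rightarrow> 'a \<Rightarrow> real) \<Rightarrow> ('a \<Rightarrow> complex) \<Rightarrow> ('a \<Rightarrow> complex) \<Rightarrow> bool" where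
  "has_fourier_transform M p f g \<longleftrightarrow>
     f \<in> L2_space M \<and> g \<in> L2_space M \<and>
     (\<exists>h. (\<forall>k. h k \<in> L2_space M \<and> integrable M (h k)) \<and>
          L2_tendsto M h f \<and> L2_tendsto M (\<lambda>k. fourier_L1 M p (h k)) g)"

definition relatively_dense :: "'a measure \<Rightarrow> 'a set set \<Rightarrow> real \<Rightarrow> 'a set \<Rightarrow> bool" where
  "relatively_dense M cubes \<gamma> E \<longleftrightarrow>
     E \<in> sets M \<and> (\<forall>Q\<in>cubes. ennreal \<gamma> \<le> emeasure M (E \<inter> Q))"

definition open_nbhd :: "real \<Rightarrow> real set \<Rightarrow> real set" where
  "open_nbhd \<sigma> E = (\<Union>x\<in>E. ball x \<sigma>)"

text \<open>The closed support of an element of \<open>L\<^sup>2\<close>, insensitive to changes on null sets.\<close>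

definition ess_support :: "(real \<Rightarrow> complex) \<Rightarrow> real set" where
  "ess_support g = - \<Union>{U. open U \<and> (AE x in lborel. x \<in> U \<longrightarrow> g x = 0)}"

text \<open>
  Weights are defined on the half-line; the values at negative arguments are never used.
  The product is taken in \<^typ>\<open>ennreal\<close>, where \<open>0 * \<infinity> = 0\<close>.
\<close>

definition PLS_property :: "(real \<Rightarrow> ennreal) \<Rightarrow> bool" where
  "PLS_property V \<longleftrightarrow>
     (\<forall>d\<ge>1. \<forall>\<gamma>\<in>{0<..<1}. \<forall>l>0. \<forall>C\<^sub>V>0. \<exists>C>0. \<forall>f g E.
        has_fourier_transform (lebesgue_Rd d) (inner_Rd d) f g \<longrightarrow>
        (\<integral>\<^sup>+ \<xi>. (ennreal (cmod (g \<xi>)) * V (norm_Rd d \<xi>))\<^sup>2 \<partial>lebesgue_Rd d)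
           \<le> ennreal (C\<^sub>V\<^sup>2 * (L2_norm (lebesgue_Rd d) f)\<^sup>2) \<longrightarrow>
        relatively_dense (lebesgue_Rd d) (cubes_Rd d l) \<gamma> E \<longrightarrow>
        L2_norm (lebesgue_Rd d) f \<le> C * L2_norm_on (lebesgue_Rd d) E f)"

definition short_length :: "(real \<Rightarrow> real) \<Rightarrow> nat \<Rightarrow> real" where
  "short_length W n = ln (W (exp (real n)))"

text \<open>
  Families are indexed by the positive integers: \<open>J 0\<close> is irrelevant, and sums run over
  \<open>Suc n\<close>. Cardinality is measured by counting measure, so that an infinite \<open>J n\<close> contributes
  \<open>\<infinity>\<close> (whereas \<^const>\<open>card\<close> would give \<open>0\<close>).
\<close>

definition cover_norm :: "(real \<Rightarrow> real) \<Rightarrow> (nat \<Rightarrow> real set set) \<Rightarrow> ennreal" where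
  "cover_norm W J =
     (\<Sum>n. ennreal ((short_length W (Suc n) / exp (real (Suc n)))\<^sup>2)
           * emeasure (count_space UNIV) (J (Suc n)))"

definition W_short_cover :: "(real \<Rightarrow> real) \<Rightarrow> (nat \<Rightarrow> real set set) \<Rightarrow> real set \<Rightarrow> bool" where
  "W_short_cover W J Q \<longleftrightarrow>
     (\<forall>n\<ge>1. (\<forall>I\<in>J n. is_interval I \<and> emeasure lborel I = ennreal (short_length W n)) \<and>
            Q \<inter> ({- exp (real (n + 1))..- exp (real n)} \<union> {exp (real n)..exp (real (n + 1))})
              \<subseteq> \<Union>(J n)) \<and>
     cover_norm W J < \<infinity>"

definition sparse_norm :: "(real \<Rightarrow> real) \<Rightarrow> real set \<Rightarrow> ennreal" where
  "sparse_norm W Q =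
     (SUP t. INF J\<in>{J. W_short_cover W J ((\<lambda>x. x - t) ` Q)}. cover_norm W J)"

definition W_sparse :: "(real \<Rightarrow> real) \<Rightarrow> real set \<Rightarrow> bool" where
  "W_sparse W Q \<longleftrightarrow>
     (\<forall>t. \<exists>J. W_short_cover W J ((\<lambda>x. x - t) ` Q)) \<and> sparse_norm W Q < \<infinity>"

end

theory Submission
  imports Defs "HOL-Probability.Probability" "HOL-Real_Asymp.Real_Asymp"
begin

text \<open>
  The window of the spectrum of \<open>f\<close> around an integer \<open>t\<close> is multiplied by an entire function
  \<open>F\<^sub>t\<close> of small exponential type that is bounded below near \<open>0\<close> and of size \<open>W\<close> to a negative
  power on \<open>Q - t\<close>. In space this is a convolution with a kernel supported in
  \<open>[-\<sigma>/2, \<sigma>/2]\<close>, so on \<open>E\<close> the result only depends on \<open>f\<close> restricted to the \<open>\<sigma>\<close>-neighbourhood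
  of \<open>E\<close>. By pigeonhole, the windows whose weighted norm is at most a constant times their norm
  carry a fixed proportion of the norm of \<open>f\<close>, and the PLS property applies to each of them.

  The functions \<open>F\<^sub>t\<close> replace the Beurling--Malliavin multiplier theorem. With one bump
  \<open>\<alpha> L\<^sup>3 c\<^bsup>-2\<^esup> x\<^sup>2 / ((x - c)\<^sup>2 + L\<^sup>2)\<close> per interval of length \<open>L\<close> and centre \<open>c\<close>, the sum \<open>\<omega>\<close> of
  the bumps is nonnegative, vanishes at \<open>0\<close>, is at least \<open>\<alpha> L / 4\<close> on the interval, and is the
  real part of a sum of simple fractions. The derivative of its conjugate function \<open>v\<close> is bounded by
  \<open>\<alpha>\<close> times the norm of the short cover. The zeros of \<open>sin (\<pi>\<tau>z)\<close> are moved to the points where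
  the increasing function \<open>\<pi>\<tau>s + v(s)\<close> is an integer multiple of \<open>\<pi>\<close>. On the line \<open>Im z = 1\<close> this
  multiplies the modulus by \<open>exp (-\<omega>)\<close> up to a factor of polynomial growth, which is absorbed by
  deleting ten zeros.
\<close>

section \<open>Cauchy integrals over the real line\<close>

text \<open>The obstacle is uniformity: the final constant must not see \<open>Q\<close>,
  \<open>E\<close> or \<open>f\<close>, although a cover has infinitely many scales and its
  cardinals are controlled through the norm alone. The spectrum is therefore cut to a bounded set,
  so that finitely many windows and scales matter, and no estimate depends on how many. The limiting
  quantity is the slope of the phase. The perturbation \<open>v\<close> may use up half of the slope
  \<pi>\<tau>, where \<tau> = \<sigma>, which forces \<alpha> to be of order \<sigma> / (1 +
  \<Lambda>). Such a multiplier only beats a small power of \<open>W\<close>; this is why PLS is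
  assumed for every positive power. The summand (L / e^n)^2 of the norm is, up to constants, what
  one bump adds to the slope far from its centre, and it bounds the bump on [-1, 1]. Close to the
  centres the geometric spacing of the scales and a lattice arrangement inside each scale take over.
  log W(t) \<le> t / 4 keeps the intervals short compared with their distance to 0, and doubling
  lets the value of log W at e^n control \<open>W\<close> on the whole shell up to e^(n+1).\<close>

lemma integral_FTC_UNIV:
  fixes f F :: "real \<Rightarrow> 'a::euclidean_space"
  assumes F: "\<And>x. (F has_vector_derivative f x) (at x)"
    and f: "\<And>x. isCont f x" and int: "integrable lborel f"
    and A: "(F \<longlongrightarrow> A) at_bot" and B: "(F \<longlongrightarrow> B) at_top"
  shows "(LINT x|lborel. f x) = B - A"
proof -
  have "(LBINT x=-\<infinity>..\<infinity>. f x) = B - A"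
  proof (rule interval_integral_FTC_integrable)
    show "set_integrable lborel (einterval (-\<infinity>) \<infinity>) f"
      using int by (simp add: set_integrable_def)
    show "((F \<circ> real_of_ereal) \<longlongrightarrow> A) (at_right (-\<infinity>))"
      using A by (simp add: ereal_tendsto_simps)
    show "((F \<circ> real_of_ereal) \<longlongrightarrow> B) (at_left \<infinity>)"
      using B by (simp add: ereal_tendsto_simps)
  qed (use F f in auto)
  then show ?thesis by (simp add: interval_lebesgue_integral_def set_lebesgue_integral_def)
qed

lemma one_plus_square_le_cmod:
  fixes z :: complex
  assumes "Im z \<noteq> 0"
  obtains C where "C > 0" "\<And>s::real. 1 + s\<^sup>2 \<le> C * (cmod (of_real s - z))\<^sup>2"
proof
  let ?a = "Re z" and ?b = "Im z"
  let ?C = "2 + (1 + 2 * ?a\<^sup>2) / ?b\<^sup>2"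
  show "?C > 0" using assms by (auto intro!: add_pos_nonneg)
  fix s :: real
  have b: "?b\<^sup>2 > 0" using assms by simp
  have "s\<^sup>2 \<le> 2 * (s - ?a)\<^sup>2 + 2 * ?a\<^sup>2"
    using zero_le_power2[of "s - 2 * ?a"] by (simp add: power2_eq_square algebra_simps)
  then have "1 + s\<^sup>2 \<le> 2 * (s - ?a)\<^sup>2 + (1 + 2 * ?a\<^sup>2) / ?b\<^sup>2 * ?b\<^sup>2" using assms by simp
  also have "\<dots> \<le> 2 * ((s - ?a)\<^sup>2 + ?b\<^sup>2) + (1 + 2 * ?a\<^sup>2) / ?b\<^sup>2 * ((s - ?a)\<^sup>2 + ?b\<^sup>2)"
    using b by (intro add_mono mult_left_mono) auto
  also have "\<dots> = ?C * ((s - ?a)\<^sup>2 + ?b\<^sup>2)" by (simp add: distrib_right)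
  finally show "1 + s\<^sup>2 \<le> ?C * (cmod (of_real s - z))\<^sup>2" by (simp add: cmod_power2)
qed

lemma integrable_inverse_1_plus_square_UNIV: "integrable lborel (\<lambda>s::real. inverse (1 + s\<^sup>2))"
  using integrable_inverse_1_plus_square by (simp add: set_integrable_def)

lemma of_real_minus_nonreal_neq_0:
  assumes "Im z \<noteq> 0" shows "of_real s - z \<noteq> 0"
  using assms by (auto simp: complex_eq_iff)

lemma cauchy_kernel_square_le: 
  fixes z :: complex
  assumes "Im z \<noteq> 0"
  obtains C where "C > 0" "\<And>s::real. (cmod (1 / (of_real s - z)))\<^sup>2 \<le> C * inverse (1 + s\<^sup>2)"
proof -
  obtain C where C: "C > 0" "\<And>s::real. 1 + s\<^sup>2 \<le> C * (cmod (of_real s - z))\<^sup>2"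
    using one_plus_square_le_cmod[OF assms] by blast
  have "(cmod (1 / (of_real s - z)))\<^sup>2 \<le> C * inverse (1 + s\<^sup>2)" for s
  proof -
    have p: "cmod (of_real s - z) > 0" using of_real_minus_nonreal_neq_0[OF assms] by simp
    have q: "1 + s\<^sup>2 > 0" by (simp add: add_pos_nonneg)
    show ?thesis using C(2)[of s] p q by (simp add: norm_divide field_simps)
  qed
  then show ?thesis using C that by blast
qed

lemma integrable_cauchy_kernel_product:
  assumes "Im p \<noteq> 0" "Im z \<noteq> 0"
  shows "integrable lborel (\<lambda>s::real. 1 / ((of_real s - p) * (of_real s - z)))"
proof -
  obtain C where C: "C > 0" "\<And>s::real. (cmod (1 / (of_real s - p)))\<^sup>2 \<le> C * inverse (1 + s\<^sup>2)"
    using cauchy_kernel_square_le[OF assms(1)] by blast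
  obtain D where D: "D > 0" "\<And>s::real. (cmod (1 / (of_real s - z)))\<^sup>2 \<le> D * inverse (1 + s\<^sup>2)"
    using cauchy_kernel_square_le[OF assms(2)] by blast
  show ?thesis
  proof (rule Bochner_Integration.integrable_bound)
    show "integrable lborel (\<lambda>s. (C + D) * inverse (1 + s\<^sup>2))"
      using integrable_inverse_1_plus_square_UNIV by simp
    show "AE s in lborel. norm (1 / ((of_real s - p) * (of_real s - z))) \<le> norm ((C + D) * inverse (1 + s\<^sup>2))"
    proof (rule AE_I2)
      fix s :: real
      let ?x = "cmod (1 / (of_real s - p))" and ?y = "cmod (1 / (of_real s - z))"
      have "0 \<le> (?x - ?y)\<^sup>2" by simp
      then have "2 * (?x * ?y) \<le> ?x\<^sup>2 + ?y\<^sup>2" by (simp add: power2_eq_square algebra_simps)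
      also have "\<dots> \<le> (C + D) * inverse (1 + s\<^sup>2)" using C(2)[of s] D(2)[of s] by (simp add: algebra_simps)
      finally have *: "2 * (?x * ?y) \<le> (C + D) * inverse (1 + s\<^sup>2)" .
      have "?x * ?y \<ge> 0" by simp
      then have "?x * ?y \<le> (C + D) * inverse (1 + s\<^sup>2)" using * by linarith
      then show "norm (1 / ((of_real s - p) * (of_real s - z))) \<le> norm ((C + D) * inverse (1 + s\<^sup>2))"
        by (simp add: norm_divide norm_mult)
    qed
  qed measurable
qed

lemma tendsto_one_plus_divide_at_top: "((\<lambda>s::real. c + z / of_real s) \<longlongrightarrow> (c::complex)) at_top"
proof -
  have "((\<lambda>s::real. c + z * of_real (inverse s)) \<longlongrightarrow> c + z * of_real 0) at_top"
    by (intro tendsto_intros tendsto_inverse_0_at_top filterlim_ident)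
  then show ?thesis by (simp add: divide_inverse)
qed

lemma Ln_diff_at_top:
  assumes "Im z \<noteq> 0" "Im p \<noteq> 0"
  shows "((\<lambda>s::real. Ln (of_real s - z) - Ln (of_real s - p)) \<longlongrightarrow> 0) at_top"
proof -
  have *: "((\<lambda>s::real. Ln (1 + (-z) / of_real s)) \<longlongrightarrow> Ln 1) at_top" for z
    by (intro tendsto_Ln tendsto_one_plus_divide_at_top) simp
  have "((\<lambda>s::real. Ln (1 + (-z) / of_real s) - Ln (1 + (-p) / of_real s)) \<longlongrightarrow> Ln 1 - Ln 1) at_top"
    by (intro tendsto_diff *)
  moreover have "\<forall>\<^sub>F s in at_top. Ln (1 + (-z) / of_real s) - Ln (1 + (-p) / of_real s)
      = Ln (of_real s - z) - Ln (of_real s - p)"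
    using eventually_gt_at_top[of "0::real"]
  proof eventually_elim
    case (elim s)
    have "Ln (of_real s - w) = of_real (ln s) + Ln (1 + (-w) / of_real s)" if "Im w \<noteq> 0" for w
    proof -
      have "of_real s - w = of_real s * (1 + (-w) / of_real s)" using elim by (simp add: field_simps)
      moreover have "1 + (-w) / of_real s \<noteq> 0"
        using of_real_minus_nonreal_neq_0[OF that, of s] elim by (simp add: field_simps)
      ultimately show ?thesis using Ln_times_of_real[of s "1 + (-w) / of_real s"] elim Ln_of_real[of s] by metis
    qed
    then show ?case using assms by simp
  qed
  ultimately show ?thesis by (simp add: tendsto_cong)
qed

text \<open>Far to the left the argument of \<open>s - z\<close> tends to -\<pi>, because
  \<open>z\<close> lies above the axis, while that of \<open>s - p\<close> tends to \<pi> when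
  \<open>p\<close> lies below. The branch cut of \<open>Ln\<close> supplies the 2 \<pi> \<i> that a
  residue would give.\<close>

lemma Ln_diff_at_bot:
  assumes "Im z > 0" "Im p \<noteq> 0"
  shows "((\<lambda>s::real. Ln (of_real s - z) - Ln (of_real s - p)) \<longlongrightarrow> (if Im p < 0 then - 2 * pi * \<i> else 0)) at_bot"
proof -
  have Lnm: "Ln (of_real (-s) - w) = Ln (of_real s - (-w)) + (if Im w < 0 then \<i> * pi else - \<i> * pi)"
    if "Im w \<noteq> 0" for w and s :: real
  proof -
    have "Ln (- (of_real s - (-w))) = (if Im w < 0 then Ln (of_real s - (-w)) + \<i> * pi else Ln (of_real s - (-w)) - \<i> * pi)"
      using that of_real_minus_nonreal_neq_0[of "-w" s] by (subst Ln_minus) auto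
    moreover have "- (of_real s - (-w)) = of_real (-s) - w" by simp
    ultimately show ?thesis by (auto split: if_splits)
  qed
  have "((\<lambda>s::real. Ln (of_real s - (-z)) - Ln (of_real s - (-p)) + ((if Im z < 0 then \<i> * pi else - \<i> * pi) - (if Im p < 0 then \<i> * pi else - \<i> * pi)))
     \<longlongrightarrow> 0 + ((if Im z < 0 then \<i> * pi else - \<i> * pi) - (if Im p < 0 then \<i> * pi else - \<i> * pi))) at_top"
    using assms by (intro tendsto_add Ln_diff_at_top tendsto_const) auto
  then have "((\<lambda>s::real. Ln (of_real (-s) - z) - Ln (of_real (-s) - p)) \<longlongrightarrow> 0 + ((if Im z < 0 then \<i> * pi else - \<i> * pi) - (if Im p < 0 then \<i> * pi else - \<i> * pi))) at_top"
    using assms by (subst Lnm, simp, subst Lnm, simp, simp add: algebra_simps)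
  then have "((\<lambda>s::real. Ln (of_real s - z) - Ln (of_real s - p)) \<longlongrightarrow> 0 + ((if Im z < 0 then \<i> * pi else - \<i> * pi) - (if Im p < 0 then \<i> * pi else - \<i> * pi))) at_bot"
    by (subst filterlim_at_bot_mirror) simp
  then show ?thesis using assms by (auto split: if_splits simp: algebra_simps)
qed

lemma isCont_cauchy_kernel_product:
  assumes "Im p \<noteq> 0" "Im z \<noteq> 0"
  shows "isCont (\<lambda>s::real. 1 / ((of_real s - p) * (of_real s - z))) x"
  using of_real_minus_nonreal_neq_0[OF assms(1)] of_real_minus_nonreal_neq_0[OF assms(2)]
  by (intro continuous_intros) auto

lemma Ln_has_vector_derivative:
  assumes "Im z \<noteq> 0"
  shows "((\<lambda>s. Ln (of_real s - z)) has_vector_derivative 1 / (of_real s - z)) (at s)"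
proof -
  have nz: "of_real s - z \<notin> \<real>\<^sub>\<le>\<^sub>0" using assms by (auto simp: complex_nonpos_Reals_iff)
  have "((\<lambda>w. Ln (w - z)) has_field_derivative 1 / (of_real s - z)) (at (of_real s))"
    using nz by (auto intro!: derivative_eq_intros simp: divide_inverse)
  then show ?thesis by (rule has_vector_derivative_real_field)
qed

lemma inverse_diff_divide:
  fixes x y :: "'a::field"
  assumes "x \<noteq> 0" "y \<noteq> 0" "y - x \<noteq> 0"
  shows "(1 / x - 1 / y) / (y - x) = 1 / (y * x)"
  using assms by (simp add: divide_simps)

text \<open>By partial fractions a difference of two logarithms is a primitive on the whole line,
  since for real \<open>s\<close> neither \<open>s - z\<close> nor \<open>s - p\<close> meets the
  cut of \<open>Ln\<close>. The fundamental theorem of calculus takes the place of a contour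
  integral.\<close>

lemma cauchy_kernel_product_distinct:
  assumes "Im z > 0" "Im p \<noteq> 0" "z \<noteq> p"
  shows "(LINT s|lborel. 1 / ((of_real s - p) * (of_real s - z))) = (if Im p < 0 then 2 * pi * \<i> / (z - p) else 0)"
proof -
  have zp: "z - p \<noteq> 0" using assms by auto
  have nz: "of_real s - z \<noteq> 0" "of_real s - p \<noteq> 0" for s
    using of_real_minus_nonreal_neq_0 assms by auto
  define c where "c = (if Im p < 0 then - 2 * pi * \<i> else 0)"
  have "(LINT s|lborel. 1 / ((of_real s - p) * (of_real s - z))) = 0 / (z - p) - c / (z - p)"
  proof (rule integral_FTC_UNIV)
    fix s :: real
    have "((\<lambda>s. (Ln (of_real s - z) - Ln (of_real s - p)) / (z - p)) has_vector_derivative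
        (1 / (of_real s - z) - 1 / (of_real s - p)) / (z - p)) (at s)"
      using assms by (intro has_vector_derivative_divide has_vector_derivative_diff Ln_has_vector_derivative) auto
    moreover have "(1 / (of_real s - z) - 1 / (of_real s - p)) / (z - p) = 1 / ((of_real s - p) * (of_real s - z))"
      using inverse_diff_divide[of "of_real s - z" "of_real s - p"] zp nz by simp
    ultimately show "((\<lambda>s. (Ln (of_real s - z) - Ln (of_real s - p)) / (z - p)) has_vector_derivative
        1 / ((of_real s - p) * (of_real s - z))) (at s)" by simp
  next
    show "((\<lambda>s. (Ln (of_real s - z) - Ln (of_real s - p)) / (z - p)) \<longlongrightarrow> 0 / (z - p)) at_top"
      using assms by (intro tendsto_divide Ln_diff_at_top tendsto_const zp) auto
    show "((\<lambda>s. (Ln (of_real s - z) - Ln (of_real s - p)) / (z - p)) \<longlongrightarrow> c / (z - p)) at_bot"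
      unfolding c_def using assms by (intro tendsto_divide Ln_diff_at_bot tendsto_const zp)
  qed (use assms in \<open>auto intro!: integrable_cauchy_kernel_product isCont_cauchy_kernel_product\<close>)
  then show ?thesis by (simp add: c_def)
qed

lemma cauchy_kernel_product_opposite:
  assumes "Im z > 0" "Im p < 0"
  shows "(LINT s|lborel. 1 / ((of_real s - p) * (of_real s - z))) = 2 * pi * \<i> / (z - p)"
  using cauchy_kernel_product_distinct[of z p] assms by force

lemma cauchy_kernel_product_same:
  assumes "Im z > 0" "Im p > 0"
  shows "(LINT s|lborel. 1 / ((of_real s - p) * (of_real s - z))) = 0"
proof (cases "z = p")
  case False
  then show ?thesis using cauchy_kernel_product_distinct[of z p] assms by simp
next
  case True
  have nz: "of_real s - z \<noteq> 0" for s
    using of_real_minus_nonreal_neq_0 assms by auto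
  have lim: "((\<lambda>s::real. -1 / (of_real s - z)) \<longlongrightarrow> 0) F" if "filterlim (\<lambda>s::real. s) at_infinity F" for F
  proof -
    have "filterlim (\<lambda>s::real. complex_of_real s - z) at_infinity F"
      unfolding filterlim_at_infinity_conv_norm_at_top
    proof (rule filterlim_at_top_mono)
      have "filterlim (\<lambda>s::real. norm s) at_top F"
        using that by (simp add: filterlim_at_infinity_conv_norm_at_top)
      then show "filterlim (\<lambda>s::real. (- cmod z) + norm s) at_top F"
        by (intro filterlim_tendsto_add_at_top[OF tendsto_const])
      show "\<forall>\<^sub>F s in F. - cmod z + norm s \<le> cmod (complex_of_real s - z)"
      proof (intro always_eventually allI)
        fix s :: real
        show "- cmod z + norm s \<le> cmod (complex_of_real s - z)"
          using norm_triangle_ineq2[of "complex_of_real s" z] by simp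
      qed
    qed
    then show ?thesis by (intro tendsto_divide_0[OF tendsto_const])
  qed
  have "(LINT s|lborel. 1 / ((of_real s - p) * (of_real s - z))) = 0 - 0"
  proof (rule integral_FTC_UNIV)
    fix s :: real
    have "((\<lambda>w. -1 / (w - z)) has_field_derivative 1 / ((of_real s - z) * (of_real s - z))) (at (of_real s))"
      using nz[of s] by (auto intro!: derivative_eq_intros simp: field_simps)
    then show "((\<lambda>s. -1 / (of_real s - z)) has_vector_derivative
        1 / ((of_real s - p) * (of_real s - z))) (at s)" 
      using True has_vector_derivative_real_field by blast
    show "((\<lambda>s::real. -1 / (of_real s - z)) \<longlongrightarrow> 0) at_top"
      by (intro lim filterlim_at_top_imp_at_infinity filterlim_ident)
    show "((\<lambda>s::real. -1 / (of_real s - z)) \<longlongrightarrow> 0) at_bot"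
      by (intro lim filterlim_at_bot_imp_at_infinity filterlim_ident)
  qed (use assms in \<open>auto intro!: integrable_cauchy_kernel_product isCont_cauchy_kernel_product\<close>)
  then show ?thesis by simp
qed

text \<open>
  The real part of the Cauchy kernel \<open>1 / (s - z)\<close> at \<open>z = a + \<i>\<close>. Entire functions are only
  estimated on the line \<open>Im z = 1\<close>, which stays away from their real zeros.
\<close>

definition conj_kernel :: "real \<Rightarrow> real \<Rightarrow> real" where
  "conj_kernel a s = (s - a) / ((s - a)\<^sup>2 + 1)"

lemma conj_kernel_eq_Re: "conj_kernel a s = Re (1 / (of_real s - Complex a 1))"
  by (simp add: conj_kernel_def Re_divide)

lemma conj_kernel_diff:
  "conj_kernel a s - conj_kernel 0 s = a * (s\<^sup>2 - a * s - 1) / (((s - a)\<^sup>2 + 1) * (s\<^sup>2 + 1))"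
proof -
  have "(s - a)\<^sup>2 + 1 \<noteq> 0" "s\<^sup>2 + 1 \<noteq> 0" by (auto simp: add_nonneg_eq_0_iff)
  then show ?thesis unfolding conj_kernel_def
    by (simp add: divide_simps) (simp add: power2_eq_square algebra_simps)
qed

lemma continuous_conj_kernel: "continuous_on UNIV (conj_kernel a)"
  unfolding conj_kernel_def by (intro continuous_intros) (auto simp: add_nonneg_eq_0_iff)

lemma borel_measurable_conj_kernel [measurable]: "conj_kernel a \<in> borel_measurable borel"
  using continuous_conj_kernel by (rule borel_measurable_continuous_onI)

text \<open>A single \<open>conj_kernel a\<close> decays only like 1 / s. Subtracting the kernel for
  \<open>a = 0\<close> gains one order, which is why phases and moduli are later compared with those
  at \<open>a = 0\<close>.\<close>

lemma integrable_conj_kernel_diff: "integrable lborel (\<lambda>s. conj_kernel a s - conj_kernel 0 s)"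
proof -
  have eq: "conj_kernel a s - conj_kernel 0 s = Re (of_real a * (1 / ((of_real s - Complex a 1) * (of_real s - Complex 0 1))))" for s
  proof -
    have nz: "of_real s - Complex a 1 \<noteq> 0" "of_real s - Complex 0 1 \<noteq> 0"
      by (auto simp: complex_eq_iff)
    have "of_real a * (1 / ((of_real s - Complex a 1) * (of_real s - Complex 0 1))) 
      = 1 / (of_real s - Complex a 1) - 1 / (of_real s - Complex 0 1)"
      using nz by (simp add: divide_simps) (simp add: complex_eq_iff)
    then show ?thesis by (simp only: conj_kernel_eq_Re minus_complex.simps)
  qed
  show ?thesis unfolding eq
    by (intro integrable_Re integrable_mult_right integrable_cauchy_kernel_product) auto
qed

lemma conj_kernel_diff_antiderivative:
  "((\<lambda>s. (ln ((s - a)\<^sup>2 + 1) - ln (s\<^sup>2 + 1)) / 2) has_real_derivative conj_kernel a s - conj_kernel 0 s) (at s)"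
proof -
  have "(s - a)\<^sup>2 + 1 > 0" "s\<^sup>2 + 1 > 0" by (auto simp: add_nonneg_pos)
  then show ?thesis unfolding conj_kernel_def
    by (auto intro!: derivative_eq_intros simp: divide_simps) 
qed

text \<open>The integral is the total variation of the antiderivative \<open>H\<close>, which climbs
  from 0 to \<open>ln r\<close> at \<open>q\<close>, drops to \<open>- ln r\<close> at
  \<open>r\<close> and returns to 0. The growth in \<open>a\<close> is logarithmic, so that a
  bounded error in the count of zeros costs only a polynomial factor.\<close>

lemma integral_abs_conj_kernel_diff_pos:
  assumes a: "a > 0"
  shows "(LINT s|lborel. \<bar>conj_kernel a s - conj_kernel 0 s\<bar>) \<le> 4 * ln (1 + a)"
proof -
  define D where "D s = conj_kernel a s - conj_kernel 0 s" for s
  define H where "H s = (ln ((s - a)\<^sup>2 + 1) - ln (s\<^sup>2 + 1)) / 2" for s :: real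
  have dH: "(H has_real_derivative D s) (at s)" for s
    unfolding H_def D_def by (rule conj_kernel_diff_antiderivative)
  \<comment> \<open>\<open>r\<close> and \<open>q = a - r\<close> are the roots of s^2 - a s - 1,
    the factor of \<open>conj_kernel_diff\<close> that decides the sign. Their product is -1, which
    makes \<open>H q\<close> and \<open>H r\<close> opposite.\<close>
  define r where "r = (a + sqrt (a\<^sup>2 + 4)) / 2"
  have ra: "r \<ge> a" "r > 1" "r \<le> 1 + a"
  proof -
    have "sqrt (a\<^sup>2 + 4) \<ge> a" by (rule real_le_rsqrt) simp
    then show "r \<ge> a" by (simp add: r_def)
    have "sqrt (a\<^sup>2 + 4) > sqrt (2\<^sup>2)" using a by (intro real_sqrt_less_mono) simp
    then show "r > 1" using a by (simp add: r_def)
    have "sqrt (a\<^sup>2 + 4) \<le> a + 2" using a by (intro real_le_lsqrt) (auto simp: power2_eq_square algebra_simps)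
    then show "r \<le> 1 + a" by (simp add: r_def)
  qed
  have r2: "r\<^sup>2 - a * r - 1 = 0"
  proof -
    have "(sqrt (a\<^sup>2 + 4))\<^sup>2 = a\<^sup>2 + 4" by simp
    then show ?thesis unfolding r_def by (simp add: power2_eq_square field_simps)
  qed
  define q where "q = a - r"
  have rq: "r * q = - 1" using r2 by (simp add: q_def power2_eq_square algebra_simps)
  have qr: "q < r" using ra a by (simp add: q_def)
  have fact: "s\<^sup>2 - a * s - 1 = (s - r) * (s - q)" for s
    using rq by (simp add: q_def power2_eq_square algebra_simps)
  have dpos: "((s - a)\<^sup>2 + 1) * (s\<^sup>2 + 1) > 0" for s
    by (intro mult_pos_pos add_nonneg_pos) auto
  have D_eq: "D s = a * ((s - r) * (s - q)) / (((s - a)\<^sup>2 + 1) * (s\<^sup>2 + 1))" for s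
    unfolding D_def conj_kernel_diff fact ..
  have D_nonneg: "D s \<ge> 0" if "s \<le> q \<or> s \<ge> r" for s
  proof -
    have "0 \<le> (s - r) * (s - q)"
      using that qr by (auto intro: mult_nonneg_nonneg mult_nonpos_nonpos)
    then have "0 \<le> a * ((s - r) * (s - q))" using a by (intro mult_nonneg_nonneg[of a]) auto
    then show ?thesis using dpos[of s] unfolding D_eq by (rule divide_nonneg_pos)
  qed
  have D_nonpos: "D s \<le> 0" if "q \<le> s" "s \<le> r" for s
  proof -
    have "(s - r) * (s - q) \<le> 0" using that by (intro mult_nonpos_nonneg) auto
    then have "a * ((s - r) * (s - q)) \<le> 0" using a by (intro mult_nonneg_nonpos[of a]) auto
    then show ?thesis using dpos[of s] unfolding D_eq by (rule divide_nonpos_pos)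
  qed
  have D_int: "integrable lborel D" unfolding D_def by (rule integrable_conj_kernel_diff)
  have D_cont: "isCont D s" for s
    using continuous_conj_kernel unfolding D_def[abs_def]
    by (intro continuous_intros) (auto simp: continuous_on_eq_continuous_at)
  have ratio: "((\<lambda>s. ((s - a)\<^sup>2 + 1) / (s\<^sup>2 + 1)) \<longlongrightarrow> 1) at_top" for a :: real
    by real_asymp
  have H_ln: "H s = ln (((s - a)\<^sup>2 + 1) / (s\<^sup>2 + 1)) / 2" for s
    unfolding H_def by (subst ln_div) (auto simp: add_nonneg_pos add_nonneg_eq_0_iff)
  have H_top: "(H \<longlongrightarrow> 0) at_top"
  proof -
    have "((\<lambda>s. ln (((s - a)\<^sup>2 + 1) / (s\<^sup>2 + 1)) / 2) \<longlongrightarrow> ln 1 / 2) at_top"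
      by (intro tendsto_intros ratio) auto
    then show ?thesis unfolding H_ln[abs_def] by simp
  qed
  have H_bot: "(H \<longlongrightarrow> 0) at_bot"
  proof -
    have "((\<lambda>s. ln (((s - (-a))\<^sup>2 + 1) / (s\<^sup>2 + 1)) / 2) \<longlongrightarrow> ln 1 / 2) at_top"
      by (intro tendsto_intros ratio) auto
    moreover have "((s - (-a))\<^sup>2 + 1) = ((- s - a)\<^sup>2 + 1)" for s by (simp add: power2_eq_square algebra_simps)
    ultimately show ?thesis unfolding H_ln[abs_def] by (subst filterlim_at_bot_mirror) simp
  qed
  have qa: "q - a = - r" "r - a = - q" by (auto simp: q_def)
  have qinv: "q = - 1 / r" using rq ra by (simp add: field_simps)
  have q2: "q\<^sup>2 + 1 = (r\<^sup>2 + 1) / r\<^sup>2" using ra unfolding qinv by (simp add: field_simps)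
  have lnq2: "ln (q\<^sup>2 + 1) = ln (r\<^sup>2 + 1) - 2 * ln r"
    unfolding q2 using ra by (subst ln_div) (auto simp: ln_realpow add_nonneg_pos add_nonneg_eq_0_iff)
  have Hq: "H q = ln r" unfolding H_def qa lnq2 by simp
  have Hr: "H r = - ln r" unfolding H_def qa by (simp add: lnq2)
  have i1: "(LBINT s=-\<infinity>..q. D s) = H q - 0"
  proof (rule interval_integral_FTC_integrable)
    show "set_integrable lborel (einterval (- \<infinity>) q) D"
      unfolding set_integrable_def by (rule integrable_mult_indicator[OF _ D_int]) simp
    show "((H \<circ> real_of_ereal) \<longlongrightarrow> 0) (at_right (-\<infinity>))" using H_bot by (simp add: ereal_tendsto_simps)
    have "isCont H q" using dH DERIV_isCont by blast
    then show "((H \<circ> real_of_ereal) \<longlongrightarrow> H q) (at_left (ereal q))" 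
      by (simp add: ereal_tendsto_simps isCont_def filterlim_at_split)
  qed (use dH D_cont in \<open>auto simp: has_real_derivative_iff_has_vector_derivative\<close>)
  have i3: "(LBINT s=r..\<infinity>. D s) = 0 - H r"
  proof (rule interval_integral_FTC_integrable)
    show "set_integrable lborel (einterval r \<infinity>) D"
      unfolding set_integrable_def by (rule integrable_mult_indicator[OF _ D_int]) simp
    show "((H \<circ> real_of_ereal) \<longlongrightarrow> 0) (at_left \<infinity>)" using H_top by (simp add: ereal_tendsto_simps)
    have "isCont H r" using dH DERIV_isCont by blast
    then show "((H \<circ> real_of_ereal) \<longlongrightarrow> H r) (at_right (ereal r))" 
      by (simp add: ereal_tendsto_simps isCont_def filterlim_at_split)
  qed (use dH D_cont in \<open>auto simp: has_real_derivative_iff_has_vector_derivative\<close>)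
  have i2: "(LBINT s=q..r. D s) = H r - H q"
    using dH D_cont qr by (intro interval_integral_FTC_finite)
      (auto simp: has_real_derivative_iff_has_vector_derivative continuous_at_imp_continuous_on intro: has_vector_derivative_at_within)
  have a_int: "interval_lebesgue_integrable lborel u v (\<lambda>s. \<bar>D s\<bar>)" for u v
    unfolding interval_lebesgue_integrable_def set_integrable_def
    by (auto intro!: integrable_mult_indicator[OF _ integrable_abs[OF D_int], unfolded real_scaleR_def])
  have "(LINT s|lborel. \<bar>D s\<bar>) = (LBINT s=-\<infinity>..\<infinity>. \<bar>D s\<bar>)"
    by (simp add: interval_lebesgue_integral_def set_lebesgue_integral_def)
  also have "\<dots> = (LBINT s=-\<infinity>..q. \<bar>D s\<bar>) + (LBINT s=q..r. \<bar>D s\<bar>) + (LBINT s=r..\<infinity>. \<bar>D s\<bar>)"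
    by (simp add: interval_integral_sum a_int)
  also have "(LBINT s=-\<infinity>..q. \<bar>D s\<bar>) = (LBINT s=-\<infinity>..q. D s)"
    by (rule interval_integral_cong) (auto simp: einterval_iff D_nonneg)
  also have "(LBINT s=r..\<infinity>. \<bar>D s\<bar>) = (LBINT s=r..\<infinity>. D s)"
    by (rule interval_integral_cong) (auto simp: einterval_iff D_nonneg)
  also have "(LBINT s=q..r. \<bar>D s\<bar>) = (LBINT s=q..r. - D s)"
    using qr by (intro interval_integral_cong) (auto simp: einterval_iff D_nonpos)
  also have "(LBINT s=q..r. - D s) = - (LBINT s=q..r. D s)" using qr
    by (simp add: interval_lebesgue_integral_def set_lebesgue_integral_def)
  finally have "(LINT s|lborel. \<bar>D s\<bar>) = 4 * ln r" unfolding i1 i2 i3 Hq Hr by simp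
  also have "\<dots> \<le> 4 * ln (1 + a)" using ra a by simp
  finally show ?thesis unfolding D_def .
qed

lemma conj_kernel_uminus: "conj_kernel (-a) s = - conj_kernel a (- s)"
  by (simp add: conj_kernel_def power2_eq_square algebra_simps divide_simps)

lemma integral_abs_conj_kernel_diff:
  "(LINT s|lborel. \<bar>conj_kernel a s - conj_kernel 0 s\<bar>) \<le> 4 * ln (1 + \<bar>a\<bar>)"
proof -
  consider "a > 0" | "a = 0" | "a < 0" by linarith
  then show ?thesis
  proof cases
    case 3
    have "conj_kernel a s - conj_kernel 0 s = - (conj_kernel (-a) (-s) - conj_kernel 0 (-s))" for s
      using conj_kernel_uminus[of "-a" s] conj_kernel_uminus[of 0 s] by simp
    then have "(LINT s|lborel. \<bar>conj_kernel a s - conj_kernel 0 s\<bar>) = (LINT s|lborel. \<bar>conj_kernel (-a) (-s) - conj_kernel 0 (-s)\<bar>)"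
      by (metis (no_types, lifting) abs_minus_cancel)
    also have "\<dots> = (LINT s|lborel. \<bar>conj_kernel (-a) s - conj_kernel 0 s\<bar>)"
      using lborel_integral_real_affine[of "-1" "\<lambda>s. \<bar>conj_kernel (-a) s - conj_kernel 0 s\<bar>" 0] by simp
    also have "\<dots> \<le> 4 * ln (1 + (-a))" using integral_abs_conj_kernel_diff_pos[of "-a"] 3 by simp
    finally show ?thesis using 3 by simp
  qed (auto intro: integral_abs_conj_kernel_diff_pos)
qed

section \<open>Fourier transforms of compactly supported functions\<close>

text \<open>The transform is taken at complex points, because zeros are moved on the real line while
  the function is read off on Im z = 1. Carrying a continuous density through all operations yields
  support and integrability in space directly, in place of the Paley-Wiener theorem.\<close>

definition bandlimited :: "real \<Rightarrow> (complex \<Rightarrow> complex) \<Rightarrow> bool" where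
  "bandlimited \<delta> F \<longleftrightarrow> (\<exists>\<psi>. continuous_on {-\<delta>..\<delta>} \<psi> \<and>
     (\<forall>z. F z = integral {-\<delta>..\<delta>} (\<lambda>t. \<psi> t * exp (- 2 * of_real pi * \<i> * z * of_real t))))"

lemma has_vector_derivative_exp_linear:
  fixes c :: complex
  shows "((\<lambda>t::real. exp (c * of_real t)) has_vector_derivative c * exp (c * of_real t)) (at t within S)"
proof -
  have "((\<lambda>w. exp (c * w)) has_field_derivative c * exp (c * of_real t)) (at (of_real t))"
    by (auto intro!: derivative_eq_intros)
  then show ?thesis by (rule has_vector_derivative_real_field[where f = "\<lambda>w. exp (c * w)"])
qed

lemma bandlimited_cmult:
  assumes "bandlimited \<delta> F" shows "bandlimited \<delta> (\<lambda>z. c * F z)"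
proof -
  obtain \<psi> where \<psi>: "continuous_on {-\<delta>..\<delta>} \<psi>"
    "\<And>z. F z = integral {-\<delta>..\<delta>} (\<lambda>t. \<psi> t * exp (- 2 * of_real pi * \<i> * z * of_real t))"
    using assms unfolding bandlimited_def by blast
  show ?thesis unfolding bandlimited_def
    by (rule exI[of _ "\<lambda>t. c * \<psi> t"]) (auto intro!: continuous_intros \<psi>(1) simp: \<psi>(2) mult.assoc)
qed

lemma bandlimited_add:
  assumes "bandlimited \<delta> F" "bandlimited \<delta> G" shows "bandlimited \<delta> (\<lambda>z. F z + G z)"
proof -
  obtain \<psi> where \<psi>: "continuous_on {-\<delta>..\<delta>} \<psi>"
    "\<And>z. F z = integral {-\<delta>..\<delta>} (\<lambda>t. \<psi> t * exp (- 2 * of_real pi * \<i> * z * of_real t))"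
    using assms unfolding bandlimited_def by blast
  obtain \<phi> where \<phi>: "continuous_on {-\<delta>..\<delta>} \<phi>"
    "\<And>z. G z = integral {-\<delta>..\<delta>} (\<lambda>t. \<phi> t * exp (- 2 * of_real pi * \<i> * z * of_real t))"
    using assms unfolding bandlimited_def by blast
  have "F z + G z = integral {-\<delta>..\<delta>} (\<lambda>t. (\<psi> t + \<phi> t) * exp (- 2 * of_real pi * \<i> * z * of_real t))" for z
    unfolding \<psi>(2) \<phi>(2) distrib_right
    by (subst integral_add) (auto intro!: integrable_continuous_interval continuous_intros \<psi>(1) \<phi>(1))
  then show ?thesis unfolding bandlimited_def
    by (intro exI[of _ "\<lambda>t. \<psi> t + \<phi> t"]) (auto intro!: continuous_intros \<psi>(1) \<phi>(1))
qed

lemma bandlimited_shift: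
  assumes "bandlimited \<delta> F" shows "bandlimited \<delta> (\<lambda>z. F (z + w))"
proof -
  obtain \<psi> where \<psi>: "continuous_on {-\<delta>..\<delta>} \<psi>"
    "\<And>z. F z = integral {-\<delta>..\<delta>} (\<lambda>t. \<psi> t * exp (- 2 * of_real pi * \<i> * z * of_real t))"
    using assms unfolding bandlimited_def by blast
  have "F (z + w) = integral {-\<delta>..\<delta>} (\<lambda>t. (\<psi> t * exp (- 2 * of_real pi * \<i> * w * of_real t)) * exp (- 2 * of_real pi * \<i> * z * of_real t))" for z
    unfolding \<psi>(2) by (intro integral_cong) (simp add: ring_distribs exp_diff exp_minus field_simps)
  then show ?thesis unfolding bandlimited_def
    by (intro exI[of _ "\<lambda>t. \<psi> t * exp (- 2 * of_real pi * \<i> * w * of_real t)"]) (auto intro!: continuous_intros \<psi>(1))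
qed

text \<open>The density is the constant 1. The identity is kept in product form because the quotient
  is singular at 0.\<close>

lemma bandlimited_sin:
  assumes "\<delta> > 0"
  shows "\<exists>F. bandlimited \<delta> F \<and> (\<forall>z. of_real pi * z * F z = sin (2 * of_real pi * of_real \<delta> * z))"
proof (intro exI conjI allI)
  let ?F = "\<lambda>z::complex. integral {-\<delta>..\<delta>} (\<lambda>t. 1 * exp (- 2 * of_real pi * \<i> * z * of_real t))"
  show "bandlimited \<delta> ?F" unfolding bandlimited_def
    by (rule exI[of _ "\<lambda>_. 1"]) (auto intro!: continuous_intros)
  fix z :: complex
  let ?e = "\<lambda>t. exp (- 2 * of_real pi * \<i> * z * of_real t)"
  have "((\<lambda>t. (- 2 * of_real pi * \<i> * z) * ?e t) has_integral ?e \<delta> - ?e (-\<delta>)) {-\<delta>..\<delta>}"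
  proof (rule fundamental_theorem_of_calculus)
    show "(?e has_vector_derivative (- 2 * of_real pi * \<i> * z) * ?e t) (at t within {-\<delta>..\<delta>})" for t
      by (rule has_vector_derivative_exp_linear)
  qed (use assms in auto)
  then have "integral {-\<delta>..\<delta>} (\<lambda>t. (- 2 * of_real pi * \<i> * z) * ?e t) = ?e \<delta> - ?e (-\<delta>)" by (rule integral_unique)
  then have eq: "(- 2 * of_real pi * \<i> * z) * ?F z = ?e \<delta> - ?e (-\<delta>)" by simp
  have s: "sin (2 * of_real pi * of_real \<delta> * z) = (?e (-\<delta>) - ?e \<delta>) / (2 * \<i>)"
    by (simp add: sin_exp_eq algebra_simps)
  show "of_real pi * z * ?F z = sin (2 * of_real pi * of_real \<delta> * z)"
    unfolding s using eq by (simp add: field_simps)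
qed

text \<open>Integration by parts: the primitive of the kernel vanishes at both ends because \<open>F a = 0\<close>.\<close>

lemma bandlimited_divide:
  assumes "bandlimited \<delta> F" "F (of_real a) = 0" "\<delta> > 0"
  shows "\<exists>G. bandlimited \<delta> G \<and> (\<forall>z. (z - of_real a) * G z = F z)"
proof -
  obtain \<psi> where \<psi>: "continuous_on {-\<delta>..\<delta>} \<psi>"
    "\<And>z. F z = integral {-\<delta>..\<delta>} (\<lambda>t. \<psi> t * exp (- 2 * of_real pi * \<i> * z * of_real t))"
    using assms unfolding bandlimited_def by blast
  define e where "e z t = exp (- 2 * of_real pi * \<i> * z * of_real t)" for z :: complex and t :: real
  have e_cont: "continuous_on S (e z)" for S z unfolding e_def[abs_def] by (intro continuous_intros)
  have e_deriv: "((e z) has_vector_derivative (- 2 * of_real pi * \<i> * z) * e z t) (at t within S)" for z t S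
    unfolding e_def[abs_def] by (rule has_vector_derivative_exp_linear)
  define \<Psi> where "\<Psi> t = integral {-\<delta>..t} (\<lambda>s. \<psi> s * e a s)" for t
  have \<Psi>_deriv: "(\<Psi> has_vector_derivative \<psi> t * e a t) (at t within {-\<delta>..\<delta>})" if "t \<in> {-\<delta>..\<delta>}" for t
  proof -
    have "continuous_on {-\<delta>..\<delta>} (\<lambda>s. \<psi> s * e a s)" by (intro continuous_intros \<psi>(1) e_cont)
    from integral_has_vector_derivative[OF this that] show ?thesis unfolding \<Psi>_def[abs_def] .
  qed
  have \<Psi>_cont: "continuous_on {-\<delta>..\<delta>} \<Psi>"
    by (rule continuous_on_vector_derivative[where f' = "\<lambda>t. \<psi> t * e a t"]) (rule \<Psi>_deriv)
  have \<Psi>_end: "\<Psi> \<delta> = 0" "\<Psi> (-\<delta>) = 0"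
    using assms(2) \<psi>(2)[of a] by (simp_all add: \<Psi>_def e_def)
  define \<eta> where "\<eta> t = 2 * of_real pi * \<i> * \<Psi> t * e (- a) t" for t
  have \<eta>_cont: "continuous_on {-\<delta>..\<delta>} \<eta>"
    unfolding \<eta>_def[abs_def] by (intro continuous_intros \<Psi>_cont e_cont)
  define G where "G z = integral {-\<delta>..\<delta>} (\<lambda>t. \<eta> t * e z t)" for z
  have G: "bandlimited \<delta> G"
    unfolding bandlimited_def G_def[abs_def] e_def using \<eta>_cont by blast
  have "(z - of_real a) * G z = F z" for z
  proof -
    have prod: "e (- a) t * e z t = e (z - a) t" "e a t * e (z - a) t = e z t" for t
      by (simp_all add: e_def ring_distribs exp_diff exp_minus field_simps)
    have "((\<lambda>t. \<Psi> t * ((- 2 * of_real pi * \<i> * (z - a)) * e (z - a) t) + \<psi> t * e a t * e (z - a) t) has_integral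
        \<Psi> \<delta> * e (z - a) \<delta> - \<Psi> (-\<delta>) * e (z - a) (-\<delta>)) {-\<delta>..\<delta>}"
    proof (rule fundamental_theorem_of_calculus)
      fix t assume "t \<in> {-\<delta>..\<delta>}"
      from has_vector_derivative_mult[OF \<Psi>_deriv[OF this] e_deriv[of "z - a" t]]
      show "((\<lambda>t. \<Psi> t * e (z - a) t) has_vector_derivative 
         \<Psi> t * ((- 2 * of_real pi * \<i> * (z - a)) * e (z - a) t) + \<psi> t * e a t * e (z - a) t) (at t within {-\<delta>..\<delta>})" .
    qed (use assms(3) in auto)
    then have 1: "integral {-\<delta>..\<delta>} (\<lambda>t. \<Psi> t * ((- 2 * of_real pi * \<i> * (z - a)) * e (z - a) t) + \<psi> t * e a t * e (z - a) t) = 0"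
      using \<Psi>_end by (auto dest: integral_unique)
    have "(\<lambda>t. \<Psi> t * ((- 2 * of_real pi * \<i> * (z - a)) * e (z - a) t) + \<psi> t * e a t * e (z - a) t)
      = (\<lambda>t. \<psi> t * e z t - (z - a) * (\<eta> t * e z t))"
    proof
      fix t
      have "\<psi> t * e a t * e (z - a) t = \<psi> t * e z t" using prod(2)[of t] by (metis mult.assoc)
      then show "\<Psi> t * ((- 2 * of_real pi * \<i> * (z - a)) * e (z - a) t) + \<psi> t * e a t * e (z - a) t
        = \<psi> t * e z t - (z - a) * (\<eta> t * e z t)"
        unfolding \<eta>_def prod(1)[of t, symmetric] by (simp add: algebra_simps)
    qed
    then have "integral {-\<delta>..\<delta>} (\<lambda>t. \<psi> t * e z t - (z - a) * (\<eta> t * e z t)) = 0" using 1 by simp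
    moreover have "integral {-\<delta>..\<delta>} (\<lambda>t. \<psi> t * e z t - (z - a) * (\<eta> t * e z t)) = F z - (z - a) * G z"
      unfolding \<psi>(2) G_def e_def[symmetric]
      by (subst integral_diff) (auto intro!: integrable_continuous_interval continuous_intros \<psi>(1) \<eta>_cont e_cont)
    ultimately show ?thesis by simp
  qed
  then show ?thesis using G by blast
qed

text \<open>Multiplication by \<open>z - x\<close> alone would leave the class, but after the
  division by \<open>z - l\<close> one has (z - x) H = G + (l - x) H, a combination of two members.
  Injectivity of \<open>l\<close> keeps the other zeros alive through earlier divisions. For indices
  in \<open>D\<close> the zero is divided out and nothing is put back.\<close>

lemma bandlimited_replace_zeros:
  fixes l x :: "int \<Rightarrow> real"
  assumes F: "bandlimited \<delta> F" and \<delta>: "\<delta> > 0" and "finite S" and "inj_on l S"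
    and zero: "\<And>k. k \<in> S \<Longrightarrow> F (of_real (l k)) = 0"
  shows "\<exists>G. bandlimited \<delta> G \<and> (\<forall>z. (\<Prod>k\<in>S. z - of_real (l k)) * G z = (\<Prod>k\<in>S - D. z - of_real (x k)) * F z)"
  using assms(3,4) zero
proof (induction S rule: finite_induct)
  case empty
  then show ?case using F by auto
next
  case (insert k S)
  then obtain G where G: "bandlimited \<delta> G" "\<And>z. (\<Prod>k\<in>S. z - of_real (l k)) * G z = (\<Prod>k\<in>S - D. z - of_real (x k)) * F z"
    by (auto simp: inj_on_def)
  have "(\<Prod>j\<in>S. of_real (l k) - complex_of_real (l j)) \<noteq> 0"
    using insert by (auto simp: inj_on_def)
  moreover have "(\<Prod>j\<in>S. of_real (l k) - complex_of_real (l j)) * G (of_real (l k)) = 0"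
    using G(2)[of "of_real (l k)"] insert.prems(2)[of k] by simp
  ultimately have "G (of_real (l k)) = 0" by simp
  then obtain H where H: "bandlimited \<delta> H" "\<And>z. (z - of_real (l k)) * H z = G z"
    using bandlimited_divide[OF G(1) _ \<delta>] by blast
  have PH: "(\<Prod>j\<in>insert k S. z - of_real (l j)) * H z = (\<Prod>k\<in>S - D. z - of_real (x k)) * F z" for z
  proof -
    have "(\<Prod>j\<in>insert k S. z - of_real (l j)) * H z = (\<Prod>j\<in>S. z - of_real (l j)) * ((z - of_real (l k)) * H z)"
      using insert by simp
    then show ?thesis using G(2) H(2) by simp
  qed
  show ?case
  proof (cases "k \<in> D")
    case True
    then show ?thesis using H PH by (auto simp: insert_Diff_if)
  next
    case False
    have "bandlimited \<delta> (\<lambda>z. G z + of_real (l k - x k) * H z)"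
      by (intro bandlimited_add bandlimited_cmult G H)
    moreover have "G z + of_real (l k - x k) * H z = (z - of_real (x k)) * H z" for z
      unfolding H(2)[symmetric] by (simp add: algebra_simps)
    ultimately have "bandlimited \<delta> (\<lambda>z. (z - of_real (x k)) * H z)" by simp
    moreover have "(\<Prod>j\<in>insert k S. z - of_real (l j)) * ((z - of_real (x k)) * H z) = (\<Prod>j\<in>insert k S - D. z - of_real (x j)) * F z" for z
    proof -
      have "(\<Prod>j\<in>insert k S. z - of_real (l j)) * ((z - of_real (x k)) * H z) = (z - of_real (x k)) * ((\<Prod>j\<in>insert k S. z - of_real (l j)) * H z)"
        by simp
      also have "\<dots> = ((z - of_real (x k)) * (\<Prod>j\<in>S - D. z - of_real (x j))) * F z"
        unfolding PH by simp
      also have "(z - of_real (x k)) * (\<Prod>j\<in>S - D. z - complex_of_real (x j)) = (\<Prod>j\<in>insert k S - D. z - of_real (x j))"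
        using False insert by (simp add: insert_Diff_if)
      finally show ?thesis .
    qed
    ultimately show ?thesis by blast
  qed
qed

section \<open>Moving the zeros of the sine function\<close>

text \<open>
  Moving a zero from \<open>l\<close> to \<open>x\<close> changes the logarithm of the modulus at \<open>a + \<i>\<close> by the integral of
  this step function against \<open>conj_kernel a\<close>.
\<close>

definition jump :: "real \<Rightarrow> real \<Rightarrow> real \<Rightarrow> real" where
  "jump l x s = of_bool (l \<le> s) - of_bool (x \<le> s)"

lemma jump_conj_kernel_less:
  assumes "l \<le> x"
  shows "integrable lborel (\<lambda>s. jump l x s * conj_kernel a s)"
    and "(LINT s|lborel. jump l x s * conj_kernel a s) = (ln ((x - a)\<^sup>2 + 1) - ln ((l - a)\<^sup>2 + 1)) / 2"
proof -
  have d: "((\<lambda>s. ln ((s - a)\<^sup>2 + 1) / 2) has_real_derivative conj_kernel a s) (at s)" for s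
  proof -
    have "(s - a)\<^sup>2 + 1 > 0" by (auto simp: add_nonneg_pos)
    then show ?thesis unfolding conj_kernel_def
      by (auto intro!: derivative_eq_intros simp: divide_simps) (simp add: algebra_simps)
  qed
  have "has_bochner_integral lborel (\<lambda>s. conj_kernel a s * indicator {l..x} s) (ln ((x - a)\<^sup>2 + 1) / 2 - ln ((l - a)\<^sup>2 + 1) / 2)"
    using d continuous_conj_kernel[of a] assms
    by (intro has_bochner_integral_FTC_Icc_real) (auto simp: continuous_on_eq_continuous_at)
  moreover have "AE s in lborel. conj_kernel a s * indicator {l..x} s = jump l x s * conj_kernel a s"
    using AE_lborel_singleton[of x]
    by eventually_elim (use assms in \<open>auto simp: jump_def indicator_def\<close>)
  ultimately have "has_bochner_integral lborel (\<lambda>s. jump l x s * conj_kernel a s) (ln ((x - a)\<^sup>2 + 1) / 2 - ln ((l - a)\<^sup>2 + 1) / 2)"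
    by (subst has_bochner_integral_cong_AE[symmetric]) (auto simp: jump_def[abs_def])
  then show "integrable lborel (\<lambda>s. jump l x s * conj_kernel a s)"
    and "(LINT s|lborel. jump l x s * conj_kernel a s) = (ln ((x - a)\<^sup>2 + 1) - ln ((l - a)\<^sup>2 + 1)) / 2"
    by (auto simp: has_bochner_integral_iff diff_divide_distrib)
qed

lemma jump_conj_kernel:
  shows "integrable lborel (\<lambda>s. jump l x s * conj_kernel a s)"
    and "(LINT s|lborel. jump l x s * conj_kernel a s) = (ln ((x - a)\<^sup>2 + 1) - ln ((l - a)\<^sup>2 + 1)) / 2"
proof -
  have sw: "jump l x s = - jump x l s" for s by (simp add: jump_def)
  show "integrable lborel (\<lambda>s. jump l x s * conj_kernel a s)"
  proof (cases "l \<le> x")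
    case False
    then have "integrable lborel (\<lambda>s. - (jump x l s * conj_kernel a s))" using jump_conj_kernel_less[of x l a] by simp
    then show ?thesis by (subst sw) simp
  qed (rule jump_conj_kernel_less)
  show "(LINT s|lborel. jump l x s * conj_kernel a s) = (ln ((x - a)\<^sup>2 + 1) - ln ((l - a)\<^sup>2 + 1)) / 2"
  proof (cases "l \<le> x")
    case False
    then show ?thesis using jump_conj_kernel_less(2)[of x l a] by (subst sw) simp
  qed (rule jump_conj_kernel_less)
qed

lemma sum_of_bool_le_int:
  fixes T A :: int
  assumes "T \<ge> 0"
  shows "(\<Sum>k\<in>{-T..T}. of_bool (k \<le> A)) = real_of_int (max 0 (min A T + T + 1))"
proof -
  have "(\<Sum>k\<in>{-T..T}. of_bool (k \<le> A)) = real (card ({-T..T} \<inter> {k. k \<le> A}))"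
    by (simp add: sum_of_bool_eq)
  also have "{-T..T} \<inter> {k. k \<le> A} = {-T..min A T}" by auto
  finally show ?thesis by simp
qed

text \<open>As the phase increases, \<open>x k \<le> s\<close> means k \<le> \<tau> s + v s / \<pi>,
  while k / \<tau> \<le> s means k \<le> \<tau> s. The difference of the two floors is -v / \<pi> up
  to an error of 1; the bound 2 also pays for the restriction to finitely many indices.\<close>

lemma zero_count_discrepancy:
  fixes v :: "real \<Rightarrow> real" and x :: "int \<Rightarrow> real"
  assumes \<tau>: "\<tau> > 0" and V: "\<And>s. \<bar>v s\<bar> \<le> V" and S: "\<And>s. \<bar>s\<bar> \<ge> S \<Longrightarrow> \<bar>v s\<bar> \<le> pi / 2"
    and mono: "strict_mono (\<lambda>s. pi * \<tau> * s + v s)"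
    and x: "\<And>k::int. pi * \<tau> * x k + v (x k) = pi * k"
  shows "\<exists>T0\<ge>0. \<forall>T\<ge>T0. \<forall>s. \<bar>(\<Sum>k\<in>{-T..T::int}. jump (real_of_int k / \<tau>) (x k) s) + v s / pi\<bar> \<le> 2"
proof (intro exI conjI allI impI)
  \<comment> \<open>Large enough that for \<open>\<bar>s\<bar> < S\<close> both floors lie in
    [-T, T], where the clipping \<open>cl\<close> acts as a translation.\<close>
  define T0 where "T0 = \<lceil>\<tau> * \<bar>S\<bar> + V / pi + 2\<rceil>"
  have "V \<ge> 0" using V[of 0] by (meson abs_ge_zero order_trans)
  then show T0: "T0 \<ge> 0"   proof -
    have "\<tau> * \<bar>S\<bar> \<ge> 0" "V / pi \<ge> 0" using \<tau> \<open>V \<ge> 0\<close> by auto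
    then show ?thesis unfolding T0_def by linarith
  qed
  fix T s assume T: "T \<ge> T0"
  define A B where "A = \<lfloor>\<tau> * s\<rfloor>" and "B = \<lfloor>\<tau> * s + v s / pi\<rfloor>"
  have k1: "real_of_int k / \<tau> \<le> s \<longleftrightarrow> k \<le> A" for k
    using \<tau> by (simp add: A_def le_floor_iff field_simps)
  have k2: "x k \<le> s \<longleftrightarrow> k \<le> B" for k
  proof -
    have "x k \<le> s \<longleftrightarrow> pi * \<tau> * x k + v (x k) \<le> pi * \<tau> * s + v s"
      using strict_mono_less_eq[OF mono] by simp
    also have "\<dots> \<longleftrightarrow> pi * k \<le> pi * \<tau> * s + v s" by (simp only: x)
    also have "\<dots> \<longleftrightarrow> k \<le> \<tau> * s + v s / pi" by (simp add: field_simps)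
    finally show ?thesis by (simp add: B_def le_floor_iff)
  qed
  define cl where "cl A = max 0 (min A T + T + 1)" for A :: int
  have "(\<Sum>k\<in>{-T..T}. jump (real_of_int k / \<tau>) (x k) s) = real_of_int (cl A) - real_of_int (cl B)"
    unfolding jump_def k1 k2 sum_subtractf cl_def using T T0 by (simp only: sum_of_bool_le_int)
  then have eq: "(\<Sum>k\<in>{-T..T}. jump (real_of_int k / \<tau>) (x k) s) = real_of_int (cl A - cl B)" by simp
  have lip: "\<bar>cl A - cl B\<bar> \<le> \<bar>A - B\<bar>" unfolding cl_def by linarith
  have AB: "\<bar>real_of_int (A - B) + v s / pi\<bar> \<le> 1" unfolding A_def B_def by linarith
  show "\<bar>(\<Sum>k\<in>{-T..T}. jump (real_of_int k / \<tau>) (x k) s) + v s / pi\<bar> \<le> 2"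
  proof (cases "\<bar>s\<bar> \<ge> S")
    \<comment> \<open>Clipping may act here, but it is 1-Lipschitz and v / \<pi> is at most 1/2 in
      modulus: the clipped difference is at most 1 + 1/2, and v / \<pi> adds the last 1/2.\<close>
    case True
    then have "\<bar>v s / pi\<bar> \<le> 1 / 2" using S[of s] by (simp add: field_simps abs_divide)
    moreover have "\<bar>real_of_int (cl A - cl B)\<bar> \<le> \<bar>real_of_int (A - B)\<bar>" using lip by linarith
    ultimately show ?thesis unfolding eq using AB by linarith
  next
    case False
    have "\<bar>\<tau> * s\<bar> \<le> \<tau> * \<bar>S\<bar>" using False \<tau> by (simp add: abs_mult)
    moreover have "\<bar>v s / pi\<bar> \<le> V / pi" using V[of s] by (simp add: divide_right_mono abs_divide)
    moreover have "\<tau> * \<bar>S\<bar> + V / pi + 2 \<le> real_of_int T" using T unfolding T0_def by linarith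
    ultimately have "\<bar>A\<bar> \<le> T" "\<bar>B\<bar> \<le> T" unfolding A_def B_def by linarith+
    then have "cl A - cl B = A - B" unfolding cl_def by linarith
    then show ?thesis unfolding eq using AB by linarith
  qed
qed

text \<open>On a horizontal line off the real axis the sine is pinned between two positive
  constants, so the size of the multiplier there is decided by the displaced and deleted zeros
  alone.\<close>

lemma cmod_sin_bounds:
  assumes "Im w = b" "b > 0"
  shows "sinh b \<le> cmod (sin w)" "cmod (sin w) \<le> cosh b"
proof -
  have n: "cmod (exp (\<i> * w)) = exp (- b)" "cmod (exp (- (\<i> * w))) = exp b"
    using assms by (simp_all add: norm_exp_eq_Re)
  have s: "cmod (sin w) = cmod (exp (\<i> * w) - exp (- (\<i> * w))) / 2"
    by (simp add: sin_exp_eq norm_divide norm_mult)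
  show "cmod (sin w) \<le> cosh b"
    unfolding s using norm_triangle_ineq4[of "exp (\<i> * w)" "exp (- (\<i> * w))"] n by (simp add: cosh_def)
  show "sinh b \<le> cmod (sin w)"
    unfolding s using norm_triangle_ineq3[of "exp (- (\<i> * w))" "exp (\<i> * w)"] n
    by (simp add: sinh_def norm_minus_commute)
qed

text \<open>The imaginary part is a combination of a pole at \<open>p\<close> and one at
  \<open>cnj p\<close>. Against the Cauchy kernel at a + \<i> only the pole in the lower half-plane
  survives. This is harmonic conjugation: it turns Im on the real line into Re on the line Im z =
  1.\<close>

lemma integral_pole_conj_kernel:
  assumes "Im p < 0"
  shows "integrable lborel (\<lambda>s. Im (w / (of_real s - p)) * conj_kernel a s)"
    and "(LINT s|lborel. Im (w / (of_real s - p)) * conj_kernel a s) = pi * Re (w / (Complex a 1 - p))"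
proof -
  let ?z = "Complex a 1"
  define A where "A s = 1 / ((complex_of_real s - p) * (complex_of_real s - ?z))" for s
  define B where "B s = 1 / ((complex_of_real s - cnj p) * (complex_of_real s - ?z))" for s
  have A: "integrable lborel A" "(LINT s|lborel. A s) = 2 * pi * \<i> / (?z - p)"
    unfolding A_def using assms cauchy_kernel_product_opposite[of ?z p] by (auto intro!: integrable_cauchy_kernel_product)
  have B: "integrable lborel B" "(LINT s|lborel. B s) = 0"
    unfolding B_def using assms by (auto intro!: integrable_cauchy_kernel_product cauchy_kernel_product_same)
  have eq: "Im (w / (of_real s - p)) * conj_kernel a s = Re ((w * A s - cnj w * B s) / (2 * \<i>))" for s
  proof -
    have aux: "(a / x - b / y) / c * (1 / z) = (a * (1 / (x * z)) - b * (1 / (y * z))) / c" for a b c x y z :: complex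
      by (simp add: divide_inverse algebra_simps)
    have "of_real (Im (w / (of_real s - p))) = (w / (of_real s - p) - cnj (w / (of_real s - p))) / (2 * \<i>)"
      by (subst complex_diff_cnj) (simp add: complex_eq_iff)
    then have "of_real (Im (w / (of_real s - p))) * (1 / (of_real s - ?z)) = (w / (of_real s - p) - cnj (w / (of_real s - p))) / (2 * \<i>) * (1 / (of_real s - ?z))"
      by (rule arg_cong)
    also have "\<dots> = (w * A s - cnj w * B s) / (2 * \<i>)"
      unfolding A_def B_def complex_cnj_divide complex_cnj_diff complex_cnj_complex_of_real by (rule aux)
    finally have "of_real (Im (w / (of_real s - p))) * (1 / (of_real s - ?z)) = (w * A s - cnj w * B s) / (2 * \<i>)" .
    moreover have "Im (w / (of_real s - p)) * conj_kernel a s = Re (of_real (Im (w / (of_real s - p))) * (1 / (of_real s - ?z)))"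
      unfolding conj_kernel_eq_Re by (simp only: Re_complex_of_real Im_complex_of_real times_complex.simps mult_zero_left diff_zero)
    ultimately show ?thesis by simp
  qed
  have int: "integrable lborel (\<lambda>s. (w * A s - cnj w * B s) / (2 * \<i>))" using A B by simp
  show "integrable lborel (\<lambda>s. Im (w / (of_real s - p)) * conj_kernel a s)"
    unfolding eq using int by (rule integrable_Re)
  have "(LINT s|lborel. Im (w / (of_real s - p)) * conj_kernel a s) = Re (LINT s|lborel. (w * A s - cnj w * B s) / (2 * \<i>))"
    unfolding eq by (rule integral_Re[OF int])
  also have "(LINT s|lborel. (w * A s - cnj w * B s) / (2 * \<i>)) = (w * (2 * pi * \<i> / (?z - p)) - cnj w * 0) / (2 * \<i>)"
    using A B by simp
  also have "\<dots> = of_real pi * (w / (?z - p)) * ((2 * \<i>) / (2 * \<i>))"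
    by (simp only: divide_inverse mult_zero_right diff_zero of_real_mult of_real_numeral) (simp only: ac_simps)
  also have "\<dots> = of_real pi * (w / (?z - p))" by simp
  finally show "(LINT s|lborel. Im (w / (of_real s - p)) * conj_kernel a s) = pi * Re (w / (Complex a 1 - p))"
    by (simp only: Re_complex_of_real Im_complex_of_real times_complex.simps mult_zero_left diff_zero)
qed

text \<open>
  The ten zeros \<open>x k\<close> with \<open>k \<in> D\<close> are deleted: the discrepancy of the zero count contributes a factor
  \<open>(1 + \<bar>a\<bar>)\<^sup>8\<close>, and the quotient has to decay like \<open>1 / (1 + a\<^sup>2)\<close>. They are chosen next to
  \<open>0\<close>, whose index is about \<open>v 0 / \<pi>\<close> and is not bounded, to keep the constants independent of \<open>v\<close>.
\<close>

lemma multiplier_from_phase: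
  fixes v \<omega> :: "real \<Rightarrow> real" and \<tau> V S :: real
  defines "Y \<equiv> 20 / \<tau>"
  assumes \<tau>: "\<tau> > 0" 
    and lip: "\<And>s t. s \<le> t \<Longrightarrow> \<bar>v t - v s\<bar> \<le> (pi * \<tau> / 2) * (t - s)"
    and V: "\<And>s. \<bar>v s\<bar> \<le> V" and S: "\<And>s. \<bar>s\<bar> \<ge> S \<Longrightarrow> \<bar>v s\<bar> \<le> pi / 2"
    and int: "\<And>a. integrable lborel (\<lambda>s. v s * (conj_kernel a s - conj_kernel 0 s))"
    and \<omega>: "\<And>a. (LINT s|lborel. v s * (conj_kernel a s - conj_kernel 0 s)) = pi * \<omega> a"
  shows "\<exists>F. bandlimited (\<tau> / 2) F \<and>
     (\<forall>a::real. cmod (F a) \<le> cosh (pi * \<tau>) / sinh (pi * \<tau>) * 8192 * (1 + Y\<^sup>2) ^ 10 / (1 + a\<^sup>2) * exp (- \<omega> a)) \<and>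
     (\<forall>a::real. \<bar>a\<bar> \<le> 1 \<longrightarrow> sinh (pi * \<tau>) / cosh (pi * \<tau>) / 256 / ((1 + Y)\<^sup>2 + 1) ^ 5 * exp (- \<omega> a) \<le> cmod (F a))"
proof -
  define \<phi> where "\<phi> s = pi * \<tau> * s + v s" for s
  have grow: "\<phi> t - \<phi> s \<ge> pi * \<tau> / 2 * (t - s)" if "s \<le> t" for s t
  proof -
    have "v t - v s \<ge> - ((pi * \<tau> / 2) * (t - s))" using lip[OF that] by linarith
    moreover have "pi * \<tau> * t - pi * \<tau> * s = 2 * (pi * \<tau> / 2 * (t - s))" by (simp add: right_diff_distrib)
    ultimately show ?thesis unfolding \<phi>_def by linarith
  qed
  have mono: "strict_mono \<phi>"
  proof (rule strict_monoI)
    fix s t :: real assume "s < t"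
    then have "pi * \<tau> / 2 * (t - s) > 0" using \<tau> by simp
    then show "\<phi> s < \<phi> t" using grow[of s t] \<open>s < t\<close> by linarith
  qed
  have vcont: "continuous_on UNIV v"
  proof -
    have "(pi * \<tau> / 2)-lipschitz_on UNIV v"
    proof (rule lipschitz_onI)
      fix s t :: real
      show "dist (v s) (v t) \<le> pi * \<tau> / 2 * dist s t"
        using lip[of s t] lip[of t s] by (cases "s \<le> t") (auto simp: dist_real_def abs_minus_commute)
    qed (use \<tau> in auto)
    then show ?thesis by (rule lipschitz_on_continuous_on)
  qed
  have \<phi>cont: "continuous_on A \<phi>" for A
    unfolding \<phi>_def by (intro continuous_intros continuous_on_subset[OF vcont]) auto
  have "\<exists>x. \<phi> x = y" for y
  proof -
    define B where "B = (\<bar>y\<bar> + V) / (pi * \<tau>)"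
    have "V \<ge> 0" using V[of 0] by linarith
    then have B: "B \<ge> 0" "pi * \<tau> * B = \<bar>y\<bar> + V" using \<tau> by (auto simp: B_def)
    have "\<phi> (-B) \<le> y" "y \<le> \<phi> B" using V[of "-B"] V[of B] B(2) by (auto simp: \<phi>_def)
    then show ?thesis using IVT'[of \<phi> "-B" y B] B(1) \<phi>cont by auto
  qed
  then have "\<forall>k::int. \<exists>x. \<phi> x = pi * k" by blast
  from choice[OF this] obtain x :: "int \<Rightarrow> real" where x: "\<And>k::int. \<phi> (x k) = pi * k" by blast
  define l where "l k = real_of_int k / \<tau>" for k
  obtain T0 where T0: "T0 \<ge> 0" "\<And>T s. T \<ge> T0 \<Longrightarrow> \<bar>(\<Sum>k\<in>{-T..T::int}. jump (l k) (x k) s) + v s / pi\<bar> \<le> 2"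
    using zero_count_discrepancy[OF \<tau> V S mono[unfolded \<phi>_def] x[unfolded \<phi>_def]] unfolding l_def by blast
  define k0 where "k0 = \<lceil>\<phi> 0 / pi\<rceil>"
  define D where "D = {k0..k0 + 9}"
  define T where "T = max T0 (\<bar>k0\<bar> + 9)"
  define I where "I = {-T..T}"
  have T: "T \<ge> T0" "D \<subseteq> I" by (auto simp: T_def D_def I_def)
  have fin: "finite I" "finite D" "k0 \<in> D" "card D = 10" by (auto simp: I_def D_def)
  \<comment> \<open>From 0 to \<open>x k\<close> the phase rises by at most 10 \<pi>, and its slope
    is at least \<pi>\<tau> / 2. The quotient is 20 / \<tau>, whatever \<open>v\<close> is.\<close>
  have xD: "0 \<le> x k" "x k \<le> Y" if "k \<in> D" for k
  proof -
    have "real_of_int k0 \<le> real_of_int k" "real_of_int k \<le> real_of_int k0 + 9" using that by (auto simp: D_def)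
    moreover have "\<phi> 0 / pi \<le> real_of_int k0" "real_of_int k0 < \<phi> 0 / pi + 1" unfolding k0_def by linarith+
    ultimately have a: "\<phi> 0 / pi \<le> k" "k \<le> \<phi> 0 / pi + 10" by linarith+
    have k: "\<phi> 0 \<le> \<phi> (x k)" "\<phi> (x k) \<le> \<phi> 0 + 10 * pi" using a unfolding x by (simp_all add: field_simps)
    show "0 \<le> x k" using k strict_mono_less_eq[OF mono] by blast
    then have "pi * \<tau> / 2 * (x k - 0) \<le> 10 * pi" using grow[of 0 "x k"] k by linarith
    moreover have "pi * \<tau> / 2 * (x k - 0) = pi * (\<tau> * x k) / 2" by simp
    ultimately have "pi * (\<tau> * x k) \<le> pi * 20" by linarith
    then have "\<tau> * x k \<le> 20" using mult_le_cancel_left_pos pi_gt_zero by blast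
    then show "x k \<le> Y" unfolding Y_def using \<tau> by (simp add: field_simps)
  qed
  obtain F1 where F1: "bandlimited (\<tau> / 2) F1" "\<And>z. of_real pi * z * F1 z = sin (of_real pi * of_real \<tau> * z)"
    using bandlimited_sin[of "\<tau> / 2"] \<tau> by auto
  \<comment> \<open>\<open>F1\<close> vanishes at the nonzero multiples of 1 / \<tau>. The shift
    moves the missing zero from 0 to \<open>l k0\<close>; as \<open>k0 \<in> D\<close>, no zero has
    to be put in its place.\<close>
  define F0 where "F0 z = F1 (z - of_real (l k0))" for z
  have F0: "bandlimited (\<tau> / 2) F0" unfolding F0_def using bandlimited_shift[OF F1(1), of "- of_real (l k0)"] by simp
  have F0z: "F0 (of_real (l k)) = 0" if "k \<in> I - {k0}" for k
  proof -
    have "of_real pi * of_real (l k - l k0) * F0 (of_real (l k)) = sin (complex_of_real (pi * \<tau> * (l k - l k0)))"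
      using F1(2)[of "of_real (l k - l k0)"] unfolding F0_def by simp
    also have "pi * \<tau> * (l k - l k0) = of_int (k - k0) * pi" using \<tau> by (simp add: l_def field_simps)
    also have "sin (complex_of_real (of_int (k - k0) * pi)) = complex_of_real (sin (of_int (k - k0) * pi))"
      by (rule sin_of_real)
    also have "sin (of_int (k - k0) * pi) = 0" unfolding sin_zero_iff_int2 by blast
    finally show ?thesis using that \<tau> by (auto simp: l_def)
  qed
  have inj: "inj_on l (I - {k0})" using \<tau> by (auto simp: inj_on_def l_def)
  obtain G where G: "bandlimited (\<tau> / 2) G" 
    "\<And>z. (\<Prod>k\<in>I - {k0}. z - of_real (l k)) * G z = (\<Prod>k\<in>(I - {k0}) - D. z - of_real (x k)) * F0 z"
    using bandlimited_replace_zeros[OF F0 _ _ inj F0z, where D = D and x = x] \<tau> fin by auto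
  define r where "r a y = cmod (Complex a 1 - of_real y)" for a y
  have r: "r a y = sqrt ((a - y)\<^sup>2 + 1)" for a y by (simp add: r_def cmod_def)
  have rpos: "r a y > 0" for a y unfolding r by (simp add: add_nonneg_pos)
  define sn where "sn a = cmod (sin (of_real pi * of_real \<tau> * (Complex a 1 - of_real (l k0))))" for a
  have sn: "sinh (pi * \<tau>) \<le> sn a" "sn a \<le> cosh (pi * \<tau>)" for a
    unfolding sn_def using \<tau> by (auto intro!: cmod_sin_bounds)
  define g where "g a = cmod (G (Complex a 1))" for a
  have key: "g a * pi * (\<Prod>k\<in>I. r a (l k)) * (\<Prod>k\<in>D. r a (x k)) = sn a * (\<Prod>k\<in>I. r a (x k))" for a
  proof -
    have e1: "(\<Prod>k\<in>I - {k0}. r a (l k)) * g a = (\<Prod>k\<in>I - D. r a (x k)) * cmod (F0 (Complex a 1))"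
    proof -
      have "(I - {k0}) - D = I - D" using fin by auto
      then show ?thesis
        using arg_cong[OF G(2)[of "Complex a 1"], of cmod] by (simp add: norm_mult r_def g_def prod_norm)
    qed
    have e2: "pi * r a (l k0) * cmod (F0 (Complex a 1)) = sn a"
      using arg_cong[OF F1(2)[of "Complex a 1 - of_real (l k0)"], of cmod] by (simp add: norm_mult r_def F0_def sn_def)
    have e3: "(\<Prod>k\<in>I. r a (l k)) = r a (l k0) * (\<Prod>k\<in>I - {k0}. r a (l k))"
      using fin T by (intro prod.remove) auto
    have e4: "(\<Prod>k\<in>I. r a (x k)) = (\<Prod>k\<in>I - D. r a (x k)) * (\<Prod>k\<in>D. r a (x k))"
      using fin T by (intro prod.subset_diff) auto
    have "g a * pi * (\<Prod>k\<in>I. r a (l k)) * (\<Prod>k\<in>D. r a (x k))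
       = pi * r a (l k0) * ((\<Prod>k\<in>I - {k0}. r a (l k)) * g a) * (\<Prod>k\<in>D. r a (x k))" unfolding e3 by simp
    also have "\<dots> = (pi * r a (l k0) * cmod (F0 (Complex a 1))) * ((\<Prod>k\<in>I - D. r a (x k)) * (\<Prod>k\<in>D. r a (x k)))"
      unfolding e1 by simp
    finally show ?thesis unfolding e2 e4 .
  qed
  define \<Theta> where "\<Theta> a = (\<Sum>k\<in>I. ln (r a (x k)) - ln (r a (l k)))" for a
  have prod_r: "(\<Prod>k\<in>I. r a (x k)) = exp (\<Theta> a) * (\<Prod>k\<in>I. r a (l k))" for a
  proof -
    have "exp (\<Theta> a) * (\<Prod>k\<in>I. r a (l k)) = (\<Prod>k\<in>I. exp (ln (r a (x k)) - ln (r a (l k))) * r a (l k))"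
      unfolding \<Theta>_def using fin by (simp add: exp_sum prod.distrib)
    also have "\<dots> = (\<Prod>k\<in>I. r a (x k))"
    proof (rule prod.cong)
      fix k
      show "exp (ln (r a (x k)) - ln (r a (l k))) * r a (l k) = r a (x k)"
        using rpos[of a "x k"] rpos[of a "l k"] by (simp add: exp_diff)
    qed simp
    finally show ?thesis by simp
  qed
  have g_eq: "g a = sn a / pi * exp (\<Theta> a) / (\<Prod>k\<in>D. r a (x k))" for a
  proof -
    have "(\<Prod>k\<in>I. r a (l k)) > 0" "(\<Prod>k\<in>D. r a (x k)) > 0" using rpos by (auto intro!: prod_pos)
    then show ?thesis using key[of a] unfolding prod_r by (simp add: field_simps)
  qed
  define n where "n s = (\<Sum>k\<in>I. jump (l k) (x k) s)" for s
  have lnr: "ln (r a y) = ln ((y - a)\<^sup>2 + 1) / 2" for a y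
    unfolding r by (simp add: ln_sqrt add_nonneg_pos power2_commute)
  have \<Theta>_int: "integrable lborel (\<lambda>s. n s * conj_kernel a s)" "(LINT s|lborel. n s * conj_kernel a s) = \<Theta> a" for a
    unfolding n_def \<Theta>_def sum_distrib_right using jump_conj_kernel[of "l _" "x _" a]
    by (auto simp: lnr diff_divide_distrib)
  \<comment> \<open>\<Theta> integrates the step function \<open>n\<close> against the kernel.
    Putting -v / \<pi> for \<open>n\<close> would give -\<omega> exactly; the error is at most 2
    pointwise and costs twice the L1 norm 4 ln (1 + |a|) of the kernel difference.\<close>
  have \<Theta>_bound: "\<bar>\<Theta> a - \<Theta> 0 + \<omega> a\<bar> \<le> 8 * ln (1 + \<bar>a\<bar>)" for a
  proof -
    define d where "d s = conj_kernel a s - conj_kernel 0 s" for s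
    have d: "integrable lborel d" unfolding d_def by (rule integrable_conj_kernel_diff)
    have nd: "integrable lborel (\<lambda>s. n s * d s)" "(LINT s|lborel. n s * d s) = \<Theta> a - \<Theta> 0"
      using \<Theta>_int[of a] \<Theta>_int[of 0] by (simp_all add: d_def right_diff_distrib)
    have vd: "integrable lborel (\<lambda>s. v s * d s)" "(LINT s|lborel. v s * d s) = pi * \<omega> a"
      using int \<omega> by (simp_all add: d_def)
    have e: "integrable lborel (\<lambda>s. n s * d s + v s * d s / pi)" using nd vd by simp
    have "\<Theta> a - \<Theta> 0 + \<omega> a = (LINT s|lborel. n s * d s + v s * d s / pi)" using nd vd by simp
    also have "\<bar>\<dots>\<bar> \<le> (LINT s|lborel. \<bar>n s * d s + v s * d s / pi\<bar>)"
      by (rule integral_abs_bound)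
    also have "\<dots> \<le> (LINT s|lborel. 2 * \<bar>d s\<bar>)"
    proof (rule integral_mono)
      fix s
      have "\<bar>n s * d s + v s * d s / pi\<bar> = \<bar>n s + v s / pi\<bar> * \<bar>d s\<bar>"
        by (simp add: abs_mult[symmetric] algebra_simps)
      also have "\<dots> \<le> 2 * \<bar>d s\<bar>" using T0(2)[OF T(1), of s] unfolding n_def I_def by (rule mult_right_mono) simp
      finally show "\<bar>n s * d s + v s * d s / pi\<bar> \<le> 2 * \<bar>d s\<bar>" .
    qed (use d e in auto)
    also have "\<dots> = 2 * (LINT s|lborel. \<bar>d s\<bar>)" by simp
    also have "\<dots> \<le> 2 * (4 * ln (1 + \<bar>a\<bar>))" unfolding d_def using integral_abs_conj_kernel_diff[of a] by linarith
    finally show ?thesis by simp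
  qed
  have E: "exp (\<Theta> a) \<le> exp (\<Theta> 0) * (exp (- \<omega> a) * (1 + \<bar>a\<bar>) ^ 8)"
          "exp (\<Theta> 0) * (exp (- \<omega> a) / (1 + \<bar>a\<bar>) ^ 8) \<le> exp (\<Theta> a)" for a
  proof -
    have p: "exp (8 * ln (1 + \<bar>a\<bar>)) = (1 + \<bar>a\<bar>) ^ 8"
      using exp_of_nat_mult[of 8 "ln (1 + \<bar>a\<bar>)"] by simp
    have "exp (\<Theta> a) \<le> exp (\<Theta> 0 + (- \<omega> a) + 8 * ln (1 + \<bar>a\<bar>))" using \<Theta>_bound[of a] by simp
    then show "exp (\<Theta> a) \<le> exp (\<Theta> 0) * (exp (- \<omega> a) * (1 + \<bar>a\<bar>) ^ 8)" unfolding exp_add p by simp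
    have "exp (\<Theta> 0 + (- \<omega> a) - 8 * ln (1 + \<bar>a\<bar>)) \<le> exp (\<Theta> a)" using \<Theta>_bound[of a] by simp
    then show "exp (\<Theta> 0) * (exp (- \<omega> a) / (1 + \<bar>a\<bar>) ^ 8) \<le> exp (\<Theta> a)" unfolding exp_add exp_diff p by simp
  qed
  have Y: "Y \<ge> 0" using \<tau> by (simp add: Y_def)
  have sh: "sinh (pi * \<tau>) > 0" "cosh (pi * \<tau>) > 0" using \<tau> by auto
  have snpos: "sn a > 0" for a using sn(1)[of a] sh(1) by linarith
  have gpos: "g 0 > 0" unfolding g_eq using snpos rpos by (auto intro!: divide_pos_pos mult_pos_pos prod_pos)
  \<comment> \<open>The line Im z = 1 becomes the real line. Dividing by the value at \<i> cancels
    \<open>exp (\<Theta> 0)\<close>, for which no bound is available.\<close>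
  define u where "u z = inverse (G (Complex 0 1)) * G (z + \<i>)" for z
  have i: "Complex a 1 = of_real a + \<i>" for a by (simp add: complex_eq_iff)
  have u: "cmod (u a) = g a / g 0" for a :: real
    unfolding u_def g_def i by (simp add: norm_mult norm_inverse norm_divide field_simps)
  define R where "R a = (\<Prod>k\<in>D. r 0 (x k) / r a (x k))" for a
  have ratio: "g a / g 0 = sn a / sn 0 * (exp (\<Theta> a) / exp (\<Theta> 0)) * R a" for a
    unfolding g_eq R_def prod_dividef by (simp add: ac_simps)
  have sq: "(1 + \<bar>a\<bar>) ^ 8 \<le> 256 * (1 + a\<^sup>2) ^ 4" for a :: real
  proof -
    have "(1 + \<bar>a\<bar>)\<^sup>2 \<le> 2 * (1 + a\<^sup>2)"
      using zero_le_power2[of "1 - \<bar>a\<bar>"] by (simp add: power2_eq_square algebra_simps flip: abs_mult)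
    then have "((1 + \<bar>a\<bar>)\<^sup>2) ^ 4 \<le> (2 * (1 + a\<^sup>2)) ^ 4" by (rule power_mono) simp
    moreover have "((1 + \<bar>a\<bar>)\<^sup>2) ^ 4 = (1 + \<bar>a\<bar>) ^ 8" by (simp flip: power_mult)
    moreover have "(2 * (1 + a\<^sup>2)) ^ 4 = 16 * (1 + a\<^sup>2) ^ 4" unfolding power_mult_distrib by simp
    moreover have "(1 + a\<^sup>2) ^ 4 \<ge> 0" by simp
    ultimately show ?thesis by linarith
  qed
  \<comment> \<open>Each deleted zero contributes a decay (1 + a^2)^(-1/2). Ten of them beat the
    growth (1 + a^2)^4 of \<open>sq\<close> and leave 1 / (1 + a^2). The constant 32 is (sqrt
    2)^10.\<close>
  have R_up: "R a \<le> 32 * (1 + Y\<^sup>2) ^ 10 / (1 + a\<^sup>2) ^ 5" for a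
  proof -
    have "R a \<le> (\<Prod>k\<in>D. sqrt 2 * (1 + Y\<^sup>2) / sqrt (1 + a\<^sup>2))"
      unfolding R_def
    proof (rule prod_mono, safe)
      fix k assume k: "k \<in> D"
      have xk: "(x k)\<^sup>2 \<le> Y\<^sup>2" using xD[OF k] by (simp add: power_mono)
      have "1 + a\<^sup>2 \<le> 2 * (1 + (x k)\<^sup>2) * ((a - x k)\<^sup>2 + 1)"
      proof -
        have "a\<^sup>2 \<le> 2 * (a - x k)\<^sup>2 + 2 * (x k)\<^sup>2"
          using zero_le_power2[of "a - 2 * x k"] by (simp add: power2_eq_square algebra_simps)
        moreover have "0 \<le> (x k)\<^sup>2 * (a - x k)\<^sup>2" by simp
        moreover have "2 * (1 + (x k)\<^sup>2) * ((a - x k)\<^sup>2 + 1) = 2 * (a - x k)\<^sup>2 + 2 + 2 * (x k)\<^sup>2 + 2 * ((x k)\<^sup>2 * (a - x k)\<^sup>2)" 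
          by (simp add: algebra_simps)
        ultimately show ?thesis by linarith
      qed
      also have "\<dots> \<le> 2 * (1 + Y\<^sup>2) * ((a - x k)\<^sup>2 + 1)" using xk by (intro mult_right_mono mult_left_mono) auto
      finally have A: "sqrt (1 + a\<^sup>2) \<le> sqrt (2 * (1 + Y\<^sup>2)) * r a (x k)"
        unfolding r by (simp flip: real_sqrt_mult)
      have B: "r 0 (x k) \<le> sqrt (1 + Y\<^sup>2)" unfolding r using xk by simp
      have "r 0 (x k) * sqrt (1 + a\<^sup>2) \<le> sqrt (1 + Y\<^sup>2) * (sqrt (2 * (1 + Y\<^sup>2)) * r a (x k))"
        using A B rpos[of 0 "x k"] by (intro mult_mono) auto
      also have "\<dots> = sqrt 2 * (sqrt (1 + Y\<^sup>2) * sqrt (1 + Y\<^sup>2)) * r a (x k)"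
        unfolding real_sqrt_mult[of 2 "1 + Y\<^sup>2"] by (simp only: ac_simps)
      also have "sqrt (1 + Y\<^sup>2) * sqrt (1 + Y\<^sup>2) = 1 + Y\<^sup>2" by (simp add: add_nonneg_nonneg)
      finally have "r 0 (x k) * sqrt (1 + a\<^sup>2) \<le> sqrt 2 * (1 + Y\<^sup>2) * r a (x k)" .
      note prems = this
      show "r 0 (x k) / r a (x k) \<le> sqrt 2 * (1 + Y\<^sup>2) / sqrt (1 + a\<^sup>2)"
      proof -
        have "sqrt (1 + a\<^sup>2) > 0" by (simp add: add_pos_nonneg)
        then show ?thesis using rpos[of a "x k"] prems by (simp add: divide_simps)
      qed
      show "0 \<le> r 0 (x k) / r a (x k)" using rpos by (simp add: less_imp_le)
    qed
    also have "\<dots> = (sqrt 2 * (1 + Y\<^sup>2)) ^ 10 / sqrt (1 + a\<^sup>2) ^ 10" using fin by (simp add: power_divide)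
    also have "sqrt (1 + a\<^sup>2) ^ 10 = (sqrt (1 + a\<^sup>2) ^ 2) ^ 5" unfolding power_mult[symmetric] by simp
    also have "sqrt (1 + a\<^sup>2) ^ 2 = 1 + a\<^sup>2" by (simp add: add_nonneg_nonneg)
    also have "(sqrt 2 * (1 + Y\<^sup>2)) ^ 10 = (sqrt 2 ^ 2) ^ 5 * (1 + Y\<^sup>2) ^ 10"
      unfolding power_mult_distrib power_mult[symmetric, of _ 2 5] by simp
    finally show ?thesis by simp
  qed
  have R_low: "R a \<ge> 1 / ((1 + Y)\<^sup>2 + 1) ^ 5" if "\<bar>a\<bar> \<le> 1" for a
  proof -
    have "(\<Prod>k\<in>D. 1 / sqrt ((1 + Y)\<^sup>2 + 1)) \<le> R a"
      unfolding R_def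
    proof (rule prod_mono, safe)
      fix k assume k: "k \<in> D"
      have "\<bar>a - x k\<bar> \<le> \<bar>1 + Y\<bar>" using xD[OF k] that Y by linarith
      then have "(a - x k)\<^sup>2 \<le> (1 + Y)\<^sup>2" using abs_le_square_iff by blast
      then have "r a (x k) \<le> sqrt ((1 + Y)\<^sup>2 + 1)" unfolding r by simp
      moreover have "r 0 (x k) \<ge> 1" unfolding r by simp
      ultimately show "1 / sqrt ((1 + Y)\<^sup>2 + 1) \<le> r 0 (x k) / r a (x k)"
        using rpos[of a "x k"] by (intro frac_le) auto
    qed (auto simp: add_nonneg_pos)
    moreover have "(\<Prod>k\<in>D. 1 / sqrt ((1 + Y)\<^sup>2 + 1)) = 1 / (sqrt ((1 + Y)\<^sup>2 + 1) ^ 2) ^ 5" 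
      unfolding power_mult[symmetric] using fin by (simp add: power_divide)
    moreover have "sqrt ((1 + Y)\<^sup>2 + 1) ^ 2 = (1 + Y)\<^sup>2 + 1" by (simp add: add_nonneg_nonneg)
    ultimately show ?thesis by simp
  qed
  have Rpos: "R a > 0" for a unfolding R_def using rpos by (auto intro!: prod_pos)
  show ?thesis
  proof (intro exI[of _ u] conjI allI impI)
    show "bandlimited (\<tau> / 2) u"
      unfolding u_def by (intro bandlimited_cmult bandlimited_shift G)
  next
    fix a :: real
    have "cmod (u a) = sn a / sn 0 * (exp (\<Theta> a) / exp (\<Theta> 0)) * R a" unfolding u ratio ..
    also have "\<dots> \<le> (cosh (pi * \<tau>) / sinh (pi * \<tau>)) * (exp (- \<omega> a) * (256 * (1 + a\<^sup>2) ^ 4)) * (32 * (1 + Y\<^sup>2) ^ 10 / (1 + a\<^sup>2) ^ 5)"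
    proof (intro mult_mono R_up)
      show "sn a / sn 0 \<le> cosh (pi * \<tau>) / sinh (pi * \<tau>)" using sn[of a] sn[of 0] sh snpos[of a] snpos[of 0] by (intro frac_le) linarith+
      have "exp (\<Theta> a) / exp (\<Theta> 0) \<le> exp (- \<omega> a) * (1 + \<bar>a\<bar>) ^ 8" using E(1)[of a] by (simp add: field_simps)
      also have "\<dots> \<le> exp (- \<omega> a) * (256 * (1 + a\<^sup>2) ^ 4)" using sq[of a] by (intro mult_left_mono) auto
      finally show "exp (\<Theta> a) / exp (\<Theta> 0) \<le> exp (- \<omega> a) * (256 * (1 + a\<^sup>2) ^ 4)" .
    qed (use sh Rpos[of a] in \<open>auto intro!: mult_nonneg_nonneg divide_nonneg_nonneg less_imp_le\<close>)
    also have "\<dots> = cosh (pi * \<tau>) / sinh (pi * \<tau>) * 8192 * (1 + Y\<^sup>2) ^ 10 / (1 + a\<^sup>2) * exp (- \<omega> a)"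
    proof -
      have aux: "c * (e * (256 * q ^ 4)) * (32 * y / q ^ 5) = c * 8192 * y / q * e" if "q > 0" for c e q y :: real
      proof -
        have "q ^ 5 = q * q ^ 4" by (simp flip: power_Suc)
        then show ?thesis using that by simp
      qed
      have "1 + a\<^sup>2 > 0" by (simp add: add_pos_nonneg)
      then show ?thesis by (rule aux)
    qed
    finally show "cmod (u a) \<le> cosh (pi * \<tau>) / sinh (pi * \<tau>) * 8192 * (1 + Y\<^sup>2) ^ 10 / (1 + a\<^sup>2) * exp (- \<omega> a)" .
  next
    fix a :: real assume a: "\<bar>a\<bar> \<le> 1"
    have "sinh (pi * \<tau>) / cosh (pi * \<tau>) / 256 / ((1 + Y)\<^sup>2 + 1) ^ 5 * exp (- \<omega> a) 
      = sinh (pi * \<tau>) / cosh (pi * \<tau>) * (exp (- \<omega> a) / 256) * (1 / ((1 + Y)\<^sup>2 + 1) ^ 5)" by simp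
    also have "\<dots> \<le> sn a / sn 0 * (exp (\<Theta> a) / exp (\<Theta> 0)) * R a"
    proof (intro mult_mono R_low a)
      show "sinh (pi * \<tau>) / cosh (pi * \<tau>) \<le> sn a / sn 0" using sn[of a] sn[of 0] sh snpos[of a] snpos[of 0] by (intro frac_le) linarith+
      have "(1 + \<bar>a\<bar>) ^ 8 \<le> 2 ^ 8" using a by (intro power_mono) auto
      then have "exp (- \<omega> a) / 256 \<le> exp (- \<omega> a) / (1 + \<bar>a\<bar>) ^ 8" by (intro divide_left_mono) auto
      also have "\<dots> \<le> exp (\<Theta> a) / exp (\<Theta> 0)" using E(2)[of a] by (simp add: field_simps)
      finally show "exp (- \<omega> a) / 256 \<le> exp (\<Theta> a) / exp (\<Theta> 0)" .
    qed (use sh snpos[of a] snpos[of 0] in \<open>auto intro!: mult_nonneg_nonneg divide_nonneg_nonneg less_imp_le\<close>)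
    also have "\<dots> = cmod (u a)" unfolding u ratio ..
    finally show "sinh (pi * \<tau>) / cosh (pi * \<tau>) / 256 / ((1 + Y)\<^sup>2 + 1) ^ 5 * exp (- \<omega> a) \<le> cmod (u a)" .
  qed
qed

section \<open>Phases assembled from finitely many bumps\<close>

definition multiplier_upper :: "real \<Rightarrow> real" where
  "multiplier_upper \<tau> = cosh (pi * \<tau>) / sinh (pi * \<tau>) * 8192 * (1 + (20 / \<tau>)\<^sup>2) ^ 10"

definition multiplier_lower :: "real \<Rightarrow> real" where
  "multiplier_lower \<tau> = sinh (pi * \<tau>) / cosh (pi * \<tau>) / 256 / ((1 + 20 / \<tau>)\<^sup>2 + 1) ^ 5"

definition bump :: "real \<Rightarrow> real \<Rightarrow> real \<Rightarrow> real" where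
  "bump c L a = L ^ 3 / c\<^sup>2 * (a\<^sup>2 / ((a - c)\<^sup>2 + L\<^sup>2))"

lemma pole_tendsto_0:
  assumes "Im p \<noteq> 0" shows "((\<lambda>s::real. Im (w / (of_real s - p))) \<longlongrightarrow> 0) at_infinity"
proof -
  have "filterlim (\<lambda>s::real. complex_of_real s - p) at_infinity at_infinity"
    unfolding filterlim_at_infinity_conv_norm_at_top
  proof (rule filterlim_at_top_mono)
    show "filterlim (\<lambda>s::real. (- cmod p) + norm s) at_top at_infinity"
      by (intro filterlim_tendsto_add_at_top[OF tendsto_const] filterlim_at_infinity_imp_norm_at_top filterlim_ident)
    show "\<forall>\<^sub>F s in at_infinity. - cmod p + norm s \<le> cmod (complex_of_real s - p)"
    proof (intro always_eventually allI)
      fix s :: real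
      show "- cmod p + norm s \<le> cmod (complex_of_real s - p)"
        using norm_triangle_ineq2[of "complex_of_real s" p] by simp
    qed
  qed
  then have "((\<lambda>s::real. w / (complex_of_real s - p)) \<longlongrightarrow> 0) at_infinity"
    by (intro tendsto_divide_0[OF tendsto_const])
  from tendsto_Im[OF this] show ?thesis by simp
qed

text \<open>\<open>2 \<le> L\<close> keeps the poles \<open>p\<close> at distance at least 1 below
  the real axis, and \<open>L \<le> \<bar>c\<bar>\<close> bounds the numerators by 2 \<alpha> L^2.
  As |s - p|^2 is at least a quarter of (s - c)^2 + L^2, the derivative of \<open>v\<close> is
  dominated by the sum in the last hypothesis, which explains the 8. Its bound is half of the slope
  \<pi>\<tau>, so the phase stays increasing.\<close>

lemma multiplier_bumps:
  fixes P :: "'a set" and c L :: "'a \<Rightarrow> real" and \<alpha> \<tau> :: real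
  assumes P: "finite P" and \<tau>: "\<tau> > 0" and \<alpha>: "\<alpha> \<ge> 0"
    and L: "\<And>j. j \<in> P \<Longrightarrow> 2 \<le> L j" "\<And>j. j \<in> P \<Longrightarrow> L j \<le> \<bar>c j\<bar>"
    and sum: "\<And>s. (\<Sum>j\<in>P. 8 * \<alpha> * ((L j)\<^sup>2 / ((s - c j)\<^sup>2 + (L j)\<^sup>2))) \<le> pi * \<tau> / 2"
  shows "\<exists>F. bandlimited (\<tau> / 2) F \<and>
     (\<forall>a::real. cmod (F a) \<le> multiplier_upper \<tau> / (1 + a\<^sup>2) * exp (- (\<Sum>j\<in>P. \<alpha> * bump (c j) (L j) a))) \<and>
     (\<forall>a::real. \<bar>a\<bar> \<le> 1 \<longrightarrow> multiplier_lower \<tau> * exp (- (\<Sum>j\<in>P. \<alpha> * bump (c j) (L j) a)) \<le> cmod (F a))"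
proof -
  \<comment> \<open>By i q^2 / (a - q) = i a^2 / (a - q) - i a - i q, the real part of the left side
    is L a^2 / ((a - c)^2 + L^2) - L: a bump with a double zero at 0, minus a constant. The real
    factor in \<open>w\<close> scales it to \<alpha> times \<open>bump\<close>. \<open>p\<close> is
    \<open>q\<close> raised by \<i> because the evaluation takes place at a + \<i>.\<close>
  define q where "q j = Complex (c j) (- L j)" for j
  define p where "p j = q j + \<i>" for j
  define w where "w j = \<i> * of_real (\<alpha> * (L j)\<^sup>2 / (c j)\<^sup>2) * (q j)\<^sup>2" for j
  define v where "v s = (\<Sum>j\<in>P. Im (w j / (of_real s - p j)))" for s :: real
  have Imp: "Im (p j) < 0" if "j \<in> P" for j using L(1)[OF that] by (simp add: p_def q_def)
  have c0: "c j \<noteq> 0" if "j \<in> P" for j using L[OF that] by auto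
  have wnorm: "cmod (w j) \<le> 2 * \<alpha> * (L j)\<^sup>2" if "j \<in> P" for j
  proof -
    have l: "(L j)\<^sup>2 \<le> (c j)\<^sup>2" using L[OF that] by (metis abs_le_square_iff abs_of_nonneg order_trans zero_le_numeral)
    have "cmod (w j) = (\<alpha> * (L j)\<^sup>2 / (c j)\<^sup>2) * ((c j)\<^sup>2 + (L j)\<^sup>2)"
    proof -
      have "cmod (w j) = \<bar>\<alpha> * (L j)\<^sup>2 / (c j)\<^sup>2\<bar> * (cmod (q j))\<^sup>2"
        unfolding w_def norm_mult norm_power norm_of_real by simp
      then show ?thesis using \<alpha> by (simp add: q_def cmod_power2)
    qed
    also have "\<dots> \<le> (\<alpha> * (L j)\<^sup>2 / (c j)\<^sup>2) * (2 * (c j)\<^sup>2)"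
      using \<alpha> l by (intro mult_left_mono) auto
    also have "\<dots> = 2 * \<alpha> * (L j)\<^sup>2" using c0[OF that] by simp
    finally show ?thesis .
  qed
  have den: "(s - c j)\<^sup>2 + (L j)\<^sup>2 \<le> 4 * (cmod (of_real s - p j))\<^sup>2" if "j \<in> P" for s j
  proof -
    have "(L j)\<^sup>2 \<le> (2 * (L j - 1))\<^sup>2" using L(1)[OF that] by (intro power_mono) auto
    then have "(L j)\<^sup>2 \<le> 4 * (L j - 1)\<^sup>2" unfolding power_mult_distrib by simp
    moreover have "0 \<le> (s - c j)\<^sup>2" by simp
    moreover have "(cmod (of_real s - p j))\<^sup>2 = (s - c j)\<^sup>2 + (L j - 1)\<^sup>2" by (simp add: cmod_power2 p_def q_def)
    ultimately show ?thesis by linarith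
  qed
  have vd: "(v has_real_derivative (\<Sum>j\<in>P. Im (- w j / (of_real s - p j)\<^sup>2))) (at s)" for s
    unfolding v_def
  proof (rule DERIV_sum)
    fix j assume j: "j \<in> P"
    have nz: "complex_of_real s - p j \<noteq> 0" using of_real_minus_nonreal_neq_0 Imp[OF j] by auto
    have "((\<lambda>z. w j / (z - p j)) has_field_derivative - w j / (of_real s - p j)\<^sup>2) (at (of_real s))"
      using nz by (auto intro!: derivative_eq_intros simp: power2_eq_square)
    then have "((\<lambda>s. w j / (of_real s - p j)) has_vector_derivative - w j / (of_real s - p j)\<^sup>2) (at s)"
      by (rule has_vector_derivative_real_field[where f = "\<lambda>z. w j / (z - p j)"])
    from bounded_linear.has_vector_derivative[OF bounded_linear_Im this]
    show "((\<lambda>s. Im (w j / (of_real s - p j))) has_real_derivative Im (- w j / (of_real s - p j)\<^sup>2)) (at s)"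
      by (simp add: has_real_derivative_iff_has_vector_derivative)
  qed
  have vd_bound: "\<bar>\<Sum>j\<in>P. Im (- w j / (of_real s - p j)\<^sup>2)\<bar> \<le> pi * \<tau> / 2" for s
  proof -
    have "\<bar>\<Sum>j\<in>P. Im (- w j / (of_real s - p j)\<^sup>2)\<bar> \<le> (\<Sum>j\<in>P. \<bar>Im (- w j / (of_real s - p j)\<^sup>2)\<bar>)"
      by (rule sum_abs)
    also have "\<dots> \<le> (\<Sum>j\<in>P. 8 * \<alpha> * ((L j)\<^sup>2 / ((s - c j)\<^sup>2 + (L j)\<^sup>2)))"
    proof (rule sum_mono)
      fix j assume j: "j \<in> P"
      have "complex_of_real s - p j \<noteq> 0" using of_real_minus_nonreal_neq_0 Imp[OF j] by auto
      then have pos: "(cmod (complex_of_real s - p j))\<^sup>2 > 0" by simp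
      have pos2: "(s - c j)\<^sup>2 + (L j)\<^sup>2 > 0" using L(1)[OF j] by (auto intro!: add_nonneg_pos)
      have "\<bar>Im (- w j / (of_real s - p j)\<^sup>2)\<bar> \<le> cmod (- w j / (of_real s - p j)\<^sup>2)" by (rule abs_Im_le_cmod)
      also have "\<dots> = cmod (w j) / (cmod (of_real s - p j))\<^sup>2" by (simp add: norm_divide norm_power)
      also have "\<dots> \<le> (2 * \<alpha> * (L j)\<^sup>2) / (((s - c j)\<^sup>2 + (L j)\<^sup>2) / 4)"
        using wnorm[OF j] den[OF j, of s] pos2 \<alpha> by (intro frac_le) auto
      also have "\<dots> = 8 * \<alpha> * ((L j)\<^sup>2 / ((s - c j)\<^sup>2 + (L j)\<^sup>2))" by simp
      finally show "\<bar>Im (- w j / (of_real s - p j)\<^sup>2)\<bar> \<le> 8 * \<alpha> * ((L j)\<^sup>2 / ((s - c j)\<^sup>2 + (L j)\<^sup>2))" .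
    qed
    also have "\<dots> \<le> pi * \<tau> / 2" by (rule sum)
    finally show ?thesis .
  qed
  have lip: "\<bar>v t - v s\<bar> \<le> (pi * \<tau> / 2) * (t - s)" if "s \<le> t" for s t
  proof (cases "s = t")
    case False
    then have "s < t" using that by simp
    from MVT2[OF this vd] obtain z where "v t - v s = (t - s) * (\<Sum>j\<in>P. Im (- w j / (of_real z - p j)\<^sup>2))" by blast
    then have "\<bar>v t - v s\<bar> = (t - s) * \<bar>\<Sum>j\<in>P. Im (- w j / (of_real z - p j)\<^sup>2)\<bar>"
      using that by (simp add: abs_mult)
    also have "\<dots> \<le> (t - s) * (pi * \<tau> / 2)" using that vd_bound[of z] by (intro mult_left_mono) auto
    finally show ?thesis by (simp only: mult.commute)
  qed simp
  \<comment> \<open>This bound and the radius \<open>S\<close> found below depend on the cover, but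
    they only decide how many zeros are moved and do not enter the constants of the
    multiplier.\<close>
  have V: "\<bar>v s\<bar> \<le> (\<Sum>j\<in>P. cmod (w j))" for s
    unfolding v_def
  proof (rule order_trans[OF sum_abs sum_mono])
    fix j assume j: "j \<in> P"
    have "1 \<le> \<bar>Im (of_real s - p j)\<bar>" using L(1)[OF j] by (simp add: p_def q_def)
    also have "\<dots> \<le> cmod (of_real s - p j)" by (rule abs_Im_le_cmod)
    finally have 1: "1 \<le> cmod (of_real s - p j)" .
    have "\<bar>Im (w j / (of_real s - p j))\<bar> \<le> cmod (w j) / cmod (of_real s - p j)"
      using abs_Im_le_cmod[of "w j / (of_real s - p j)"] by (simp add: norm_divide)
    also have "\<dots> \<le> cmod (w j) / 1" using 1 by (intro divide_left_mono) auto
    finally show "\<bar>Im (w j / (of_real s - p j))\<bar> \<le> cmod (w j)" by simp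
  qed
  have "(v \<longlongrightarrow> (\<Sum>j\<in>P. 0)) at_infinity"
    unfolding v_def using Imp by (intro tendsto_sum pole_tendsto_0) fastforce
  then have "\<forall>\<^sub>F s in at_infinity. dist (v s) 0 < pi / 2" by (intro tendstoD) auto
  then obtain S where "\<forall>s. norm s \<ge> S \<longrightarrow> dist (v s) 0 < pi / 2"
    unfolding eventually_at_infinity by blast
  then have S: "\<bar>s\<bar> \<ge> S \<Longrightarrow> \<bar>v s\<bar> \<le> pi / 2" for s
    by (metis dist_0_norm dist_commute less_imp_le real_norm_def)
  have int1: "integrable lborel (\<lambda>s. v s * conj_kernel a s)" 
    "(LINT s|lborel. v s * conj_kernel a s) = pi * (\<Sum>j\<in>P. Re (w j / (Complex a 1 - p j)))" for a
    unfolding v_def sum_distrib_right sum_distrib_left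
    using integral_pole_conj_kernel[OF Imp] by auto
  have Re_w: "Re (w j / (Complex a 1 - p j)) = \<alpha> * bump (c j) (L j) a - \<alpha> * (L j) ^ 3 / (c j)\<^sup>2" if j: "j \<in> P" for a j
  proof -
    define d where "d = (a - c j)\<^sup>2 + (L j)\<^sup>2"
    have d: "d > 0" unfolding d_def using L(1)[OF j] by (auto intro!: add_nonneg_pos)
    have z: "Complex a 1 - p j = Complex (a - c j) (L j)" by (simp add: p_def q_def complex_eq_iff)
    have wj: "w j = Complex (\<alpha> * (L j)\<^sup>2 / (c j)\<^sup>2 * (2 * c j * L j)) (\<alpha> * (L j)\<^sup>2 / (c j)\<^sup>2 * ((c j)\<^sup>2 - (L j)\<^sup>2))"
      by (simp add: w_def q_def complex_eq_iff power2_eq_square)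
    have "Re (w j / (Complex a 1 - p j)) = \<alpha> * (L j)\<^sup>2 / (c j)\<^sup>2 * ((2 * c j * L j) * (a - c j) + ((c j)\<^sup>2 - (L j)\<^sup>2) * L j) / d"
    proof -
      have "Re (Complex (k * A) (k * B) / Complex x y) = k * (A * x + B * y) / (x\<^sup>2 + y\<^sup>2)" for k A B x y
        by (simp add: Re_divide) (simp add: algebra_simps)
      then show ?thesis unfolding z wj d_def by blast
    qed
    also have "(2 * c j * L j) * (a - c j) + ((c j)\<^sup>2 - (L j)\<^sup>2) * L j = L j * (a\<^sup>2 - d)"
      by (simp add: d_def power2_eq_square algebra_simps)
    also have "\<alpha> * (L j)\<^sup>2 / (c j)\<^sup>2 * (L j * (a\<^sup>2 - d)) / d = \<alpha> * (L j) ^ 3 / (c j)\<^sup>2 * (a\<^sup>2 / d - 1)"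
      using d by (simp add: field_simps power2_eq_square power3_eq_cube)
    finally show ?thesis by (simp add: bump_def d_def algebra_simps)
  qed
  have int: "integrable lborel (\<lambda>s. v s * (conj_kernel a s - conj_kernel 0 s))" for a
    unfolding right_diff_distrib using int1[of a] int1[of 0] by simp
  have \<omega>: "(LINT s|lborel. v s * (conj_kernel a s - conj_kernel 0 s)) = pi * (\<Sum>j\<in>P. \<alpha> * bump (c j) (L j) a)" for a
  proof -
    have "(LINT s|lborel. v s * (conj_kernel a s - conj_kernel 0 s)) 
      = pi * (\<Sum>j\<in>P. Re (w j / (Complex a 1 - p j))) - pi * (\<Sum>j\<in>P. Re (w j / (Complex 0 1 - p j)))"
      unfolding right_diff_distrib using int1[of a] int1[of 0] by simp
    also have "\<dots> = pi * (\<Sum>j\<in>P. Re (w j / (Complex a 1 - p j)) - Re (w j / (Complex 0 1 - p j)))"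
      by (simp only: right_diff_distrib sum_subtractf)
    also have "\<dots> = pi * (\<Sum>j\<in>P. \<alpha> * bump (c j) (L j) a)"
      using Re_w[of _ a] Re_w[of _ 0] by (intro arg_cong[where f = "\<lambda>x. pi * x"] sum.cong) (auto simp: bump_def)
    finally show ?thesis .
  qed
  from multiplier_from_phase[OF \<tau> lip V S int \<omega>] show ?thesis
    unfolding multiplier_upper_def multiplier_lower_def by simp
qed

section \<open>Multipliers adapted to a short cover\<close>

text \<open>Replacing \<open>y\<close> by its floor costs a factor 3 and each half-line is dominated
  by one convergent series, whence the 6; the 1 makes the constant positive. The point is uniformity
  in \<open>y\<close> and \<open>A\<close>: the lemma serves both for the bumps of one scale and for
  the windows around integers.\<close>

lemma lattice_sum_bound:
  "\<exists>Z>0. \<forall>(y::real) (A :: int set). finite A \<longrightarrow> (\<Sum>j\<in>A. 1 / (1 + (y - of_int j)\<^sup>2)) \<le> Z"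
proof -
  define g where "g n = 1 / (1 + (real n)\<^sup>2)" for n
  have sm: "summable g"
  proof (rule summable_comparison_test')
    show "summable (\<lambda>n. inverse (real n ^ 2))" by (rule inverse_power_summable) simp
    fix n :: nat assume "n \<ge> 1"
    then show "norm (g n) \<le> inverse (real n ^ 2)"
      unfolding g_def by (simp add: divide_inverse add_nonneg_nonneg) (intro le_imp_inverse_le, auto)
  qed
  have g0: "g n \<ge> 0" for n unfolding g_def by simp
  have half: "(\<Sum>i\<in>B. 1 / (1 + (real_of_int i)\<^sup>2)) \<le> suminf g" if "finite B" "inj_on (\<lambda>i. nat \<bar>i\<bar>) B" for B :: "int set"
  proof -
    have "(\<Sum>i\<in>B. 1 / (1 + (real_of_int i)\<^sup>2)) = (\<Sum>i\<in>B. g (nat \<bar>i\<bar>))"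
      unfolding g_def by (intro sum.cong) auto
    also have "\<dots> = sum g ((\<lambda>i. nat \<bar>i\<bar>) ` B)" using that by (simp add: sum.reindex)
    also have "\<dots> \<le> suminf g" using that sm g0 by (intro sum_le_suminf) auto
    finally show ?thesis .
  qed
  have two: "(\<Sum>i\<in>B. 1 / (1 + (real_of_int i)\<^sup>2)) \<le> 2 * suminf g" if "finite B" for B :: "int set"
  proof -
    have "(\<Sum>i\<in>B. 1 / (1 + (real_of_int i)\<^sup>2)) = (\<Sum>i\<in>B \<inter> {0..}. 1 / (1 + (real_of_int i)\<^sup>2)) + (\<Sum>i\<in>B - {0..}. 1 / (1 + (real_of_int i)\<^sup>2))"
      using that by (metis sum.Int_Diff)
    also have "\<dots> \<le> suminf g + suminf g"
      using that by (intro add_mono half) (auto simp: inj_on_def)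
    finally show ?thesis by simp
  qed
  have "(\<Sum>j\<in>A. 1 / (1 + (y - of_int j)\<^sup>2)) \<le> 6 * suminf g + 1" if "finite A" for y and A :: "int set"
  proof -
    define k where "k = \<lfloor>y\<rfloor>"
    have "(\<Sum>j\<in>A. 1 / (1 + (y - of_int j)\<^sup>2)) \<le> (\<Sum>j\<in>A. 3 * (1 / (1 + (real_of_int (j - k))\<^sup>2)))"
    proof (rule sum_mono)
      fix j
      define u i where "u = y - of_int j" and "i = real_of_int (j - k)"
      have "\<bar>i + u\<bar> \<le> 1" unfolding u_def i_def k_def by simp linarith
      then have "(i + u)\<^sup>2 \<le> 1" by (simp add: abs_square_le_1)
      moreover have "i\<^sup>2 \<le> 2 * (i + u)\<^sup>2 + 2 * u\<^sup>2"
        using zero_le_power2[of "i + 2 * u"] by (simp add: power2_eq_square algebra_simps)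
      moreover have "0 \<le> u\<^sup>2" by simp
      ultimately have "1 + i\<^sup>2 \<le> 3 + 3 * u\<^sup>2" by linarith
      then have "1 + i\<^sup>2 \<le> 3 * (1 + u\<^sup>2)" by (simp only: distrib_left mult_1_right)
      moreover have "1 + u\<^sup>2 > 0" "1 + i\<^sup>2 > 0" by (simp_all add: add_pos_nonneg)
      ultimately have "1 / (1 + u\<^sup>2) \<le> 3 * (1 / (1 + i\<^sup>2))" by (simp add: divide_simps)
      then show "1 / (1 + (y - of_int j)\<^sup>2) \<le> 3 * (1 / (1 + (real_of_int (j - k))\<^sup>2))" unfolding u_def i_def .
    qed
    also have "\<dots> = 3 * (\<Sum>i\<in>(\<lambda>j. j - k) ` A. 1 / (1 + (real_of_int i)\<^sup>2))"
      by (subst sum.reindex) (auto simp: inj_on_def sum_distrib_left)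
    also have "\<dots> \<le> 3 * (2 * suminf g)" using that by (intro mult_left_mono two) auto
    finally show ?thesis by simp
  qed
  moreover have "6 * suminf g + 1 > 0" using suminf_nonneg[OF sm g0] by simp
  ultimately show ?thesis by blast
qed

text \<open>The condition puts e^n between |s| / (2 e) and 2 |s|, a range of ratio 4 e, and 4 e <
  e^3.\<close>

lemma near_scales_card:
  fixes s :: real
  assumes "finite S" "\<And>n. n \<in> S \<Longrightarrow> exp (real n) \<le> 2 * \<bar>s\<bar> \<and> \<bar>s\<bar> \<le> 2 * exp (real n + 1)"
  shows "card S \<le> 3"
proof (cases "S = {}")
  case False
  define m where "m = Min S"
  have m: "m \<in> S" "\<And>n. n \<in> S \<Longrightarrow> m \<le> n" using False assms(1) by (auto simp: m_def)
  have "S \<subseteq> {m..m + 2}"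
  proof
    fix n assume n: "n \<in> S"
    have e2: "exp (1::real) > 2" using exp_lower_Taylor_quadratic[of "1::real"] by simp
    have "n \<le> m + 2"
    proof (rule ccontr)
      assume "\<not> n \<le> m + 2"
      then have "real m + 3 \<le> real n" by linarith
      then have "exp (real m + 3) \<le> exp (real n)" by simp
      moreover have "exp (real m + 1) * (exp 1 * exp 1) = exp (real m + 3)" by (simp flip: exp_add)
      ultimately have "exp (real m + 1) * (exp 1 * exp 1) \<le> exp (real m + 1) * 4" 
        using assms(2)[OF n] assms(2)[OF m(1)] by linarith
      then have "exp (1::real) * exp 1 \<le> 4" using exp_gt_zero[of "real m + 1"] mult_le_cancel_left_pos by blast
      moreover have "exp (1::real) * exp 1 > 2 * 2" using e2 by (intro mult_strict_mono) auto
      ultimately show False by simp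
    qed
    then show "n \<in> {m..m + 2}" using m(2)[OF n] by simp
  qed
  then have "card S \<le> card {m..m + 2}" by (intro card_mono) auto
  then show ?thesis by simp
qed simp

text \<open>The first sum controls the slope of the phase, the second the size of \<omega> on
  [-1, 1], where the multiplier must not be small. At the at most three scales comparable to
  \<open>\<bar>s\<bar>\<close> the centres belong to a lattice of spacing \<open>L n\<close>, and
  rescaling gives \<open>Z\<close>. At the other scales the distance to \<open>s\<close> is at least
  e^n / 4, so a term is at most 16 times its share of the norm.\<close>

lemma scale_sums:
  fixes L :: "nat \<Rightarrow> real" and I :: "nat \<Rightarrow> int set" and M Z :: real and N :: nat
  defines "P \<equiv> Sigma {n\<in>{1..N}. 2 \<le> L n} I"
  assumes Z: "\<And>y (A :: int set). finite A \<Longrightarrow> (\<Sum>j\<in>A. 1 / (1 + (y - of_int j)\<^sup>2)) \<le> Z" "Z > 0"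
    and L: "\<And>n. n \<in> {1..N} \<Longrightarrow> L n \<le> exp (real n) / 4" and fin: "\<And>n. n \<in> {1..N} \<Longrightarrow> finite (I n)"
    and c: "\<And>n j. n \<in> {1..N} \<Longrightarrow> j \<in> I n \<Longrightarrow> 3 / 4 * exp (real n) \<le> \<bar>of_int j * L n\<bar>"
       "\<And>n j. n \<in> {1..N} \<Longrightarrow> j \<in> I n \<Longrightarrow> \<bar>of_int j * L n\<bar> \<le> exp (real n + 1) + exp (real n) / 4"
    and M: "(\<Sum>n=1..N. (L n / exp (real n))\<^sup>2 * card (I n)) \<le> M"
  shows "(\<Sum>(n, j)\<in>P. (L n)\<^sup>2 / ((s - of_int j * L n)\<^sup>2 + (L n)\<^sup>2)) \<le> 3 * Z + 16 * M"
    and "\<bar>x\<bar> \<le> 1 \<Longrightarrow> (\<Sum>(n, j)\<in>P. bump (of_int j * L n) (L n) x) \<le> 16 * M"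
proof -
  define S where "S = {n\<in>{1..N}. 2 \<le> L n}"
  have S: "finite S" "\<And>n. n \<in> S \<Longrightarrow> n \<in> {1..N}" "\<And>n. n \<in> S \<Longrightarrow> 2 \<le> L n" by (auto simp: S_def)
  define a where "a n = (L n / exp (real n))\<^sup>2 * card (I n)" for n
  have a0: "a n \<ge> 0" for n by (simp add: a_def)
  have aS: "(\<Sum>n\<in>S. a n) \<le> M"
  proof -
    have "(\<Sum>n\<in>S. a n) \<le> (\<Sum>n=1..N. a n)" 
    proof (rule sum_mono2)
      show "S \<subseteq> {1..N}" using S(2) by blast
    qed (use a0 in auto)
    then show ?thesis using M by (simp add: a_def)
  qed
  have split: "(\<Sum>(n, j)\<in>P. f n j) = (\<Sum>n\<in>S. \<Sum>j\<in>I n. f n j)" for f :: "nat \<Rightarrow> int \<Rightarrow> real"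
    unfolding P_def S_def[symmetric] 
  proof (rule sum.Sigma[symmetric])
    show "finite S" by (rule S)
    show "\<forall>n\<in>S. finite (I n)" using fin S(2) by blast
  qed
  show "(\<Sum>(n, j)\<in>P. (L n)\<^sup>2 / ((s - of_int j * L n)\<^sup>2 + (L n)\<^sup>2)) \<le> 3 * Z + 16 * M"
  proof -
    define near where "near n \<longleftrightarrow> exp (real n) \<le> 2 * \<bar>s\<bar> \<and> \<bar>s\<bar> \<le> 2 * exp (real n + 1)" for n
    have "(\<Sum>j\<in>I n. (L n)\<^sup>2 / ((s - of_int j * L n)\<^sup>2 + (L n)\<^sup>2)) \<le> (if near n then Z else 0) + 16 * a n" if n: "n \<in> S" for n
    proof (cases "near n")
      case True
      have Ln: "L n > 0" using S(3)[OF n] by simp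
      have "(\<Sum>j\<in>I n. (L n)\<^sup>2 / ((s - of_int j * L n)\<^sup>2 + (L n)\<^sup>2)) = (\<Sum>j\<in>I n. 1 / (1 + (s / L n - of_int j)\<^sup>2))"
      proof (rule sum.cong)
        fix j
        have "(s - of_int j * L n)\<^sup>2 + (L n)\<^sup>2 = (L n)\<^sup>2 * (1 + (s / L n - of_int j)\<^sup>2)"
          using Ln by (simp add: field_simps power2_eq_square)
        then show "(L n)\<^sup>2 / ((s - of_int j * L n)\<^sup>2 + (L n)\<^sup>2) = 1 / (1 + (s / L n - of_int j)\<^sup>2)"
          using Ln by simp
      qed simp
      also have "\<dots> \<le> Z" using fin S(2)[OF n] by (intro Z)
      finally show ?thesis using True a0[of n] by simp
    next
      case False
      have "(\<Sum>j\<in>I n. (L n)\<^sup>2 / ((s - of_int j * L n)\<^sup>2 + (L n)\<^sup>2)) \<le> (\<Sum>j\<in>I n. 16 * (L n / exp (real n))\<^sup>2)"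
      proof (rule sum_mono)
        fix j assume j: "j \<in> I n"
        have "exp (real n) / 4 \<le> \<bar>s - of_int j * L n\<bar>"
        proof -
          have "exp (real n + 1) \<ge> exp (real n)" by simp
          then show ?thesis using False c[OF S(2)[OF n] j] unfolding near_def by linarith
        qed
        then have "(exp (real n) / 4)\<^sup>2 \<le> \<bar>s - of_int j * L n\<bar>\<^sup>2" by (intro power_mono) auto
        then have "(exp (real n) / 4)\<^sup>2 \<le> (s - of_int j * L n)\<^sup>2 + (L n)\<^sup>2" using zero_le_power2[of "L n"] unfolding power2_abs by linarith
        then have "(L n)\<^sup>2 / ((s - of_int j * L n)\<^sup>2 + (L n)\<^sup>2) \<le> (L n)\<^sup>2 / (exp (real n) / 4)\<^sup>2"
          by (intro frac_le) auto
        also have "\<dots> = 16 * (L n / exp (real n))\<^sup>2" by (simp add: power_divide)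
        finally show "(L n)\<^sup>2 / ((s - of_int j * L n)\<^sup>2 + (L n)\<^sup>2) \<le> 16 * (L n / exp (real n))\<^sup>2" .
      qed
      then show ?thesis using False by (simp add: a_def ac_simps)
    qed
    then have "(\<Sum>n\<in>S. \<Sum>j\<in>I n. (L n)\<^sup>2 / ((s - of_int j * L n)\<^sup>2 + (L n)\<^sup>2)) \<le> (\<Sum>n\<in>S. (if near n then Z else 0) + 16 * a n)"
      by (rule sum_mono)
    also have "\<dots> = Z * card (S \<inter> {n. near n}) + 16 * (\<Sum>n\<in>S. a n)"
      using S(1) by (simp add: sum.distrib sum.If_cases sum_distrib_left)
    also have "card (S \<inter> {n. near n}) \<le> 3"
      using S(1) by (intro near_scales_card[where s = s]) (auto simp: near_def)
    then have "Z * card (S \<inter> {n. near n}) \<le> Z * 3" using Z(2) by (intro mult_left_mono) auto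
    finally show ?thesis unfolding split using aS by simp
  qed
  show "(\<Sum>(n, j)\<in>P. bump (of_int j * L n) (L n) x) \<le> 16 * M" if x: "\<bar>x\<bar> \<le> 1"
  proof -
    have "(\<Sum>j\<in>I n. bump (of_int j * L n) (L n) x) \<le> 16 * a n" if n: "n \<in> S" for n
    proof -
      have "(\<Sum>j\<in>I n. bump (of_int j * L n) (L n) x) \<le> (\<Sum>j\<in>I n. 16 * (L n / exp (real n))\<^sup>2)"
      proof (rule sum_mono)
        fix j assume j: "j \<in> I n"
        define d where "d = \<bar>of_int j * L n\<bar>"
        have d: "3 / 4 * exp (real n) \<le> d" unfolding d_def by (rule c(1)[OF S(2)[OF n] j])
        have "exp (real n) \<ge> exp 1" using S(2)[OF n] by simp
        moreover have "exp (1::real) \<ge> 2" using exp_ge_add_one_self[of "1::real"] by simp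
        ultimately have d1: "d \<ge> 3/2" using d by linarith
        have Ln: "2 \<le> L n" "L n \<le> d" using S(3)[OF n] L[OF S(2)[OF n]] d exp_gt_zero[of "real n"] by (auto simp del: exp_gt_zero) 
        \<comment> \<open>3/2 is the threshold from which \<open>d - 1 \<ge> d / 3\<close> holds. It
          is reached because the scales start at n = 1.\<close>
        have "d / 3 \<le> \<bar>x - of_int j * L n\<bar>" using x d1 unfolding d_def by linarith
        then have "(d / 3)\<^sup>2 \<le> \<bar>x - of_int j * L n\<bar>\<^sup>2" using d1 by (intro power_mono) auto
        then have den: "(d / 3)\<^sup>2 \<le> (x - of_int j * L n)\<^sup>2 + (L n)\<^sup>2" using zero_le_power2[of "L n"] unfolding power2_abs by linarith
        have dp: "(d / 3)\<^sup>2 > 0" using d1 by simp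
        have x2: "x\<^sup>2 \<le> 1" using x by (simp add: abs_square_le_1)
        have "x\<^sup>2 / ((x - of_int j * L n)\<^sup>2 + (L n)\<^sup>2) \<le> 1 / (d / 3)\<^sup>2"
          using den dp x2 by (intro frac_le) auto
        then have "bump (of_int j * L n) (L n) x \<le> L n ^ 3 / (of_int j * L n)\<^sup>2 * (1 / (d / 3)\<^sup>2)"
          unfolding bump_def using Ln by (intro mult_left_mono) auto
        also have "(of_int j * L n)\<^sup>2 = d\<^sup>2" by (simp add: d_def)
        also have "L n ^ 3 / d\<^sup>2 * (1 / (d / 3)\<^sup>2) = 9 * (L n)\<^sup>2 / d\<^sup>2 * (L n / d\<^sup>2)"
          using d1 by (simp add: power2_eq_square power3_eq_cube field_simps)
        also have "\<dots> \<le> 9 * (L n)\<^sup>2 / d\<^sup>2 * 1"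
        proof (rule mult_left_mono)
          have "d * 1 \<le> d * d" using d1 by (intro mult_left_mono) auto
          then have "L n \<le> d\<^sup>2" using Ln(2) unfolding power2_eq_square mult_1_right by linarith
          then show "L n / d\<^sup>2 \<le> 1" using d1 by simp
        qed simp
        also have "9 * (L n)\<^sup>2 / d\<^sup>2 * 1 \<le> 9 * (L n)\<^sup>2 / (3 / 4 * exp (real n))\<^sup>2"
          unfolding mult_1_right using d by (intro frac_le power_mono) auto
        also have "\<dots> = 16 * (L n / exp (real n))\<^sup>2" by (simp add: power_divide power_mult_distrib field_simps)
        finally show "bump (of_int j * L n) (L n) x \<le> 16 * (L n / exp (real n))\<^sup>2" .
      qed
      then show ?thesis by (simp add: a_def ac_simps)
    qed
    then have "(\<Sum>n\<in>S. \<Sum>j\<in>I n. bump (of_int j * L n) (L n) x) \<le> (\<Sum>n\<in>S. 16 * a n)" by (rule sum_mono)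
    also have "\<dots> \<le> 16 * M" using aS by (simp flip: sum_distrib_left)
    finally show ?thesis unfolding split .
  qed
qed

lemma interval_diff_le_length:
  assumes "is_interval I" "emeasure lborel I = ennreal r" "r > 0" "x \<in> I" "y \<in> I"
  shows "\<bar>x - y\<bar> \<le> r"
proof -
  have "y - x \<le> r" if "x \<in> I" "y \<in> I" "x \<le> y" for x y
  proof -
    have "{x..y} \<subseteq> I" using mem_is_interval_1_I[OF assms(1) that(1,2)] by auto
    \<comment> \<open>\<open>emeasure\<close> is 0 off the measurable sets, so positive length
      already gives measurability.\<close>
    moreover have "I \<in> sets lborel" using assms(2,3) by (intro emeasure_neq_0_sets) auto
    ultimately have "emeasure lborel {x..y} \<le> ennreal r" using assms(2) by (metis emeasure_mono)
    then show ?thesis using that assms(3) by simp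
  qed
  from this[of x y] this[of y x] assms(4,5) show ?thesis by linarith
qed

text \<open>The intervals of a cover may overlap or cluster, which would spoil the lattice sums.
  They are traded for the cells [j r, (j + 1) r) that \<open>X\<close> meets. All points of one
  interval lie within \<open>r\<close> of a chosen one, so their indices differ from its index by at
  most 1: three cells per interval.\<close>

lemma card_floor_image:
  fixes X :: "real set" and r :: real
  assumes "finite JJ" "r > 0" "X \<subseteq> \<Union>JJ" "\<And>I x y. I \<in> JJ \<Longrightarrow> x \<in> I \<Longrightarrow> y \<in> I \<Longrightarrow> \<bar>x - y\<bar> \<le> r"
  shows "finite ((\<lambda>x. \<lfloor>x / r\<rfloor>) ` X)" "card ((\<lambda>x. \<lfloor>x / r\<rfloor>) ` X) \<le> 3 * card JJ"
proof -
  define K where "K I = {\<lfloor>(SOME x. x \<in> I) / r\<rfloor> - 1..\<lfloor>(SOME x. x \<in> I) / r\<rfloor> + 1}" for I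
  have sub: "(\<lambda>x. \<lfloor>x / r\<rfloor>) ` X \<subseteq> (\<Union>I\<in>JJ. K I)"
  proof
    fix k assume "k \<in> (\<lambda>x. \<lfloor>x / r\<rfloor>) ` X"
    then obtain x I where x: "k = \<lfloor>x / r\<rfloor>" "I \<in> JJ" "x \<in> I" using assms(3) by blast
    define x0 where "x0 = (SOME x. x \<in> I)"
    have "x0 \<in> I" unfolding x0_def using x(3) by (rule someI)
    then have "\<bar>x - x0\<bar> \<le> r" using assms(4)[OF x(2,3)] by blast
    then have "\<bar>x / r - x0 / r\<bar> \<le> 1" using assms(2) by (simp add: field_simps abs_le_iff)
    then have "\<bar>\<lfloor>x / r\<rfloor> - \<lfloor>x0 / r\<rfloor>\<bar> \<le> 1" by linarith
    then have "k \<in> K I" unfolding K_def x0_def[symmetric] x(1) by auto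
    then show "k \<in> (\<Union>I\<in>JJ. K I)" using x(2) by blast
  qed
  have fin: "finite (\<Union>I\<in>JJ. K I)" using assms(1) by (simp add: K_def)
  show "finite ((\<lambda>x. \<lfloor>x / r\<rfloor>) ` X)" using finite_subset[OF sub fin] .
  have "card ((\<lambda>x. \<lfloor>x / r\<rfloor>) ` X) \<le> card (\<Union>I\<in>JJ. K I)" by (rule card_mono[OF fin sub])
  also have "\<dots> \<le> (\<Sum>I\<in>JJ. card (K I))" by (rule card_UN_le[OF assms(1)])
  also have "\<dots> = 3 * card JJ" by (simp add: K_def)
  finally show "card ((\<lambda>x. \<lfloor>x / r\<rfloor>) ` X) \<le> 3 * card JJ" .
qed

text \<open>Since the lengths are positive, an infinite \<open>J n\<close> would make the norm
  infinite; this gives \<open>card\<close> its meaning. The shift from \<open>n\<close> to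
  \<open>n - 1\<close> undoes the summation over \<open>Suc n\<close>.\<close>

lemma cover_norm_partial_sum:
  assumes "cover_norm W J \<le> ennreal M" "M \<ge> 0" and pos: "\<And>n. n \<in> {1..N} \<Longrightarrow> short_length W n > 0"
  shows "\<And>n. n \<in> {1..N} \<Longrightarrow> finite (J n)"
    and "(\<Sum>n=1..N. (short_length W n / exp (real n))\<^sup>2 * card (J n)) \<le> M"
proof -
  define f where "f n = ennreal ((short_length W (Suc n) / exp (real (Suc n)))\<^sup>2) * emeasure (count_space UNIV) (J (Suc n))" for n
  have part: "(\<Sum>n\<in>F. f n) \<le> ennreal M" if "finite F" for F
  proof -
    have "(\<Sum>n\<in>F. f n) \<le> suminf f" using that by (intro sum_le_suminf) auto
    then show ?thesis using assms(1) unfolding cover_norm_def f_def by (rule order_trans)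
  qed
  show fin: "finite (J n)" if n: "n \<in> {1..N}" for n
  proof (rule ccontr)
    assume "infinite (J n)"
    obtain m where m: "n = Suc m" using n by (cases n) auto
    have "f m = \<infinity>" using \<open>infinite (J n)\<close> pos[OF n] unfolding f_def m[symmetric] by (simp add: ennreal_mult_eq_top_iff)
    then show False using part[of "{m}"] by (simp add: top_unique)
  qed
  have "ennreal (\<Sum>n=1..N. (short_length W n / exp (real n))\<^sup>2 * card (J n)) = (\<Sum>n=1..N. ennreal ((short_length W n / exp (real n))\<^sup>2 * card (J n)))"
    by (rule sum_ennreal[symmetric]) simp
  also have "\<dots> = (\<Sum>n=1..N. f (n - 1))"
  proof (rule sum.cong)
    fix n assume n: "n \<in> {1..N}"
    then have "Suc (n - 1) = n" by simp
    then show "ennreal ((short_length W n / exp (real n))\<^sup>2 * card (J n)) = f (n - 1)"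
      unfolding f_def using fin[OF n] by (simp add: ennreal_mult ennreal_of_nat_eq_real_of_nat)
  qed simp
  also have "\<dots> = (\<Sum>n\<in>(\<lambda>n. n - 1) ` {1..N}. f n)" by (subst sum.reindex) (auto simp: inj_on_def)
  also have "\<dots> \<le> ennreal M" by (rule part) simp
  finally show "(\<Sum>n=1..N. (short_length W n / exp (real n))\<^sup>2 * card (J n)) \<le> M"
    using assms(2) by (simp add: ennreal_le_iff)
qed

text \<open>\<beta>, \<open>B\<close> and \<open>b\<close> are fixed before \<open>Q\<close>,
  \<open>J\<close> and \<open>N\<close>. A multiplier is built from finitely many bumps, so only the
  scales up to \<open>N\<close> receive them and the gain over \<open>W\<close> is claimed up to
  e^(N+1); \<open>N\<close> will be taken as large as the spectrum requires.\<close>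

lemma cover_multiplier:
  fixes W :: "real \<Rightarrow> real" and C_doub \<tau> M :: real
  assumes mono: "mono_on {0..} W"
    and W1: "\<And>t. t \<ge> 1 \<Longrightarrow> W t > 1"
    and doub: "\<And>t. t > 1 \<Longrightarrow> ln (W (exp 1 * t)) \<le> C_doub * ln (W t)"
    and quarter: "\<And>t. t > 1 \<Longrightarrow> ln (W t) \<le> t / 4"
    and W0: "\<And>t. t \<ge> 0 \<Longrightarrow> W t \<ge> 1"
    and \<tau>: "\<tau> > 0" and M: "M > 0"
  obtains \<beta> B b where "\<beta> > 0" "B > 0" "b > 0"
    "\<And>Q J N. W_short_cover W J Q \<Longrightarrow> cover_norm W J \<le> ennreal M \<Longrightarrow>
       \<exists>F. bandlimited (\<tau> / 2) F \<and> (\<forall>x::real. cmod (F x) \<le> B / (1 + x\<^sup>2)) \<and>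
         (\<forall>x::real. x \<in> Q \<longrightarrow> \<bar>x\<bar> \<le> exp (real N + 1) \<longrightarrow> cmod (F x) * W \<bar>x\<bar> powr \<beta> \<le> B / (1 + x\<^sup>2)) \<and>
         (\<forall>x::real. \<bar>x\<bar> \<le> 1 \<longrightarrow> b \<le> cmod (F x))"
proof -
  obtain Z :: real where Z: "Z > 0"
    "\<And>y (A :: int set). finite A \<Longrightarrow> (\<Sum>j\<in>A. 1 / (1 + (y - of_int j)\<^sup>2)) \<le> Z"
    using lattice_sum_bound by blast
  define L where "L n = short_length W n" for n
  have Lpos: "L n > 0" for n unfolding L_def short_length_def using W1[of "exp (real n)"] by simp
  have Lq: "L n \<le> exp (real n) / 4" if "n \<ge> 1" for n
    unfolding L_def short_length_def using quarter[of "exp (real n)"] that by simp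
  have Ld: "L (n + 1) \<le> C_doub * L n" if "n \<ge> 1" for n
    using doub[of "exp (real n)"] that unfolding L_def short_length_def by (simp add: exp_add mult.commute)
  have Cd: "C_doub > 0"
  proof -
    have "0 < C_doub * L 1" using Ld[of 1] Lpos[of "1 + 1"] by linarith
    then show ?thesis using Lpos[of 1] by (simp add: zero_less_mult_iff)
  qed
  have Wmono: "W x \<le> W y" if "0 \<le> x" "x \<le> y" for x y using mono_onD[OF mono] that by auto
  define S where "S = 3 * Z + 16 * (3 * M)"
  have S: "S > 0" using Z M by (simp add: S_def add_pos_pos)
  \<comment> \<open>\<open>S\<close> bounds \<open>\<Sum> L\<^sup>2 / ((s - c)\<^sup>2 + L\<^sup>2)\<close> over all bumps, uniformly in \<open>s\<close> and in the cover\<close>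
  define \<alpha> where "\<alpha> = pi * \<tau> / (16 * S)"
  have \<alpha>: "\<alpha> > 0" "8 * \<alpha> * S = pi * \<tau> / 2" using \<tau> S by (auto simp: \<alpha>_def)
  \<comment> \<open>On the shell of index \<open>n\<close>, doubling gives log W \<le> C_doub L n,
    and on \<open>Q\<close> the bumps amount to at least \<alpha> L n / 4. This \<beta> makes the
    two balance.\<close>
  define \<beta> where "\<beta> = \<alpha> / (4 * C_doub)"
  have \<beta>: "\<beta> > 0" "\<beta> * C_doub = \<alpha> / 4" using \<alpha> Cd by (auto simp: \<beta>_def)
  \<comment> \<open>One summand for each regime: shells with bumps, shells with
    \<open>L n < 2\<close>, and \<open>\<bar>x\<bar> \<le> exp 1\<close>, which lies below the first
    shell.\<close>
  define B where "B = multiplier_upper \<tau> * (1 + exp (\<alpha> / 2) + W (exp 1) powr \<beta>)"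
  \<comment> \<open>48 = 16 * 3: the bound of \<open>scale_sums\<close> on [-1, 1], with the norm
    tripled by the passage to lattice cells.\<close>
  define b where "b = multiplier_lower \<tau> * exp (- (48 * \<alpha> * M))"
  have sh: "sinh (pi * \<tau>) > 0" "cosh (pi * \<tau>) > 0" using \<tau> by auto
  have mu: "multiplier_upper \<tau> > 0" unfolding multiplier_upper_def using sh by (intro mult_pos_pos divide_pos_pos zero_less_power add_pos_nonneg) auto
  have ml: "multiplier_lower \<tau> > 0" unfolding multiplier_lower_def using sh by (intro divide_pos_pos zero_less_power add_nonneg_pos) auto
  have B: "B > 0" unfolding B_def using mu by (intro mult_pos_pos add_pos_nonneg) auto
  have b: "b > 0" unfolding b_def using ml by simp
  have main: "\<exists>F. bandlimited (\<tau> / 2) F \<and> (\<forall>x::real. cmod (F x) \<le> B / (1 + x\<^sup>2)) \<and>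
         (\<forall>x::real. x \<in> Q \<longrightarrow> \<bar>x\<bar> \<le> exp (real N + 1) \<longrightarrow> cmod (F x) * W \<bar>x\<bar> powr \<beta> \<le> B / (1 + x\<^sup>2)) \<and>
         (\<forall>x::real. \<bar>x\<bar> \<le> 1 \<longrightarrow> b \<le> cmod (F x))"
    if cov: "W_short_cover W J Q" and nrm: "cover_norm W J \<le> ennreal M" for Q J N
  proof -
    define X where "X n = Q \<inter> {x. exp (real n) \<le> \<bar>x\<bar> \<and> \<bar>x\<bar> \<le> exp (real n + 1)}" for n
    define I where "I n = (\<lambda>x. \<lfloor>x / L n\<rfloor>) ` X n" for n
    have finJ: "finite (J n)" if "n \<in> {1..N}" for n
      using cover_norm_partial_sum(1)[OF nrm _ _ that] M Lpos unfolding L_def by auto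
    have sumJ: "(\<Sum>n=1..N. (L n / exp (real n))\<^sup>2 * card (J n)) \<le> M"
      unfolding L_def using Lpos M by (intro cover_norm_partial_sum(2)[OF nrm]) (auto simp: L_def)
    have J: "is_interval K" "emeasure lborel K = ennreal (L n)" if "n \<ge> 1" "K \<in> J n" for n K
      using cov that unfolding W_short_cover_def L_def by auto
    have XJ: "X n \<subseteq> \<Union>(J n)" if "n \<ge> 1" for n
    proof -
      have "Q \<inter> ({- exp (real (n + 1))..- exp (real n)} \<union> {exp (real n)..exp (real (n + 1))}) \<subseteq> \<Union>(J n)"
        using cov that unfolding W_short_cover_def by blast
      moreover have "X n \<subseteq> Q \<inter> ({- exp (real (n + 1))..- exp (real n)} \<union> {exp (real n)..exp (real (n + 1))})"
        unfolding X_def by (auto simp: abs_if add.commute split: if_splits)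
      ultimately show ?thesis by blast
    qed
    have I: "finite (I n)" "card (I n) \<le> 3 * card (J n)" if n: "n \<in> {1..N}" for n
    proof -
      have n1: "n \<ge> 1" using n by simp
      have d: "\<bar>x - y\<bar> \<le> L n" if "K \<in> J n" "x \<in> K" "y \<in> K" for K x y
        using interval_diff_le_length[OF J[OF n1 that(1)] Lpos that(2,3)] .
      show "finite (I n)" "card (I n) \<le> 3 * card (J n)"
        unfolding I_def using card_floor_image[OF finJ[OF n] Lpos XJ[OF n1] d] by auto
    qed
    \<comment> \<open>The bump sits at the left end of a cell, within L n \<le> e^n / 4 of a point
      of the shell.\<close>
    have centre: "\<bar>of_int j * L n\<bar> \<ge> 3 / 4 * exp (real n) \<and> \<bar>of_int j * L n\<bar> \<le> exp (real n + 1) + exp (real n) / 4" 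
      if n: "n \<in> {1..N}" and j: "j \<in> I n" for n j
    proof -
      obtain x where x: "x \<in> X n" "j = \<lfloor>x / L n\<rfloor>" using j by (auto simp: I_def)
      have "of_int j \<le> x / L n" "x / L n < of_int j + 1" unfolding x(2) by linarith+
      then have "of_int j * L n \<le> x" "x < of_int j * L n + L n" using Lpos[of n] by (simp_all add: field_simps)
      then have "\<bar>x - of_int j * L n\<bar> \<le> exp (real n) / 4" using Lq[of n] n by simp
      moreover have "exp (real n) \<le> \<bar>x\<bar>" "\<bar>x\<bar> \<le> exp (real n + 1)" using x(1) by (auto simp: X_def)
      ultimately show ?thesis by linarith
    qed
    have sumI: "(\<Sum>n=1..N. (L n / exp (real n))\<^sup>2 * card (I n)) \<le> 3 * M"
    proof -
      have "(\<Sum>n=1..N. (L n / exp (real n))\<^sup>2 * card (I n)) \<le> (\<Sum>n=1..N. 3 * ((L n / exp (real n))\<^sup>2 * card (J n)))"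
      proof (rule sum_mono)
        fix n assume "n \<in> {1..N}"
        then have "real (card (I n)) \<le> 3 * real (card (J n))" using I(2)[of n] by linarith
        from mult_left_mono[OF this, of "(L n / exp (real n))\<^sup>2"]
        show "(L n / exp (real n))\<^sup>2 * card (I n) \<le> 3 * ((L n / exp (real n))\<^sup>2 * card (J n))" by (simp add: ac_simps)
      qed
      also have "\<dots> \<le> 3 * M" using sumJ by (simp flip: sum_distrib_left)
      finally show ?thesis .
    qed
    \<comment> \<open>scales with \<open>L n < 2\<close> need no bump, since \<open>W\<close> is bounded there by a constant\<close>
    define P where "P = Sigma {n\<in>{1..N}. 2 \<le> L n} I"
    define c where "c p = of_int (snd p) * L (fst p)" for p :: "nat \<times> int"
    define l where "l p = L (fst p)" for p :: "nat \<times> int"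
    have finP: "finite P" unfolding P_def using I(1) by (intro finite_SigmaI) auto
    have sc: "(\<Sum>p\<in>P. (l p)\<^sup>2 / ((s - c p)\<^sup>2 + (l p)\<^sup>2)) \<le> S"
             "\<bar>x\<bar> \<le> 1 \<Longrightarrow> (\<Sum>p\<in>P. bump (c p) (l p) x) \<le> 16 * (3 * M)" for s x
      using scale_sums[where L = L and I = I and N = N and Z = Z and M = "3 * M", OF Z(2) Z(1) Lq I(1) _ _ sumI] centre
      unfolding P_def S_def c_def l_def by (auto simp: split_beta)
    have Pl: "2 \<le> l p" "l p \<le> \<bar>c p\<bar>" if pP: "p \<in> P" for p
    proof -
      obtain n j where p: "p = (n, j)" "n \<in> {1..N}" "2 \<le> L n" "j \<in> I n" using pP by (auto simp: P_def)
      show "2 \<le> l p" using p by (simp add: l_def)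
      have "L n \<le> exp (real n) / 4" using Lq p by simp
      then show "l p \<le> \<bar>c p\<bar>" using centre[OF p(2,4)] exp_gt_zero[of "real n"] unfolding p(1) l_def c_def by (simp del: exp_gt_zero)
    qed
    have sum8: "(\<Sum>p\<in>P. 8 * \<alpha> * ((l p)\<^sup>2 / ((s - c p)\<^sup>2 + (l p)\<^sup>2))) \<le> pi * \<tau> / 2" for s
    proof -
      have "(\<Sum>p\<in>P. 8 * \<alpha> * ((l p)\<^sup>2 / ((s - c p)\<^sup>2 + (l p)\<^sup>2))) = 8 * \<alpha> * (\<Sum>p\<in>P. (l p)\<^sup>2 / ((s - c p)\<^sup>2 + (l p)\<^sup>2))"
        by (rule sum_distrib_left[symmetric])
      also have "\<dots> \<le> 8 * \<alpha> * S" using sc(1)[of s] \<alpha> by (intro mult_left_mono) auto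
      finally show ?thesis unfolding \<alpha>(2) .
    qed
    define \<omega> where "\<omega> x = (\<Sum>p\<in>P. \<alpha> * bump (c p) (l p) x)" for x
    obtain F where F: "bandlimited (\<tau> / 2) F"
      "\<And>x::real. cmod (F x) \<le> multiplier_upper \<tau> / (1 + x\<^sup>2) * exp (- \<omega> x)"
      "\<And>x::real. \<bar>x\<bar> \<le> 1 \<Longrightarrow> multiplier_lower \<tau> * exp (- \<omega> x) \<le> cmod (F x)"
      using multiplier_bumps[OF finP \<tau> less_imp_le[OF \<alpha>(1)] Pl sum8] unfolding \<omega>_def by auto
    have bump0: "0 \<le> \<alpha> * bump (c p) (l p) x" if "p \<in> P" for p x
      unfolding bump_def using \<alpha> Pl(1)[OF that] by auto
    have \<omega>0: "\<omega> x \<ge> 0" for x unfolding \<omega>_def using bump0 by (intro sum_nonneg)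
    have q: "1 + x\<^sup>2 > 0" for x :: real by (simp add: add_pos_nonneg)
    have up: "cmod (F x) * y \<le> B / (1 + x\<^sup>2)" 
      if "exp (- \<omega> x) * y \<le> 1 + exp (\<alpha> / 2) + W (exp 1) powr \<beta>" "y \<ge> 0" for x y :: real
    proof -
      have "cmod (F x) * y \<le> multiplier_upper \<tau> / (1 + x\<^sup>2) * exp (- \<omega> x) * y"
        using F(2)[of x] that(2) by (intro mult_right_mono)
      also have "\<dots> = multiplier_upper \<tau> / (1 + x\<^sup>2) * (exp (- \<omega> x) * y)" by simp
      also have "\<dots> \<le> multiplier_upper \<tau> / (1 + x\<^sup>2) * (1 + exp (\<alpha> / 2) + W (exp 1) powr \<beta>)"
        using that(1) mu q[of x] by (intro mult_left_mono) auto
      finally show ?thesis by (simp add: B_def)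
    qed
    show ?thesis
    proof (intro exI[of _ F] conjI allI impI F(1))
      fix x :: real
      have "exp (- \<omega> x) * 1 \<le> 1" using \<omega>0[of x] by simp
      moreover have "0 \<le> exp (\<alpha> / 2)" "0 \<le> W (exp 1) powr \<beta>" by auto
      ultimately have "exp (- \<omega> x) * 1 \<le> 1 + exp (\<alpha> / 2) + W (exp 1) powr \<beta>" by linarith
      from up[OF this] show "cmod (F x) \<le> B / (1 + x\<^sup>2)" by simp
    next
      fix x :: real assume x: "\<bar>x\<bar> \<le> 1"
      have "\<omega> x = \<alpha> * (\<Sum>p\<in>P. bump (c p) (l p) x)" unfolding \<omega>_def by (rule sum_distrib_left[symmetric])
      also have "\<dots> \<le> \<alpha> * (16 * (3 * M))" using sc(2)[OF x] \<alpha> by (intro mult_left_mono) auto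
      finally have "multiplier_lower \<tau> * exp (- (48 * \<alpha> * M)) \<le> multiplier_lower \<tau> * exp (- \<omega> x)"
        using ml by (intro mult_left_mono) auto
      then show "b \<le> cmod (F x)" unfolding b_def using F(3)[OF x] by linarith
    next
      fix x :: real assume x: "x \<in> Q" "\<bar>x\<bar> \<le> exp (real N + 1)"
      show "cmod (F x) * W \<bar>x\<bar> powr \<beta> \<le> B / (1 + x\<^sup>2)"
      proof (rule up)
        have e1: "exp (- \<omega> x) \<le> 1" using \<omega>0[of x] by simp
        show "exp (- \<omega> x) * W \<bar>x\<bar> powr \<beta> \<le> 1 + exp (\<alpha> / 2) + W (exp 1) powr \<beta>"
        proof (cases "\<bar>x\<bar> \<le> exp 1")
          case True
          have "W \<bar>x\<bar> powr \<beta> \<le> W (exp 1) powr \<beta>" using Wmono[OF _ True] W0[of "\<bar>x\<bar>"] \<beta> by (intro powr_mono2) auto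
          then have "exp (- \<omega> x) * W \<bar>x\<bar> powr \<beta> \<le> 1 * W (exp 1) powr \<beta>" using e1 by (intro mult_mono) auto
          then show ?thesis by (simp add: add_increasing)
        next
          case False
          have ex: "exp (1::real) > 0" by simp
          have xp: "\<bar>x\<bar> > 0" using False ex by linarith
          define m where "m = ln \<bar>x\<bar>"
          have m1: "exp m = \<bar>x\<bar>" using xp by (simp add: m_def)
          then have "exp 1 < exp m" "exp m \<le> exp (real N + 1)" using False x(2) by auto
          then have m: "exp m = \<bar>x\<bar>" "m > 1" "m \<le> real N + 1" using m1 unfolding exp_less_cancel_iff exp_le_cancel_iff by blast+
          \<comment> \<open>For m = N + 1 the floor would name the shell N + 1, which has no bumps.
            The shells are closed, and the minimum assigns this endpoint to the shell N.\<close>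
          define n where "n = min N (nat \<lfloor>m\<rfloor>)"
          have n: "n \<in> {1..N}" "real n \<le> m" "m \<le> real n + 1"
          proof -
            have f: "1 \<le> \<lfloor>m\<rfloor>" "of_int \<lfloor>m\<rfloor> \<le> m" "m < of_int \<lfloor>m\<rfloor> + 1" using m(2) by linarith+
            have N: "N \<ge> 1" using m(2,3) by linarith
            have k: "real (nat \<lfloor>m\<rfloor>) = of_int \<lfloor>m\<rfloor>" "nat \<lfloor>m\<rfloor> \<ge> 1" using f(1) by linarith+
            show "n \<in> {1..N}" unfolding n_def using N k by auto
            show "real n \<le> m" unfolding n_def using k f(2) by linarith
            show "m \<le> real n + 1" unfolding n_def using k f(3) m(3) by (simp add: min_def)
          qed
          have W: "W \<bar>x\<bar> powr \<beta> \<le> exp (\<alpha> / 4 * L n)"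
          proof -
            have "W \<bar>x\<bar> \<le> W (exp (real (n + 1)))" using n(3) by (intro Wmono) (auto simp flip: m(1))
            then have "W \<bar>x\<bar> powr \<beta> \<le> W (exp (real (n + 1))) powr \<beta>" using W0[of "\<bar>x\<bar>"] \<beta> by (intro powr_mono2) auto
            also have "\<dots> = exp (\<beta> * L (n + 1))" using W1[of "exp (real (n + 1))"] unfolding L_def short_length_def powr_def by auto
            also have "\<dots> \<le> exp (\<beta> * (C_doub * L n))" using Ld[of n] n(1) \<beta> by (simp add: mult_left_mono)
            also have "\<beta> * (C_doub * L n) = \<alpha> / 4 * L n" using \<beta>(2) by (metis mult.assoc)
            finally show ?thesis .
          qed
          show ?thesis
          proof (cases "2 \<le> L n")
            case True
            have xX: "x \<in> X n" using x(1) n unfolding X_def by (auto simp flip: m(1))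
            define j where "j = \<lfloor>x / L n\<rfloor>"
            have j: "j \<in> I n" unfolding I_def j_def using xX by blast
            then have pP: "(n, j) \<in> P" using n(1) True by (simp add: P_def)
            define d where "d = of_int j * L n"
            have "of_int j \<le> x / L n" "x / L n < of_int j + 1" unfolding j_def by linarith+
            then have "d \<le> x" "x < d + L n" using Lpos[of n] by (simp_all add: field_simps d_def)
            then have xd: "\<bar>x - d\<bar> \<le> L n" by simp
            have "L n \<le> \<bar>x\<bar> / 4" 
            proof -
              have "exp (real n) \<le> \<bar>x\<bar>" using n(2) by (simp flip: m(1))
              then show ?thesis using Lq[of n] n(1) by simp
            qed
            then have dx: "\<bar>d\<bar> \<le> 5 / 4 * \<bar>x\<bar>" using xd by linarith
            have d0: "\<bar>d\<bar> > 0" using Pl[OF pP] by (auto simp: c_def l_def d_def)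
            have den: "(x - d)\<^sup>2 + (L n)\<^sup>2 \<le> 2 * (L n)\<^sup>2" using power_mono[OF xd, of 2] by simp
            have d2: "d\<^sup>2 \<le> 2 * x\<^sup>2"
            proof -
              have "\<bar>d\<bar>\<^sup>2 \<le> (5 / 4 * \<bar>x\<bar>)\<^sup>2" using dx by (intro power_mono) auto
              then have "d\<^sup>2 \<le> 25 / 16 * x\<^sup>2" by (simp add: power_mult_distrib power_divide)
              then show ?thesis using zero_le_power2[of x] by linarith
            qed
            \<comment> \<open>At distance at most \<open>L n\<close> from the centre the denominator
              of the bump is at most 2 L^2, and d^2 \<le> 2 x^2; these two factors 2 make the
              4.\<close>
            have "L n / 4 = L n ^ 3 / d\<^sup>2 * (d\<^sup>2 / 2 / (2 * (L n)\<^sup>2))"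
              using d0 Lpos[of n] by (simp add: power2_eq_square power3_eq_cube)
            also have "\<dots> \<le> L n ^ 3 / d\<^sup>2 * (x\<^sup>2 / ((x - d)\<^sup>2 + (L n)\<^sup>2))"
            proof (rule mult_left_mono)
              show "d\<^sup>2 / 2 / (2 * (L n)\<^sup>2) \<le> x\<^sup>2 / ((x - d)\<^sup>2 + (L n)\<^sup>2)"
                using d2 den Lpos[of n] by (intro frac_le) (auto intro: add_nonneg_pos)
            qed (use Lpos[of n] in auto)
            finally have "L n / 4 \<le> bump (c (n, j)) (l (n, j)) x" by (simp add: bump_def c_def l_def d_def)
            then have "\<alpha> * (L n / 4) \<le> \<alpha> * bump (c (n, j)) (l (n, j)) x" using \<alpha> by (intro mult_left_mono) auto
            also have "\<dots> \<le> \<omega> x" unfolding \<omega>_def using bump0 finP pP by (intro member_le_sum) auto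
            finally have "\<alpha> / 4 * L n \<le> \<omega> x" by simp
            then have "exp (- \<omega> x) * exp (\<alpha> / 4 * L n) \<le> 1" by (simp flip: exp_add)
            moreover have "exp (- \<omega> x) * W \<bar>x\<bar> powr \<beta> \<le> exp (- \<omega> x) * exp (\<alpha> / 4 * L n)" using W by (intro mult_left_mono) auto
            moreover have "0 \<le> exp (\<alpha> / 2)" "0 \<le> W (exp 1) powr \<beta>" by auto
            ultimately show ?thesis by linarith
          next
            case False
            have "exp (\<alpha> / 4 * L n) \<le> exp (\<alpha> / 2)" using False \<alpha> by simp
            then have "W \<bar>x\<bar> powr \<beta> \<le> exp (\<alpha> / 2)" using W by linarith
            then have "exp (- \<omega> x) * W \<bar>x\<bar> powr \<beta> \<le> 1 * exp (\<alpha> / 2)" using e1 by (intro mult_mono) auto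
            moreover have "0 \<le> W (exp 1) powr \<beta>" by auto
            ultimately show ?thesis by linarith
          qed
        qed
      qed simp
    qed
  qed
  show ?thesis by (rule that[OF \<beta>(1) B b main])
qed

section \<open>The Fourier transform on square integrable functions\<close>

lemma L2_norm_eq: "L2_norm M f = sqrt (LINT x|M. (cmod (f x))\<^sup>2)"
  unfolding L2_norm_on_def by (simp add: set_integral_space set_lebesgue_integral_def cong: Bochner_Integration.integral_cong)

lemma L2_norm_nonneg [simp]: "L2_norm_on M A f \<ge> 0"
  by (simp add: L2_norm_on_def set_lebesgue_integral_def Bochner_Integration.integral_nonneg)

lemma L2_norm_on_eq:
  "L2_norm_on M A f = L2_norm M (\<lambda>x. indicator A x * f x)"
  unfolding L2_norm_eq unfolding L2_norm_on_def set_lebesgue_integral_def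
  by (intro arg_cong[where f = sqrt] Bochner_Integration.integral_cong) (auto simp: indicator_def)

lemma L2_norm_power2: "(L2_norm M f)\<^sup>2 = (LINT x|M. (cmod (f x))\<^sup>2)"
  unfolding L2_norm_eq by (simp add: Bochner_Integration.integral_nonneg)

lemma nn_integral_L2: "f \<in> L2_space M \<Longrightarrow> (\<integral>\<^sup>+x. ennreal ((cmod (f x))\<^sup>2) \<partial>M) = ennreal ((L2_norm M f)\<^sup>2)"
  unfolding L2_norm_power2 L2_space_def by (intro nn_integral_eq_integral) auto

lemma L2_spaceI:
  assumes "f \<in> borel_measurable M" "(\<integral>\<^sup>+x. ennreal ((cmod (f x))\<^sup>2) \<partial>M) < \<infinity>"
  shows "f \<in> L2_space M"
  using assms unfolding L2_space_def by (auto intro!: integrableI_nonneg)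

lemma L2_space_measurable [measurable_dest]: "f \<in> L2_space M \<Longrightarrow> f \<in> borel_measurable M"
  by (simp add: L2_space_def)

lemma L2_space_bound:
  assumes "f \<in> L2_space M" "g \<in> borel_measurable M" "\<And>x. x \<in> space M \<Longrightarrow> cmod (g x) \<le> C * cmod (f x)"
  shows "g \<in> L2_space M"
proof -
  have "integrable M (\<lambda>x. (cmod (g x))\<^sup>2)"
  proof (rule Bochner_Integration.integrable_bound)
    show "integrable M (\<lambda>x. C\<^sup>2 * (cmod (f x))\<^sup>2)" using assms by (simp add: L2_space_def)
    show "AE x in M. norm ((cmod (g x))\<^sup>2) \<le> norm (C\<^sup>2 * (cmod (f x))\<^sup>2)"
    proof (rule AE_I2)
      fix x assume "x \<in> space M"
      from power_mono[OF assms(3)[OF this], of 2] show "norm ((cmod (g x))\<^sup>2) \<le> norm (C\<^sup>2 * (cmod (f x))\<^sup>2)"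
        by (simp add: power_mult_distrib)
    qed
  qed (use assms in measurable)
  then show ?thesis using assms by (simp add: L2_space_def)
qed

lemma L2_space_cmult: "f \<in> L2_space M \<Longrightarrow> (\<lambda>x. c * f x) \<in> L2_space M"
  by (rule L2_space_bound[where C = "cmod c"]) (auto simp: norm_mult L2_space_def)

lemma L2_space_indicator: "f \<in> L2_space M \<Longrightarrow> A \<in> sets M \<Longrightarrow> (\<lambda>x. indicator A x * f x) \<in> L2_space M"
  by (rule L2_space_bound[where C = 1]) (auto simp: norm_mult L2_space_def indicator_def)

lemma L2_integrable_mult:
  assumes "f \<in> L2_space M" "g \<in> L2_space M"
  shows "integrable M (\<lambda>x. f x * g x)" "integrable M (\<lambda>x. cmod (f x) * cmod (g x))"
proof -
  have [measurable]: "f \<in> borel_measurable M" "g \<in> borel_measurable M" using assms by (auto simp: L2_space_def)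
  have i: "integrable M (\<lambda>x. (cmod (f x))\<^sup>2 + (cmod (g x))\<^sup>2)" using assms by (auto simp: L2_space_def)
  have b: "cmod (f x) * cmod (g x) \<le> (cmod (f x))\<^sup>2 + (cmod (g x))\<^sup>2" for x
  proof -
    have "2 * (cmod (f x) * cmod (g x)) \<le> (cmod (f x))\<^sup>2 + (cmod (g x))\<^sup>2"
      using zero_le_power2[of "cmod (f x) - cmod (g x)"] by (simp add: power2_eq_square algebra_simps)
    moreover have "0 \<le> cmod (f x) * cmod (g x)" by simp
    ultimately show ?thesis by linarith
  qed
  show "integrable M (\<lambda>x. f x * g x)" 
    by (rule Bochner_Integration.integrable_bound[OF i]) (use b in \<open>auto simp: norm_mult\<close>)
  show "integrable M (\<lambda>x. cmod (f x) * cmod (g x))"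
    by (rule Bochner_Integration.integrable_bound[OF i]) (use b in \<open>auto simp: norm_mult\<close>)
qed

lemma L2_space_add: 
  assumes "f \<in> L2_space M" "g \<in> L2_space M" shows "(\<lambda>x. f x + g x) \<in> L2_space M"
proof -
  have [measurable]: "f \<in> borel_measurable M" "g \<in> borel_measurable M" using assms by (auto simp: L2_space_def)
  have "integrable M (\<lambda>x. (cmod (f x + g x))\<^sup>2)"
  proof (rule Bochner_Integration.integrable_bound)
    show "integrable M (\<lambda>x. (cmod (f x))\<^sup>2 + (cmod (g x))\<^sup>2 + 2 * (cmod (f x) * cmod (g x)))"
      using assms L2_integrable_mult[OF assms] by (auto simp: L2_space_def)
    show "AE x in M. norm ((cmod (f x + g x))\<^sup>2) \<le> norm ((cmod (f x))\<^sup>2 + (cmod (g x))\<^sup>2 + 2 * (cmod (f x) * cmod (g x)))"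
    proof (rule AE_I2)
      fix x
      have "(cmod (f x + g x))\<^sup>2 \<le> (cmod (f x) + cmod (g x))\<^sup>2" by (intro power_mono norm_triangle_ineq) auto
      then show "norm ((cmod (f x + g x))\<^sup>2) \<le> norm ((cmod (f x))\<^sup>2 + (cmod (g x))\<^sup>2 + 2 * (cmod (f x) * cmod (g x)))"
        by (simp add: power2_sum)
    qed
  qed measurable
  then show ?thesis by (simp add: L2_space_def)
qed

lemma L2_space_diff: 
  assumes "f \<in> L2_space M" "g \<in> L2_space M" shows "(\<lambda>x. f x - g x) \<in> L2_space M"
  using L2_space_add[OF assms(1) L2_space_cmult[OF assms(2), of "-1"]] by simp

text \<open>Nonnegativity of the quadratic form \<open>q\<close>, evaluated at the two norms. If one
  norm is 0, the form is affine in one variable, and being bounded below forces the mixed integral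
  to vanish.\<close>

lemma L2_cauchy_schwarz:
  assumes "f \<in> L2_space M" "g \<in> L2_space M"
  shows "(LINT x|M. cmod (f x) * cmod (g x)) \<le> L2_norm M f * L2_norm M g"
proof -
  let ?c = "LINT x|M. cmod (f x) * cmod (g x)"
  let ?a = "L2_norm M f" and ?b = "L2_norm M g"
  have i: "integrable M (\<lambda>x. (cmod (f x))\<^sup>2)" "integrable M (\<lambda>x. (cmod (g x))\<^sup>2)" "integrable M (\<lambda>x. cmod (f x) * cmod (g x))"
    using assms L2_integrable_mult[OF assms] by (auto simp: L2_space_def)
  have q: "0 \<le> u\<^sup>2 * ?a\<^sup>2 + v\<^sup>2 * ?b\<^sup>2 - 2 * u * v * ?c" for u v
  proof -
    have "0 \<le> (LINT x|M. (u * cmod (f x) - v * cmod (g x))\<^sup>2)" by (simp add: Bochner_Integration.integral_nonneg)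
    also have "\<dots> = (LINT x|M. u\<^sup>2 * (cmod (f x))\<^sup>2 + v\<^sup>2 * (cmod (g x))\<^sup>2 - 2 * u * v * (cmod (f x) * cmod (g x)))"
      by (intro Bochner_Integration.integral_cong) (auto simp: power2_eq_square algebra_simps)
    also have "\<dots> = u\<^sup>2 * ?a\<^sup>2 + v\<^sup>2 * ?b\<^sup>2 - 2 * u * v * ?c" unfolding L2_norm_power2 using i by simp
    finally show ?thesis .
  qed
  have a: "?a \<ge> 0" and b: "?b \<ge> 0" and c: "?c \<ge> 0" by (auto intro: Bochner_Integration.integral_nonneg)
  show ?thesis
  proof (cases "?a = 0 \<or> ?b = 0")
    case False
    then have "?a * ?b > 0" using a b by (auto simp: less_le)
    have "0 \<le> 2 * (?a * ?b) * (?a * ?b - ?c)" using q[of ?b ?a] by (simp add: power2_eq_square algebra_simps)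
    then show ?thesis using \<open>?a * ?b > 0\<close> by (simp add: zero_le_mult_iff)
  next
    case True
    have "?c \<le> 0"
    proof (rule ccontr)
      assume "\<not> ?c \<le> 0"
      then have c: "?c > 0" by simp
      have contr: False if "0 \<le> y - z" "z > y" for y z :: real using that by linarith
      have e: "2 * ((y\<^sup>2 + 1) / ?c) * ?c > y\<^sup>2" for y
      proof -
        have "2 * ((y\<^sup>2 + 1) / ?c) * ?c = y\<^sup>2 + (y\<^sup>2 + 2)" using c by simp
        then show ?thesis using zero_le_power2[of y] by (simp add: add_nonneg_pos)
      qed
      from True show False
      proof
        assume "?a = 0"
        then have "0 \<le> ?b\<^sup>2 - 2 * u * ?c" for u using q[of u 1] by simp
        from this[of "(?b\<^sup>2 + 1) / ?c"] show False by (rule contr[OF _ e])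
      next
        assume "?b = 0"
        then have "0 \<le> ?a\<^sup>2 - 2 * u * ?c" for u using q[of 1 u] by simp
        from this[of "(?a\<^sup>2 + 1) / ?c"] show False by (rule contr[OF _ e])
      qed
    qed
    then show ?thesis using True by auto
  qed
qed

lemma L2_minkowski:
  assumes "f \<in> L2_space M" "g \<in> L2_space M"
  shows "L2_norm M (\<lambda>x. f x + g x) \<le> L2_norm M f + L2_norm M g"
proof -
  have i: "integrable M (\<lambda>x. (cmod (f x))\<^sup>2)" "integrable M (\<lambda>x. (cmod (g x))\<^sup>2)" "integrable M (\<lambda>x. cmod (f x) * cmod (g x))"
    using assms L2_integrable_mult[OF assms] by (auto simp: L2_space_def)
  have "(L2_norm M (\<lambda>x. f x + g x))\<^sup>2 \<le> (LINT x|M. (cmod (f x))\<^sup>2 + (cmod (g x))\<^sup>2 + 2 * (cmod (f x) * cmod (g x)))"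
    unfolding L2_norm_power2
  proof (rule integral_mono)
    show "integrable M (\<lambda>x. (cmod (f x + g x))\<^sup>2)" using L2_space_add[OF assms] by (simp add: L2_space_def)
    fix x
    have "(cmod (f x + g x))\<^sup>2 \<le> (cmod (f x) + cmod (g x))\<^sup>2" by (intro power_mono norm_triangle_ineq) auto
    then show "(cmod (f x + g x))\<^sup>2 \<le> (cmod (f x))\<^sup>2 + (cmod (g x))\<^sup>2 + 2 * (cmod (f x) * cmod (g x))"
      by (simp add: power2_sum)
  qed (use i in auto)
  also have "\<dots> = (L2_norm M f)\<^sup>2 + (L2_norm M g)\<^sup>2 + 2 * (LINT x|M. cmod (f x) * cmod (g x))"
    unfolding L2_norm_power2 using i by simp
  also have "\<dots> \<le> (L2_norm M f)\<^sup>2 + (L2_norm M g)\<^sup>2 + 2 * (L2_norm M f * L2_norm M g)"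
    using L2_cauchy_schwarz[OF assms] by simp
  also have "\<dots> = (L2_norm M f + L2_norm M g)\<^sup>2" by (simp add: power2_sum)
  finally show ?thesis by (rule power2_le_imp_le) simp
qed

lemma L2_norm_minus_commute: "L2_norm M (\<lambda>x. f x - g x) = L2_norm M (\<lambda>x. g x - f x)"
  unfolding L2_norm_eq by (simp add: norm_minus_commute)

lemma L2_norm_triangle_diff:
  assumes "f \<in> L2_space M" "g \<in> L2_space M"
  shows "\<bar>L2_norm M f - L2_norm M g\<bar> \<le> L2_norm M (\<lambda>x. f x - g x)"
proof -
  have "L2_norm M f \<le> L2_norm M (\<lambda>x. f x - g x) + L2_norm M g"
    using L2_minkowski[OF L2_space_diff[OF assms] assms(2)] by simp
  moreover have "L2_norm M g \<le> L2_norm M (\<lambda>x. g x - f x) + L2_norm M f"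
    using L2_minkowski[OF L2_space_diff[OF assms(2,1)] assms(1)] by simp
  ultimately show ?thesis using L2_norm_minus_commute[of M f g] by linarith
qed

lemma L2_tendsto_iff:
  assumes "\<And>k. h k \<in> L2_space M" "f \<in> L2_space M"
  shows "L2_tendsto M h f \<longleftrightarrow> (\<lambda>k. L2_norm M (\<lambda>x. h k x - f x)) \<longlonglongrightarrow> 0"
proof -
  have "L2_tendsto M h f \<longleftrightarrow> (\<lambda>k. ennreal ((L2_norm M (\<lambda>x. h k x - f x))\<^sup>2)) \<longlonglongrightarrow> ennreal 0"
    unfolding L2_tendsto_def using nn_integral_L2[OF L2_space_diff[OF assms]] by simp
  also have "\<dots> \<longleftrightarrow> (\<lambda>k. (L2_norm M (\<lambda>x. h k x - f x))\<^sup>2) \<longlonglongrightarrow> 0"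
    by (rule tendsto_ennreal_iff) auto
  also have "\<dots> \<longleftrightarrow> (\<lambda>k. L2_norm M (\<lambda>x. h k x - f x)) \<longlonglongrightarrow> 0"
  proof
    assume "(\<lambda>k. (L2_norm M (\<lambda>x. h k x - f x))\<^sup>2) \<longlonglongrightarrow> 0"
    from tendsto_real_sqrt[OF this] show "(\<lambda>k. L2_norm M (\<lambda>x. h k x - f x)) \<longlonglongrightarrow> 0" by simp
  next
    assume "(\<lambda>k. L2_norm M (\<lambda>x. h k x - f x)) \<longlonglongrightarrow> 0"
    from tendsto_power[OF this, of 2] show "(\<lambda>k. (L2_norm M (\<lambda>x. h k x - f x))\<^sup>2) \<longlonglongrightarrow> 0" by simp
  qed
  finally show ?thesis .
qed

lemma L2_tendsto_norm:
  assumes "\<And>k. h k \<in> L2_space M" "f \<in> L2_space M" "L2_tendsto M h f"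
  shows "(\<lambda>k. L2_norm M (h k)) \<longlonglongrightarrow> L2_norm M f"
proof -
  have "(\<lambda>k. L2_norm M (\<lambda>x. h k x - f x)) \<longlonglongrightarrow> 0" using assms L2_tendsto_iff by blast
  then have "(\<lambda>k. L2_norm M (h k) - L2_norm M f) \<longlonglongrightarrow> 0"
  proof (rule Lim_null_comparison[rotated])
    show "\<forall>\<^sub>F k in sequentially. norm (L2_norm M (h k) - L2_norm M f) \<le> L2_norm M (\<lambda>x. h k x - f x)"
      unfolding real_norm_def by (intro always_eventually allI L2_norm_triangle_diff assms)
  qed
  then show ?thesis by (simp add: LIM_zero_iff)
qed

lemma L2_tendsto_dominated:
  assumes g: "g \<in> L2_space M" and [measurable]: "\<And>k. h k \<in> borel_measurable M" "f \<in> borel_measurable M"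
    and lim: "AE x in M. (\<lambda>k. h k x) \<longlonglongrightarrow> f x"
    and bound: "\<And>k. AE x in M. cmod (h k x) \<le> cmod (g x)" "AE x in M. cmod (f x) \<le> cmod (g x)"
  shows "L2_tendsto M h f"
proof -
  have [measurable]: "g \<in> borel_measurable M" using g by (simp add: L2_space_def)
  have "(\<lambda>k. \<integral>\<^sup>+ x. ennreal ((cmod (h k x - f x))\<^sup>2) \<partial>M) \<longlonglongrightarrow> (\<integral>\<^sup>+ x. 0 \<partial>M)"
  proof (rule nn_integral_dominated_convergence[where w = "\<lambda>x. ennreal (4 * (cmod (g x))\<^sup>2)"])
    show "(\<integral>\<^sup>+ x. ennreal (4 * (cmod (g x))\<^sup>2) \<partial>M) < \<infinity>"
    proof -
      have "integrable M (\<lambda>x. 4 * (cmod (g x))\<^sup>2)" using g by (simp add: L2_space_def)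
      then show ?thesis by (subst nn_integral_eq_integral) auto
    qed
    show "AE x in M. ennreal ((cmod (h k x - f x))\<^sup>2) \<le> ennreal (4 * (cmod (g x))\<^sup>2)" for k
      using bound(1)[of k] bound(2)
    proof eventually_elim
      case (elim x)
      have "cmod (h k x - f x) \<le> 2 * cmod (g x)" using elim norm_triangle_ineq4[of "h k x" "f x"] by linarith
      from power_mono[OF this, of 2] show ?case by (intro ennreal_leI) (simp add: power_mult_distrib)
    qed
    show "AE x in M. (\<lambda>k. ennreal ((cmod (h k x - f x))\<^sup>2)) \<longlonglongrightarrow> 0"
      using lim
    proof eventually_elim
      case (elim x)
      have "(\<lambda>k. ennreal ((cmod (h k x - f x))\<^sup>2)) \<longlonglongrightarrow> ennreal ((cmod (f x - f x))\<^sup>2)"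
        using elim by (intro tendsto_ennrealI tendsto_intros)
      then show ?case by simp
    qed
  qed measurable
  then show ?thesis by (simp add: L2_tendsto_def)
qed

section \<open>Truncation, approximation by continuous functions, continuity of translations\<close>

lemma L2_space_bounded_support:
  fixes f :: "real \<Rightarrow> complex"
  assumes [measurable]: "f \<in> borel_measurable lborel" and "\<And>x. cmod (f x) \<le> B * indicator {-R..R} x"
  shows "f \<in> L2_space lborel"
proof -
  have "integrable lborel (\<lambda>x. (cmod (f x))\<^sup>2)"
  proof (rule Bochner_Integration.integrable_bound)
    have "integrable lborel (indicator {-R..R} :: real \<Rightarrow> real)" by (intro integrable_real_indicator) (auto simp: emeasure_lborel_Icc_eq)
    then show "integrable lborel (\<lambda>x. B\<^sup>2 * indicator {-R..R} x :: real)" by simp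
    show "AE x in lborel. norm ((cmod (f x))\<^sup>2) \<le> norm (B\<^sup>2 * indicator {-R..R} x :: real)"
    proof (rule AE_I2)
      fix x
      from power_mono[OF assms(2)[of x], of 2] show "norm ((cmod (f x))\<^sup>2) \<le> norm (B\<^sup>2 * indicator {-R..R} x :: real)"
        by (auto simp: power_mult_distrib indicator_def split: if_splits)
    qed
  qed measurable
  then show ?thesis using assms by (simp add: L2_space_def)
qed

lemma L2_tendstoD:
  assumes "L2_tendsto M h f" "\<And>k. h k \<in> L2_space M" "f \<in> L2_space M" "e > 0"
  shows "\<forall>\<^sub>F k in sequentially. L2_norm M (\<lambda>x. h k x - f x) < e"
proof -
  have "(\<lambda>k. L2_norm M (\<lambda>x. h k x - f x)) \<longlonglongrightarrow> 0" using assms L2_tendsto_iff by blast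
  from order_tendstoD(2)[OF this \<open>e > 0\<close>] show ?thesis .
qed

lemma L2_truncate_tendsto:
  fixes f :: "real \<Rightarrow> complex"
  assumes "f \<in> L2_space lborel"
  shows "L2_tendsto lborel (\<lambda>n x. if \<bar>x\<bar> \<le> real n \<and> cmod (f x) \<le> real n then f x else 0) f"
proof (rule L2_tendsto_dominated[OF assms])
  have [measurable]: "f \<in> borel_measurable borel" using assms by (simp add: L2_space_def)
  show "f \<in> borel_measurable lborel" by simp
  show "(\<lambda>x. if \<bar>x\<bar> \<le> real n \<and> cmod (f x) \<le> real n then f x else 0) \<in> borel_measurable lborel" for n
    by measurable
  show "AE x in lborel. (\<lambda>n. if \<bar>x\<bar> \<le> real n \<and> cmod (f x) \<le> real n then f x else 0) \<longlonglongrightarrow> f x"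
  proof (rule AE_I2)
    fix x
    obtain N where N: "max \<bar>x\<bar> (cmod (f x)) \<le> real N" using real_arch_simple by blast
    have "\<forall>\<^sub>F n in sequentially. (if \<bar>x\<bar> \<le> real n \<and> cmod (f x) \<le> real n then f x else 0) = f x"
      using eventually_ge_at_top[of N]
    proof eventually_elim
      case (elim n)
      then have "real N \<le> real n" by simp
      then show ?case using N by auto
    qed
    then show "(\<lambda>n. if \<bar>x\<bar> \<le> real n \<and> cmod (f x) \<le> real n then f x else 0) \<longlonglongrightarrow> f x"
      by (rule tendsto_eventually)
  qed
qed auto

text \<open>A bounded truncation \<open>h\<close> of \<open>f\<close> is an almost everywhere limit
  of continuous functions, but without a majorant. Retracting their values to a disc and multiplying
  by a plateau provides one and leaves \<open>h\<close> unchanged, so dominated convergence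
  applies.\<close>

lemma L2_approx_continuous:
  fixes f :: "real \<Rightarrow> complex"
  assumes f: "f \<in> L2_space lborel" and e: "e > 0"
  obtains k B R where "continuous_on UNIV k" "\<And>x. cmod (k x) \<le> B * indicator {-R..R} x" 
    "L2_norm lborel (\<lambda>x. k x - f x) < e"
proof -
  have fm[measurable]: "f \<in> borel_measurable borel" using f by (simp add: L2_space_def)
  define fM where "fM n x = (if \<bar>x\<bar> \<le> real n \<and> cmod (f x) \<le> real n then f x else 0)" for n x
  have fM: "fM n \<in> L2_space lborel" for n
    unfolding fM_def by (rule L2_space_bound[OF f, where C = 1]) auto
  have "L2_tendsto lborel fM f" using L2_truncate_tendsto[OF f] unfolding fM_def[abs_def] .
  from L2_tendstoD[OF this fM f, of "e/2"] e 
  have "\<forall>\<^sub>F n in sequentially. L2_norm lborel (\<lambda>x. fM n x - f x) < e / 2" by simp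
  then have "\<forall>\<^sub>F n in sequentially. L2_norm lborel (\<lambda>x. fM n x - f x) < e / 2 \<and> n \<ge> 1"
    using eventually_ge_at_top by (rule eventually_conj)
  then obtain n where n: "L2_norm lborel (\<lambda>x. fM n x - f x) < e / 2" "n \<ge> 1"
    using eventually_happens'[OF sequentially_bot] by blast
  define M where "M = real n"
  have M: "M \<ge> 1" using n by (simp add: M_def)
  define h where "h = fM n"
  have hm[measurable]: "h \<in> borel_measurable borel" unfolding h_def fM_def by measurable
  have "h \<in> borel_measurable (lebesgue_on UNIV)"
    by (intro measurable_restrict_space1 measurable_completion) simp
  then have "h measurable_on UNIV" by (simp add: measurable_on_iff_borel_measurable)
  then obtain N g where N: "negligible N" and g: "\<And>i. continuous_on UNIV (g i)" 
     and lim: "\<And>x. x \<notin> N \<Longrightarrow> (\<lambda>i. g i x) \<longlonglongrightarrow> h x"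
    unfolding measurable_on_def by auto
  \<comment> \<open>\<open>cl\<close> is the radial retraction onto the closed disc of radius
    \<open>M\<close>; \<open>cut\<close> is 1 on [-M, M] and 0 beyond M + 1.\<close>
  define cl where "cl z = of_real (M / max M (cmod z)) * z" for z
  define cut where "cut x = complex_of_real (max 0 (min 1 (M + 1 - \<bar>x\<bar>)))" for x :: real
  define k where "k i x = cl (g i x) * cut x" for i x
  have cl_cont: "continuous_on UNIV cl" unfolding cl_def using M
    by (intro continuous_intros) (auto simp: max_def)
  have k_cont: "continuous_on UNIV (k i)" for i
    unfolding k_def cut_def by (intro continuous_intros continuous_on_compose2[OF cl_cont] g) auto
  have cl_bound: "cmod (cl z) \<le> M" for z
    unfolding cl_def using M by (simp add: norm_mult norm_divide max_def)
  have cl_id: "cl z = z" if "cmod z \<le> M" for z using that M by (simp add: cl_def max_def)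
  have k_bound: "cmod (k i x) \<le> M * indicator {-(M + 1)..M + 1} x" for i x
  proof (cases "\<bar>x\<bar> \<le> M + 1")
    case True
    have "cmod (cut x) \<le> 1" by (simp add: cut_def)
    then have "cmod (k i x) \<le> M * 1" unfolding k_def norm_mult using cl_bound M by (intro mult_mono) auto
    then show ?thesis using True by (auto simp: indicator_def)
  next
    case False
    then show ?thesis by (auto simp: k_def cut_def indicator_def)
  qed
  have kL: "k i \<in> L2_space lborel" for i
    by (rule L2_space_bounded_support[OF _ k_bound]) (simp add: borel_measurable_continuous_onI[OF k_cont])
  have hL: "h \<in> L2_space lborel" unfolding h_def by (rule fM)
  have hk: "h x * cut x = h x" "cmod (h x) \<le> M" for x
    using M by (auto simp: h_def fM_def M_def cut_def)
  define G where "G x = complex_of_real (M * indicator {-(M + 1)..M + 1} x)" for x :: real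
  have "L2_tendsto lborel k h"
  proof (rule L2_tendsto_dominated[where g = G])
    show "G \<in> L2_space lborel" using M unfolding G_def
      by (intro L2_space_bounded_support[where B = M and R = "M + 1"]) (auto simp: indicator_def)
    have Geq: "cmod (G x) = M * indicator {-(M + 1)..M + 1} x" for x
      unfolding G_def norm_of_real using M by (simp add: abs_mult)
    show "AE x in lborel. cmod (k i x) \<le> cmod (G x)" for i unfolding Geq using k_bound by simp
    show "AE x in lborel. cmod (h x) \<le> cmod (G x)" unfolding Geq 
      using M by (intro AE_I2) (auto simp: h_def fM_def M_def indicator_def)
    show "k i \<in> borel_measurable lborel" for i by (simp add: borel_measurable_continuous_onI[OF k_cont])
    have "AE x in lebesgue. x \<notin> N" using N by (intro AE_not_in) (simp add: negligible_iff_null_sets)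
    then have "AE x in lborel. x \<notin> N" by (simp add: AE_completion_iff)
    then show "AE x in lborel. (\<lambda>i. k i x) \<longlonglongrightarrow> h x"
    proof eventually_elim
      case (elim x)
      have "isCont cl (h x)" using cl_cont by (simp add: continuous_on_eq_continuous_at)
      from isCont_tendsto_compose[OF this lim[OF elim]] have "(\<lambda>i. cl (g i x)) \<longlonglongrightarrow> cl (h x)" .
      then have "(\<lambda>i. k i x) \<longlonglongrightarrow> cl (h x) * cut x" unfolding k_def by (intro tendsto_mult tendsto_const)
      then show ?case using hk[of x] by (simp add: cl_id)
    qed
  qed simp
  from L2_tendstoD[OF this kL hL, of "e/2"] e
  have "\<forall>\<^sub>F i in sequentially. L2_norm lborel (\<lambda>x. k i x - h x) < e / 2" by simp
  then obtain i where i: "L2_norm lborel (\<lambda>x. k i x - h x) < e / 2"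
    using eventually_happens'[OF sequentially_bot] by blast
  have "L2_norm lborel (\<lambda>x. k i x - f x) = L2_norm lborel (\<lambda>x. (k i x - h x) + (h x - f x))" by simp
  also have "\<dots> \<le> L2_norm lborel (\<lambda>x. k i x - h x) + L2_norm lborel (\<lambda>x. h x - f x)"
    by (intro L2_minkowski L2_space_diff kL hL f)
  also have "\<dots> < e" using i n by (simp add: h_def)
  finally show ?thesis using that k_cont k_bound by blast
qed

lemma lborel_integral_shift: 
  fixes f :: "real \<Rightarrow> 'a::{banach, second_countable_topology}"
  shows "(LINT x|lborel. f (x - u)) = (LINT x|lborel. f x)"
  using lborel_integral_real_affine[of 1 f "-u"] by simp

lemma L2_norm_shift: "L2_norm lborel (\<lambda>x. f (x - u)) = L2_norm lborel f" for u :: real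
  unfolding L2_norm_eq by (subst lborel_integral_shift[where f = "\<lambda>x. (cmod (f x))\<^sup>2"]) simp

lemma L2_space_shift:
  fixes u :: real
  assumes "f \<in> L2_space lborel" shows "(\<lambda>x. f (x - u)) \<in> L2_space lborel"
proof -
  have [measurable]: "f \<in> borel_measurable borel" using assms by (simp add: L2_space_def)
  have "integrable lborel (\<lambda>x. (cmod (f (- u + 1 * x)))\<^sup>2)"
    using assms by (intro lborel_integrable_real_affine[where f = "\<lambda>x. (cmod (f x))\<^sup>2"]) (auto simp: L2_space_def)
  then show ?thesis by (simp add: L2_space_def)
qed

lemma L2_translation_continuous:
  fixes f :: "real \<Rightarrow> complex" and u :: "nat \<Rightarrow> real"
  assumes f: "f \<in> L2_space lborel" and u: "u \<longlonglongrightarrow> 0"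
  shows "(\<lambda>n. L2_norm lborel (\<lambda>x. f (x - u n) - f x)) \<longlonglongrightarrow> 0"
proof (rule LIMSEQ_I)
  fix r :: real assume "r > 0"
  then obtain k B R where k: "continuous_on UNIV k" "\<And>x. cmod (k x) \<le> B * indicator {-R..R} x" 
    "L2_norm lborel (\<lambda>x. k x - f x) < r / 3" using L2_approx_continuous[OF f, of "r/3"] by auto
  have km[measurable]: "k \<in> borel_measurable borel" by (rule borel_measurable_continuous_onI[OF k(1)])
  have kL: "k \<in> L2_space lborel" by (rule L2_space_bounded_support[OF _ k(2)]) simp
  obtain U where U: "\<And>n. \<bar>u n\<bar> \<le> U" using convergent_imp_Bseq[OF convergentI[OF u]] by (auto simp: Bseq_def)
  have B: "B * indicator {-R..R} x \<ge> 0" for x :: real using order_trans[OF norm_ge_zero k(2)[of x]] .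
  define G where "G x = complex_of_real (\<bar>B\<bar> * indicator {-(R + U)..R + U} x)" for x :: real
  have "L2_tendsto lborel (\<lambda>n x. k (x - u n)) k"
  proof (rule L2_tendsto_dominated[where g = G])
    show "G \<in> L2_space lborel" unfolding G_def
      by (intro L2_space_bounded_support[where B = "\<bar>B\<bar>" and R = "R + U"]) (auto simp: indicator_def)
    have Geq: "cmod (G x) = \<bar>B\<bar> * indicator {-(R + U)..R + U} x" for x
      unfolding G_def norm_of_real by (simp add: abs_mult)
    have "cmod (k (x - v)) \<le> cmod (G x)" if "\<bar>v\<bar> \<le> U" for x v
    proof (cases "\<bar>x - v\<bar> \<le> R")
      case True
      then have "x \<in> {-(R + U)..R + U}" "x - v \<in> {-R..R}" using that by (auto simp: abs_le_iff)
      then show ?thesis unfolding Geq using k(2)[of "x - v"] by simp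
    next
      case False
      then have "x - v \<notin> {-R..R}" by auto
      then have "cmod (k (x - v)) \<le> 0" using k(2)[of "x - v"] by simp
      then show ?thesis unfolding Geq by simp
    qed
    note dom = this
    show "AE x in lborel. cmod (k (x - u n)) \<le> cmod (G x)" for n using dom[OF U] by simp
    show "AE x in lborel. cmod (k x) \<le> cmod (G x)"
      using dom[of 0] U[of 0] by (intro AE_I2) simp
    show "AE x in lborel. (\<lambda>n. k (x - u n)) \<longlonglongrightarrow> k x"
    proof (rule AE_I2)
      fix x
      have "isCont k x" using k(1) by (simp add: continuous_on_eq_continuous_at)
      moreover have "(\<lambda>n. x - u n) \<longlonglongrightarrow> x" using tendsto_diff[OF tendsto_const u, of x] by simp
      ultimately show "(\<lambda>n. k (x - u n)) \<longlonglongrightarrow> k x" by (rule isCont_tendsto_compose)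
    qed
  qed auto
  from L2_tendstoD[OF this L2_space_shift[OF kL] kL, of "r/3"] \<open>r > 0\<close>
  obtain N where N: "\<And>n. n \<ge> N \<Longrightarrow> L2_norm lborel (\<lambda>x. k (x - u n) - k x) < r / 3"
    by (auto simp: eventually_sequentially)
  have "norm (L2_norm lborel (\<lambda>x. f (x - u n) - f x) - 0) < r" if "n \<ge> N" for n
  proof -
    have "L2_norm lborel (\<lambda>x. f (x - u n) - f x) = L2_norm lborel (\<lambda>x. (f (x - u n) - k (x - u n)) + ((k (x - u n) - k x) + (k x - f x)))" by simp
    also have "\<dots> \<le> L2_norm lborel (\<lambda>x. f (x - u n) - k (x - u n)) + L2_norm lborel (\<lambda>x. (k (x - u n) - k x) + (k x - f x))"
      by (intro L2_minkowski L2_space_diff L2_space_add L2_space_shift kL f)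
    also have "L2_norm lborel (\<lambda>x. (k (x - u n) - k x) + (k x - f x)) \<le> L2_norm lborel (\<lambda>x. k (x - u n) - k x) + L2_norm lborel (\<lambda>x. k x - f x)"
      by (intro L2_minkowski L2_space_diff L2_space_shift kL f)
    also have "L2_norm lborel (\<lambda>x. f (x - u n) - k (x - u n)) = L2_norm lborel (\<lambda>x. k x - f x)"
      using L2_norm_shift[of "\<lambda>x. f x - k x" "u n"] L2_norm_minus_commute[of lborel f k] by simp
    finally show ?thesis using N[OF that] k(3) by simp
  qed
  then show "\<exists>no. \<forall>n\<ge>no. norm (L2_norm lborel (\<lambda>x. f (x - u n) - f x) - 0) < r" by blast
qed

section \<open>Gaussian summability and Plancherel\<close>

abbreviation fourier :: "(real \<Rightarrow> complex) \<Rightarrow> real \<Rightarrow> complex" where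
  "fourier \<equiv> fourier_L1 lborel (*)"

abbreviation char2pi :: "real \<Rightarrow> complex" where
  "char2pi x \<equiv> exp (2 * of_real pi * \<i> * of_real x)"

lemma norm_char2pi [simp]: "cmod (char2pi x) = 1"
  using norm_exp_i_times[of "2 * pi * x"] by (simp add: ac_simps)

lemma measurable_char2pi [measurable]:
  "(\<lambda>(x, y). char2pi (x * y)) \<in> borel_measurable (borel \<Otimes>\<^sub>M borel)"
  "(\<lambda>(x, y). char2pi (- (x * y))) \<in> borel_measurable (borel \<Otimes>\<^sub>M borel)"
  by measurable

lemma fourier_eq: "fourier f \<xi> = (LINT t|lborel. f t * char2pi (- (\<xi> * t)))"
  unfolding fourier_L1_def by simp

lemma measurable_fourier [measurable]:
  assumes [measurable]: "f \<in> borel_measurable borel"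
  shows "fourier f \<in> borel_measurable borel"
  unfolding fourier_L1_def by measurable

lemma integrable_mult_unimodular:
  fixes f k :: "'a \<Rightarrow> complex"
  assumes "integrable M f" and [measurable]: "k \<in> borel_measurable M" and "\<And>x. cmod (k x) \<le> 1"
  shows "integrable M (\<lambda>x. f x * k x)"
proof (rule Bochner_Integration.integrable_bound[OF assms(1)])
  show "AE x in M. norm (f x * k x) \<le> norm (f x)"
    using assms(3) by (intro AE_I2) (simp add: norm_mult mult_left_le)
qed (use assms(1) in measurable)

lemma fourier_bound:
  assumes "integrable lborel f" shows "cmod (fourier f \<xi>) \<le> (LINT t|lborel. cmod (f t))"
proof -
  have "cmod (fourier f \<xi>) \<le> (LINT t|lborel. cmod (f t * char2pi (- (\<xi> * t))))"
    unfolding fourier_eq by (rule integral_norm_bound)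
  then show ?thesis by (simp add: norm_mult del: of_real_minus of_real_mult)
qed

text \<open>The multiplication formula, with the kernel as a parameter so that one statement serves
  both signs of the exponent.\<close>

lemma fubini_kernel:
  fixes a b :: "real \<Rightarrow> complex" and k :: "real \<Rightarrow> real \<Rightarrow> complex"
  assumes a: "integrable lborel a" and b: "integrable lborel b"
    and [measurable]: "(\<lambda>(x, y). k x y) \<in> borel_measurable (borel \<Otimes>\<^sub>M borel)"
    and k: "\<And>x y. cmod (k x y) \<le> 1"
  shows "(LINT x|lborel. a x * (LINT y|lborel. b y * k x y)) = (LINT y|lborel. b y * (LINT x|lborel. a x * k x y))"
proof -
  have [measurable]: "a \<in> borel_measurable borel" "b \<in> borel_measurable borel" using a b by auto
  have int: "integrable (lborel \<Otimes>\<^sub>M lborel) (\<lambda>(x, y). a x * (b y * k x y))"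
  proof (rule lborel_pair.Fubini_integrable)
    show "(\<lambda>(x, y). a x * (b y * k x y)) \<in> borel_measurable (lborel \<Otimes>\<^sub>M lborel)" by measurable
    have ib: "integrable lborel (\<lambda>y. b y * k x y)" for x by (rule integrable_mult_unimodular[OF b _ k]) measurable
    show "AE x in lborel. integrable lborel (\<lambda>y. case (x, y) of (x, y) \<Rightarrow> a x * (b y * k x y))" using ib by simp
    show "integrable lborel (\<lambda>x. LINT y|lborel. norm (case (x, y) of (x, y) \<Rightarrow> a x * (b y * k x y)))"
    proof (rule Bochner_Integration.integrable_bound)
      show "integrable lborel (\<lambda>x. a x * of_real (LINT y|lborel. cmod (b y)))" using a by simp
      show "AE x in lborel. norm (LINT y|lborel. norm (case (x, y) of (x, y) \<Rightarrow> a x * (b y * k x y))) \<le> norm (a x * of_real (LINT y|lborel. cmod (b y)))"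
      proof (rule AE_I2)
        fix x
        have "(LINT y|lborel. cmod (b y * k x y)) \<le> (LINT y|lborel. cmod (b y))"
        proof (rule integral_mono)
          show "integrable lborel (\<lambda>y. cmod (b y * k x y))" by (rule integrable_norm[OF ib])
          show "integrable lborel (\<lambda>y. cmod (b y))" by (rule integrable_norm[OF b])
        qed (use k in \<open>simp add: norm_mult mult_left_le\<close>)
        then have "cmod (a x) * (LINT y|lborel. cmod (b y * k x y)) \<le> cmod (a x) * (LINT y|lborel. cmod (b y))"
          by (intro mult_left_mono) auto
        moreover have "0 \<le> (LINT y|lborel. cmod (b y))" "0 \<le> (LINT y|lborel. cmod (b y * k x y))" by (auto intro: Bochner_Integration.integral_nonneg)
        ultimately show "norm (LINT y|lborel. norm (case (x, y) of (x, y) \<Rightarrow> a x * (b y * k x y))) \<le> norm (a x * of_real (LINT y|lborel. cmod (b y)))"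
          by (simp add: norm_mult abs_mult)
      qed
    qed measurable
  qed
  have "(LINT x|lborel. a x * (LINT y|lborel. b y * k x y)) = (LINT x|lborel. LINT y|lborel. a x * (b y * k x y))" by simp
  also have "\<dots> = (LINT y|lborel. LINT x|lborel. a x * (b y * k x y))"
    using lborel_pair.Fubini_integral[OF int] by simp
  also have "\<dots> = (LINT y|lborel. LINT x|lborel. b y * (a x * k x y))" by (simp add: ac_simps)
  finally show ?thesis by simp
qed

text \<open>Scaled so that its inverse transform is the density of the centred normal law with
  standard deviation \<delta>.\<close>

definition gauss_weight :: "real \<Rightarrow> real \<Rightarrow> real" where
  "gauss_weight \<delta> \<xi> = exp (- (2 * pi * \<delta> * \<xi>)\<^sup>2 / 2)"

lemma gauss_weight_eq: "gauss_weight \<delta> \<xi> = sqrt (2 * pi) * std_normal_density (2 * pi * \<delta> * \<xi>)"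
  by (simp add: gauss_weight_def std_normal_density_def)

lemma gauss_weight_bounds: "0 \<le> gauss_weight \<delta> \<xi>" "gauss_weight \<delta> \<xi> \<le> 1" "0 < gauss_weight \<delta> \<xi>"
  by (simp_all add: gauss_weight_def)

lemma gauss_weight_measurable [measurable]: "gauss_weight \<delta> \<in> borel_measurable borel"
  unfolding gauss_weight_def[abs_def] by measurable

lemma integral_std_normal_iexp: 
  "integrable lborel (\<lambda>w. std_normal_density w *\<^sub>R iexp (t * w))"
  "(LINT w|lborel. std_normal_density w *\<^sub>R iexp (t * w)) = of_real (exp (- t\<^sup>2 / 2))"
proof -
  show "(LINT w|lborel. std_normal_density w *\<^sub>R iexp (t * w)) = of_real (exp (- t\<^sup>2 / 2))"
    using char_std_normal_distribution unfolding char_def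
    by (subst (asm) integral_density) (auto dest: fun_cong[of _ _ t] simp: normal_density_nonneg)
  show "integrable lborel (\<lambda>w. std_normal_density w *\<^sub>R iexp (t * w))"
    by (rule Bochner_Integration.integrable_bound[where f = std_normal_density])
       (auto simp: integrable_std_normal_moment[of 0, simplified] normal_density_nonneg)
qed

lemma gauss_weight_integrable: 
  assumes "\<delta> > 0"
  shows "integrable lborel (\<lambda>\<xi>. complex_of_real (gauss_weight \<delta> \<xi>))"
proof -
  have "integrable lborel std_normal_density" using integrable_std_normal_moment[of 0] by simp
  then have "integrable lborel (\<lambda>\<xi>. std_normal_density (0 + (2 * pi * \<delta>) * \<xi>))"
    using assms by (intro lborel_integrable_real_affine) auto
  then show ?thesis unfolding gauss_weight_eq by simp
qed

lemma gauss_weight_inverse_transform: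
  assumes "\<delta> > 0"
  shows "(LINT \<xi>|lborel. of_real (gauss_weight \<delta> \<xi>) * char2pi (\<xi> * u)) = of_real (std_normal_density (u / \<delta>) / \<delta>)"
proof -
  have c: "1 / (2 * pi * \<delta>) \<noteq> 0" using assms by simp
  have "(LINT \<xi>|lborel. of_real (gauss_weight \<delta> \<xi>) * char2pi (\<xi> * u))
     = \<bar>1 / (2 * pi * \<delta>)\<bar> *\<^sub>R (LINT w|lborel. of_real (gauss_weight \<delta> (0 + 1 / (2 * pi * \<delta>) * w)) * char2pi ((0 + 1 / (2 * pi * \<delta>) * w) * u))"
    by (rule lborel_integral_real_affine[OF c])
  also have "(\<lambda>w. of_real (gauss_weight \<delta> (0 + 1 / (2 * pi * \<delta>) * w)) * char2pi ((0 + 1 / (2 * pi * \<delta>) * w) * u))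
     = (\<lambda>w. of_real (sqrt (2 * pi)) * (std_normal_density w *\<^sub>R iexp ((u / \<delta>) * w)))"
  proof
    fix w
    have "2 * pi * \<delta> * (0 + 1 / (2 * pi * \<delta>) * w) = w" using assms by simp
    moreover have "2 * of_real pi * \<i> * complex_of_real ((0 + 1 / (2 * pi * \<delta>) * w) * u) = \<i> * of_real ((u / \<delta>) * w)"
      using assms by (simp add: field_simps)
    ultimately show "of_real (gauss_weight \<delta> (0 + 1 / (2 * pi * \<delta>) * w)) * char2pi ((0 + 1 / (2 * pi * \<delta>) * w) * u)
     = of_real (sqrt (2 * pi)) * (std_normal_density w *\<^sub>R iexp ((u / \<delta>) * w))"
      unfolding gauss_weight_eq by (simp only: scaleR_conv_of_real of_real_mult mult.assoc)
  qed
  also have "(LINT w|lborel. of_real (sqrt (2 * pi)) * (std_normal_density w *\<^sub>R iexp ((u / \<delta>) * w))) 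
     = of_real (sqrt (2 * pi)) * of_real (exp (- (u / \<delta>)\<^sup>2 / 2))"
    by (simp only: integral_mult_right_zero integral_std_normal_iexp(2))
  also have "\<bar>1 / (2 * pi * \<delta>)\<bar> *\<^sub>R (of_real (sqrt (2 * pi)) * complex_of_real (exp (- (u / \<delta>)\<^sup>2 / 2))) = of_real (std_normal_density (u / \<delta>) / \<delta>)"
  proof -
    have "sqrt (2 * pi) * sqrt (2 * pi) = 2 * pi" by simp
    then have q: "sqrt (2 * pi) / (2 * pi) = 1 / sqrt (2 * pi)" by (simp add: field_simps)
    have "\<bar>1 / (2 * pi * \<delta>)\<bar> * (sqrt (2 * pi) * exp (- (u / \<delta>)\<^sup>2 / 2)) = (sqrt (2 * pi) / (2 * pi)) * exp (- (u / \<delta>)\<^sup>2 / 2) / \<delta>"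
      using assms by simp
    also have "\<dots> = std_normal_density (u / \<delta>) / \<delta>" unfolding q std_normal_density_def by simp
    finally have "\<bar>1 / (2 * pi * \<delta>)\<bar> * (sqrt (2 * pi) * exp (- (u / \<delta>)\<^sup>2 / 2)) = std_normal_density (u / \<delta>) / \<delta>" .
    then show ?thesis unfolding scaleR_conv_of_real of_real_mult[symmetric] by (rule arg_cong)
  qed
  finally show ?thesis .
qed

text \<open>Convolution with that density, written as an expectation: the probability measure does
  not depend on \<delta>, so limits in \<delta> can be taken under the integral.\<close>

definition gauss_smooth :: "real \<Rightarrow> (real \<Rightarrow> complex) \<Rightarrow> real \<Rightarrow> complex" where
  "gauss_smooth \<delta> f x = (LINT w|std_normal_distribution. f (x - \<delta> * w))"

lemma gauss_smooth_fourier: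
  assumes h: "integrable lborel h" and \<delta>: "\<delta> > 0"
  shows "(LINT \<xi>|lborel. fourier h \<xi> * of_real (gauss_weight \<delta> \<xi>) * char2pi (\<xi> * x)) = gauss_smooth \<delta> h x"
proof -
  have [measurable]: "h \<in> borel_measurable borel" using h by auto
  have int: "integrable lborel (\<lambda>\<xi>. of_real (gauss_weight \<delta> \<xi>) * char2pi (\<xi> * x))"
    by (rule integrable_mult_unimodular[OF gauss_weight_integrable[OF \<delta>]]) auto
  have "(LINT \<xi>|lborel. fourier h \<xi> * of_real (gauss_weight \<delta> \<xi>) * char2pi (\<xi> * x))
    = (LINT \<xi>|lborel. (of_real (gauss_weight \<delta> \<xi>) * char2pi (\<xi> * x)) * (LINT y|lborel. h y * char2pi (- (\<xi> * y))))"
    unfolding fourier_eq by (simp only: ac_simps)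
  also have "\<dots> = (LINT y|lborel. h y * (LINT \<xi>|lborel. (of_real (gauss_weight \<delta> \<xi>) * char2pi (\<xi> * x)) * char2pi (- (\<xi> * y))))"
    by (rule fubini_kernel[OF int h measurable_char2pi(2)]) (simp only: norm_char2pi)
  also have "\<dots> = (LINT y|lborel. h y * (LINT \<xi>|lborel. of_real (gauss_weight \<delta> \<xi>) * char2pi (\<xi> * (x - y))))"
    by (simp add: mult.assoc exp_add[symmetric] ring_distribs)
  also have "\<dots> = (LINT y|lborel. h y * of_real (std_normal_density ((x - y) / \<delta>) / \<delta>))"
    by (simp only: gauss_weight_inverse_transform[OF \<delta>])
  also have "\<dots> = \<bar>- \<delta>\<bar> *\<^sub>R (LINT w|lborel. h (x + (- \<delta>) * w) * of_real (std_normal_density ((x - (x + (- \<delta>) * w)) / \<delta>) / \<delta>))"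
    using \<delta> by (intro lborel_integral_real_affine) auto
  also have "\<dots> = (LINT w|lborel. \<bar>- \<delta>\<bar> *\<^sub>R (h (x + (- \<delta>) * w) * of_real (std_normal_density ((x - (x + (- \<delta>) * w)) / \<delta>) / \<delta>)))"
    by simp
  also have "\<dots> = (LINT w|lborel. std_normal_density w *\<^sub>R h (x - \<delta> * w))"
    using \<delta> by (intro Bochner_Integration.integral_cong) (auto simp: scaleR_conv_of_real)
  also have "\<dots> = gauss_smooth \<delta> h x"
    unfolding gauss_smooth_def by (subst integral_density) (auto simp: normal_density_nonneg)
  finally show ?thesis .
qed

lemma prob_space_std_normal: "prob_space std_normal_distribution"
  by (rule prob_space_normal_density) simp

lemma measurable_gauss_smooth [measurable]:
  assumes [measurable]: "f \<in> borel_measurable borel"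
  shows "gauss_smooth \<delta> f \<in> borel_measurable borel"
proof -
  interpret G: prob_space std_normal_distribution by (rule prob_space_std_normal)
  show ?thesis unfolding gauss_smooth_def[abs_def] by measurable
qed

text \<open>Cauchy-Schwarz against the constant 1 on a probability space. If the right-hand side is
  infinite, the integral in \<open>gauss_smooth\<close> may diverge and have the default value 0;
  the claim is then trivial.\<close>

lemma gauss_smooth_pointwise:
  assumes [measurable]: "h \<in> borel_measurable borel"
  shows "ennreal ((cmod (gauss_smooth \<delta> h x - h x))\<^sup>2) \<le> (\<integral>\<^sup>+ w. ennreal ((cmod (h (x - \<delta> * w) - h x))\<^sup>2) \<partial>std_normal_distribution)"
proof (cases "(\<integral>\<^sup>+ w. ennreal ((cmod (h (x - \<delta> * w) - h x))\<^sup>2) \<partial>std_normal_distribution) < \<infinity>")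
  case True
  interpret G: prob_space std_normal_distribution by (rule prob_space_std_normal)
  define k where "k w = h (x - \<delta> * w) - h x" for w
  have k: "k \<in> L2_space std_normal_distribution"
    using True unfolding k_def by (intro L2_spaceI) auto
  have one: "(\<lambda>_. 1) \<in> L2_space std_normal_distribution" by (simp add: L2_space_def)
  have ik: "integrable std_normal_distribution k" using L2_integrable_mult(1)[OF k one] by simp
  have "integrable std_normal_distribution (\<lambda>w. k w + h x)" using ik by simp
  moreover have "gauss_smooth \<delta> h x = (LINT w|std_normal_distribution. k w + h x)"
    by (simp add: gauss_smooth_def k_def)
  ultimately have eq: "gauss_smooth \<delta> h x - h x = (LINT w|std_normal_distribution. k w)"
    using ik G.prob_space by simp
  have "cmod (LINT w|std_normal_distribution. k w) \<le> (LINT w|std_normal_distribution. cmod (k w) * cmod 1)"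
    using integral_norm_bound[of std_normal_distribution k] by simp
  also have "\<dots> \<le> L2_norm std_normal_distribution k * L2_norm std_normal_distribution (\<lambda>_. 1)"
    by (rule L2_cauchy_schwarz[OF k one])
  also have "L2_norm std_normal_distribution (\<lambda>_. 1) = 1" unfolding L2_norm_eq using G.prob_space by simp
  finally have "cmod (gauss_smooth \<delta> h x - h x) \<le> L2_norm std_normal_distribution k" unfolding eq by simp
  then have "ennreal ((cmod (gauss_smooth \<delta> h x - h x))\<^sup>2) \<le> ennreal ((L2_norm std_normal_distribution k)\<^sup>2)"
    by (intro ennreal_leI power_mono) auto
  also have "\<dots> = (\<integral>\<^sup>+ w. ennreal ((cmod (k w))\<^sup>2) \<partial>std_normal_distribution)" using nn_integral_L2[OF k] by simp
  finally show ?thesis unfolding k_def .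
next
  case False
  then have "(\<integral>\<^sup>+ w. ennreal ((cmod (h (x - \<delta> * w) - h x))\<^sup>2) \<partial>std_normal_distribution) = \<infinity>"
    by (simp add: not_less top_unique)
  then show ?thesis by simp
qed

lemma L2_norm_shift_diff:
  fixes u :: real
  assumes h: "h \<in> L2_space lborel"
  shows "L2_norm lborel (\<lambda>x. h (x - u) - h x) \<le> 2 * L2_norm lborel h"
proof -
  have "L2_norm lborel (\<lambda>x. h (x - u) + (-1) * h x) \<le> L2_norm lborel (\<lambda>x. h (x - u)) + L2_norm lborel (\<lambda>x. (-1) * h x)"
    by (intro L2_minkowski L2_space_shift L2_space_cmult h)
  also have "L2_norm lborel (\<lambda>x. (-1) * h x) = L2_norm lborel h" unfolding L2_norm_eq by simp
  also have "L2_norm lborel (\<lambda>x. h (x - u)) = L2_norm lborel h" by (rule L2_norm_shift)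
  finally show ?thesis by simp
qed

lemma gauss_smooth_distance:
  assumes h: "h \<in> L2_space lborel"
  shows "(\<integral>\<^sup>+ x. ennreal ((cmod (gauss_smooth \<delta> h x - h x))\<^sup>2) \<partial>lborel)
    \<le> (\<integral>\<^sup>+ w. ennreal ((L2_norm lborel (\<lambda>x. h (x - \<delta> * w) - h x))\<^sup>2) \<partial>std_normal_distribution)"
proof -
  have [measurable]: "h \<in> borel_measurable borel" using h by (simp add: L2_space_def)
  interpret G: prob_space std_normal_distribution by (rule prob_space_std_normal)
  interpret P: pair_sigma_finite lborel std_normal_distribution ..
  have "(\<integral>\<^sup>+ x. ennreal ((cmod (gauss_smooth \<delta> h x - h x))\<^sup>2) \<partial>lborel)
      \<le> (\<integral>\<^sup>+ x. \<integral>\<^sup>+ w. ennreal ((cmod (h (x - \<delta> * w) - h x))\<^sup>2) \<partial>std_normal_distribution \<partial>lborel)"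
    by (intro nn_integral_mono gauss_smooth_pointwise) measurable
  also have "\<dots> = (\<integral>\<^sup>+ w. \<integral>\<^sup>+ x. ennreal ((cmod (h (x - \<delta> * w) - h x))\<^sup>2) \<partial>lborel \<partial>std_normal_distribution)"
    by (rule P.Fubini'[symmetric]) measurable
  also have "\<dots> = (\<integral>\<^sup>+ w. ennreal ((L2_norm lborel (\<lambda>x. h (x - \<delta> * w) - h x))\<^sup>2) \<partial>std_normal_distribution)"
    by (intro nn_integral_cong nn_integral_L2 L2_space_diff L2_space_shift h)
  finally show ?thesis by simp
qed

lemma gauss_smooth_tendsto:
  assumes h: "h \<in> L2_space lborel" and \<delta>: "\<delta> \<longlonglongrightarrow> 0"
  shows "L2_tendsto lborel (\<lambda>n. gauss_smooth (\<delta> n) h) h"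
proof -
  have [measurable]: "h \<in> borel_measurable borel" using h by (simp add: L2_space_def)
  interpret G: prob_space std_normal_distribution by (rule prob_space_std_normal)
  define U where "U u = ennreal ((L2_norm lborel (\<lambda>x. h (x - u) - h x))\<^sup>2)" for u
  have "U u = (\<integral>\<^sup>+ x. ennreal ((cmod (h (x - u) - h x))\<^sup>2) \<partial>lborel)" for u
    unfolding U_def by (intro nn_integral_L2[symmetric] L2_space_diff L2_space_shift h)
  then have "U = (\<lambda>u. \<integral>\<^sup>+ x. ennreal ((cmod (h (x - u) - h x))\<^sup>2) \<partial>lborel)" by (rule ext)
  then have [measurable]: "U \<in> borel_measurable borel" by simp
  have "(\<lambda>n. \<integral>\<^sup>+ w. U (\<delta> n * w) \<partial>std_normal_distribution) \<longlonglongrightarrow> (\<integral>\<^sup>+ w. 0 \<partial>std_normal_distribution)"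
  proof (rule nn_integral_dominated_convergence[where w = "\<lambda>_. ennreal ((2 * L2_norm lborel h)\<^sup>2)"])
    show "(\<integral>\<^sup>+ x. ennreal ((2 * L2_norm lborel h)\<^sup>2) \<partial>std_normal_distribution) < \<infinity>"
      using G.emeasure_space_1 by (simp add: ennreal_mult_less_top)
    show "AE w in std_normal_distribution. (\<lambda>n. U (\<delta> n * w)) \<longlonglongrightarrow> 0"
    proof (rule AE_I2)
      fix w
      have "(\<lambda>n. \<delta> n * w) \<longlonglongrightarrow> 0" using tendsto_mult[OF \<delta> tendsto_const, of w] by simp
      from L2_translation_continuous[OF h this]
      have "(\<lambda>n. (L2_norm lborel (\<lambda>x. h (x - \<delta> n * w) - h x))\<^sup>2) \<longlonglongrightarrow> 0\<^sup>2" by (rule tendsto_power)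
      then have "(\<lambda>n. ennreal ((L2_norm lborel (\<lambda>x. h (x - \<delta> n * w) - h x))\<^sup>2)) \<longlonglongrightarrow> ennreal (0\<^sup>2)" by (rule tendsto_ennrealI)
      then show "(\<lambda>n. U (\<delta> n * w)) \<longlonglongrightarrow> 0" unfolding U_def by simp
    qed
    show "AE w in std_normal_distribution. U (\<delta> n * w) \<le> ennreal ((2 * L2_norm lborel h)\<^sup>2)" for n
      unfolding U_def by (intro AE_I2 ennreal_leI power_mono L2_norm_shift_diff h) auto
  qed auto
  then have lim: "(\<lambda>n. \<integral>\<^sup>+ w. U (\<delta> n * w) \<partial>std_normal_distribution) \<longlonglongrightarrow> 0" by simp
  show ?thesis unfolding L2_tendsto_def
  proof (rule tendsto_sandwich[OF always_eventually always_eventually tendsto_const lim])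
    show "\<forall>n. (\<integral>\<^sup>+ x. ennreal ((cmod (gauss_smooth (\<delta> n) h x - h x))\<^sup>2) \<partial>lborel)
        \<le> (\<integral>\<^sup>+ w. U (\<delta> n * w) \<partial>std_normal_distribution)"
      unfolding U_def by (intro allI gauss_smooth_distance h)
  qed simp
qed

lemma gauss_smooth_L2:
  assumes h: "h \<in> L2_space lborel"
  shows "gauss_smooth \<delta> h \<in> L2_space lborel"
proof -
  have hm[measurable]: "h \<in> borel_measurable borel" using h by (simp add: L2_space_def)
  interpret G: prob_space std_normal_distribution by (rule prob_space_std_normal)
  note gauss_smooth_distance[OF h, of \<delta>]
  also have "(\<integral>\<^sup>+ w. ennreal ((L2_norm lborel (\<lambda>x. h (x - \<delta> * w) - h x))\<^sup>2) \<partial>std_normal_distribution)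
    \<le> (\<integral>\<^sup>+ w. ennreal ((2 * L2_norm lborel h)\<^sup>2) \<partial>std_normal_distribution)"
    by (intro nn_integral_mono ennreal_leI power_mono L2_norm_shift_diff h) auto
  also have "\<dots> < \<infinity>" using G.emeasure_space_1 by (simp add: ennreal_mult_less_top)
  finally have "(\<lambda>x. gauss_smooth \<delta> h x - h x) \<in> L2_space lborel" by (intro L2_spaceI) auto
  from L2_space_add[OF this h] show ?thesis by simp
qed

lemma cnj_fourier: "cnj (fourier h \<xi>) = (LINT x|lborel. cnj (h x) * char2pi (\<xi> * x))"
proof -
  have "cnj (char2pi (- (\<xi> * x))) = char2pi (\<xi> * x)" for x by (simp add: exp_cnj)
  then show ?thesis unfolding fourier_eq by (simp only: Bochner_Integration.integral_cnj[symmetric] complex_cnj_mult)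
qed

lemma fourier_gauss_integrable:
  assumes h: "integrable lborel h" and \<delta>: "\<delta> > 0"
  shows "integrable lborel (\<lambda>\<xi>. fourier h \<xi> * of_real (gauss_weight \<delta> \<xi>))"
proof (rule Bochner_Integration.integrable_bound)
  have [measurable]: "h \<in> borel_measurable borel" using h by auto
  show "integrable lborel (\<lambda>\<xi>. of_real (LINT t|lborel. cmod (h t)) * complex_of_real (gauss_weight \<delta> \<xi>))"
    using gauss_weight_integrable[OF \<delta>] by simp
  show "(\<lambda>\<xi>. fourier h \<xi> * of_real (gauss_weight \<delta> \<xi>)) \<in> borel_measurable lborel" by measurable
  show "AE \<xi> in lborel. norm (fourier h \<xi> * of_real (gauss_weight \<delta> \<xi>)) \<le> norm (of_real (LINT t|lborel. cmod (h t)) * complex_of_real (gauss_weight \<delta> \<xi>))"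
    unfolding norm_mult norm_of_real
    by (intro AE_I2 mult_right_mono order_trans[OF fourier_bound[OF h] abs_ge_self] abs_ge_zero)
qed

text \<open>The Gaussian-weighted energy \<open>I n\<close> of the transform is computed twice. By
  Fubini it is the inner product of \<open>h\<close> with its Gaussian mean and tends to the squared
  norm of \<open>h\<close>; by monotone convergence it tends to the energy of the transform. The
  second limit presupposes no integrability, so square integrability of the transform is a
  result.\<close>

lemma plancherel_L1_L2:
  assumes h1: "integrable lborel h" and h2: "h \<in> L2_space lborel"
  shows "fourier h \<in> L2_space lborel" "L2_norm lborel (fourier h) = L2_norm lborel h"
proof -
  have hm[measurable]: "h \<in> borel_measurable borel" using h1 by auto
  define \<delta> where "\<delta> n = 1 / real (Suc n)" for n
  have \<delta>: "\<delta> \<longlonglongrightarrow> 0" "\<delta> n > 0" for n unfolding \<delta>_def using LIMSEQ_Suc[OF lim_1_over_n] by auto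
  define I where "I n = (LINT \<xi>|lborel. (cmod (fourier h \<xi>))\<^sup>2 * gauss_weight (\<delta> n) \<xi>)" for n
  have sq: "of_real ((cmod (fourier h \<xi>))\<^sup>2 * gauss_weight (\<delta> n) \<xi>) = (fourier h \<xi> * of_real (gauss_weight (\<delta> n) \<xi>)) * cnj (fourier h \<xi>)" for \<xi> n
    by (simp add: complex_norm_square del: of_real_power) 
  have cn: "integrable lborel (\<lambda>x. cnj (h x))" using h1 by simp
  have I_int: "integrable lborel (\<lambda>\<xi>. (cmod (fourier h \<xi>))\<^sup>2 * gauss_weight (\<delta> n) \<xi>)" for n
  proof (rule Bochner_Integration.integrable_bound)
    let ?B = "LINT t|lborel. cmod (h t)"
    show "integrable lborel (\<lambda>\<xi>. of_real ?B * (fourier h \<xi> * of_real (gauss_weight (\<delta> n) \<xi>)))"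
      using fourier_gauss_integrable[OF h1 \<delta>(2)] by simp
    show "AE \<xi> in lborel. norm ((cmod (fourier h \<xi>))\<^sup>2 * gauss_weight (\<delta> n) \<xi>) \<le> norm (of_real ?B * (fourier h \<xi> * of_real (gauss_weight (\<delta> n) \<xi>)))"
    proof (rule AE_I2)
      fix \<xi>
      have "cmod (fourier h \<xi>) * (cmod (fourier h \<xi>) * gauss_weight (\<delta> n) \<xi>) \<le> \<bar>?B\<bar> * (cmod (fourier h \<xi>) * gauss_weight (\<delta> n) \<xi>)"
        using fourier_bound[OF h1, of \<xi>] gauss_weight_bounds by (intro mult_right_mono mult_nonneg_nonneg) (auto intro: order_trans)
      then show "norm ((cmod (fourier h \<xi>))\<^sup>2 * gauss_weight (\<delta> n) \<xi>) \<le> norm (of_real ?B * (fourier h \<xi> * of_real (gauss_weight (\<delta> n) \<xi>)))"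
        using gauss_weight_bounds(1)[of "\<delta> n" \<xi>] by (simp add: norm_mult power2_eq_square abs_mult mult.assoc)
    qed
  qed measurable
  have I_eq: "of_real (I n) = (LINT x|lborel. cnj (h x) * gauss_smooth (\<delta> n) h x)" for n
  proof -
    have "of_real (I n) = (LINT \<xi>|lborel. (fourier h \<xi> * of_real (gauss_weight (\<delta> n) \<xi>)) * cnj (fourier h \<xi>))"
      unfolding I_def sq[symmetric] by (rule integral_of_real[OF I_int, symmetric])
    also have "\<dots> = (LINT \<xi>|lborel. (fourier h \<xi> * of_real (gauss_weight (\<delta> n) \<xi>)) * (LINT x|lborel. cnj (h x) * char2pi (\<xi> * x)))"
      unfolding cnj_fourier ..
    also have "\<dots> = (LINT x|lborel. cnj (h x) * (LINT \<xi>|lborel. (fourier h \<xi> * of_real (gauss_weight (\<delta> n) \<xi>)) * char2pi (\<xi> * x)))"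
      by (rule fubini_kernel[OF fourier_gauss_integrable[OF h1 \<delta>(2)] cn measurable_char2pi(1)]) (simp only: norm_char2pi)
    finally show ?thesis unfolding gauss_smooth_fourier[OF h1 \<delta>(2)] .
  qed
  have hh: "of_real ((L2_norm lborel h)\<^sup>2) = (LINT x|lborel. cnj (h x) * h x)"
  proof -
    have "(LINT x|lborel. cnj (h x) * h x) = (LINT x|lborel. of_real ((cmod (h x))\<^sup>2))"
      by (intro Bochner_Integration.integral_cong) (auto simp: complex_norm_square mult.commute simp del: of_real_power)
    also have "\<dots> = of_real (LINT x|lborel. (cmod (h x))\<^sup>2)"
      using h2 by (intro integral_of_real) (simp add: L2_space_def)
    finally show ?thesis unfolding L2_norm_power2 by simp
  qed
  have cL2: "(\<lambda>x. cnj (h x)) \<in> L2_space lborel"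
    by (rule L2_space_bound[OF h2 borel_measurable_integrable[OF cn], where C = 1]) auto
  have conv: "L2_tendsto lborel (\<lambda>n. gauss_smooth (\<delta> n) h) h" by (rule gauss_smooth_tendsto[OF h2 \<delta>(1)])
  then have conv': "(\<lambda>n. L2_norm lborel (\<lambda>x. gauss_smooth (\<delta> n) h x - h x)) \<longlonglongrightarrow> 0"
    by (rule L2_tendsto_iff[OF gauss_smooth_L2[OF h2] h2, THEN iffD1])
  have diff: "\<bar>I n - (L2_norm lborel h)\<^sup>2\<bar> \<le> L2_norm lborel h * L2_norm lborel (\<lambda>x. gauss_smooth (\<delta> n) h x - h x)" for n
  proof -
    have i1: "integrable lborel (\<lambda>x. cnj (h x) * gauss_smooth (\<delta> n) h x)" by (intro L2_integrable_mult cL2 gauss_smooth_L2 h2)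
    have i2: "integrable lborel (\<lambda>x. cnj (h x) * h x)" by (intro L2_integrable_mult cL2 h2)
    have "\<bar>I n - (L2_norm lborel h)\<^sup>2\<bar> = cmod (of_real (I n) - of_real ((L2_norm lborel h)\<^sup>2))"
      unfolding of_real_diff[symmetric] norm_of_real ..
    also have "\<dots> = cmod (LINT x|lborel. cnj (h x) * (gauss_smooth (\<delta> n) h x - h x))"
      unfolding I_eq hh right_diff_distrib by (subst Bochner_Integration.integral_diff[OF i1 i2]) simp
    also have "\<dots> \<le> (LINT x|lborel. cmod (cnj (h x)) * cmod (gauss_smooth (\<delta> n) h x - h x))"
      using integral_norm_bound[of lborel "\<lambda>x. cnj (h x) * (gauss_smooth (\<delta> n) h x - h x)"] by (simp add: norm_mult)
    also have "\<dots> \<le> L2_norm lborel (\<lambda>x. cnj (h x)) * L2_norm lborel (\<lambda>x. gauss_smooth (\<delta> n) h x - h x)"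
      by (intro L2_cauchy_schwarz cL2 L2_space_diff gauss_smooth_L2 h2)
    also have "L2_norm lborel (\<lambda>x. cnj (h x)) = L2_norm lborel h" unfolding L2_norm_eq by simp
    finally show ?thesis .
  qed
  have "(\<lambda>n. I n - (L2_norm lborel h)\<^sup>2) \<longlonglongrightarrow> 0"
  proof (rule Lim_null_comparison)
    show "\<forall>\<^sub>F n in sequentially. norm (I n - (L2_norm lborel h)\<^sup>2) \<le> L2_norm lborel h * L2_norm lborel (\<lambda>x. gauss_smooth (\<delta> n) h x - h x)"
      using diff by simp
    show "(\<lambda>n. L2_norm lborel h * L2_norm lborel (\<lambda>x. gauss_smooth (\<delta> n) h x - h x)) \<longlonglongrightarrow> 0"
      using tendsto_mult[OF tendsto_const conv'] by simp
  qed
  then have "I \<longlonglongrightarrow> (L2_norm lborel h)\<^sup>2" by (simp add: LIM_zero_iff)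
  then have lim1: "(\<lambda>n. ennreal (I n)) \<longlonglongrightarrow> ennreal ((L2_norm lborel h)\<^sup>2)" by (rule tendsto_ennrealI)
  have nI: "ennreal (I n) = (\<integral>\<^sup>+\<xi>. ennreal ((cmod (fourier h \<xi>))\<^sup>2 * gauss_weight (\<delta> n) \<xi>) \<partial>lborel)" for n
    unfolding I_def using I_int[of n] gauss_weight_bounds by (intro nn_integral_eq_integral[symmetric]) auto
  have lim2: "(\<lambda>n. \<integral>\<^sup>+\<xi>. ennreal ((cmod (fourier h \<xi>))\<^sup>2 * gauss_weight (\<delta> n) \<xi>) \<partial>lborel) \<longlonglongrightarrow> (\<integral>\<^sup>+\<xi>. ennreal ((cmod (fourier h \<xi>))\<^sup>2) \<partial>lborel)"
  proof (rule nn_integral_LIMSEQ)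
    show "incseq (\<lambda>n \<xi>. ennreal ((cmod (fourier h \<xi>))\<^sup>2 * gauss_weight (\<delta> n) \<xi>))"
    proof (intro incseq_SucI le_funI ennreal_leI mult_left_mono)
      fix n \<xi>
      have "\<delta> (Suc n) \<le> \<delta> n" unfolding \<delta>_def by (intro divide_left_mono) auto
      then have "(2 * pi * \<delta> (Suc n))\<^sup>2 \<le> (2 * pi * \<delta> n)\<^sup>2" using \<delta>(2) by (intro power_mono mult_left_mono) (auto simp: less_imp_le)
      then have "(2 * pi * \<delta> (Suc n) * \<xi>)\<^sup>2 \<le> (2 * pi * \<delta> n * \<xi>)\<^sup>2" unfolding power_mult_distrib[of _ \<xi>] by (intro mult_right_mono) auto
      then show "gauss_weight (\<delta> n) \<xi> \<le> gauss_weight (\<delta> (Suc n)) \<xi>" unfolding gauss_weight_def by simp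
    qed simp
    show "(\<lambda>n. ennreal ((cmod (fourier h \<xi>))\<^sup>2 * gauss_weight (\<delta> n) \<xi>)) \<longlonglongrightarrow> ennreal ((cmod (fourier h \<xi>))\<^sup>2)" for \<xi>
    proof -
      have "(\<lambda>n. gauss_weight (\<delta> n) \<xi>) \<longlonglongrightarrow> exp (- (2 * pi * 0 * \<xi>)\<^sup>2 / 2)"
        unfolding gauss_weight_def by (intro tendsto_intros \<delta>(1)) simp
      then have "(\<lambda>n. gauss_weight (\<delta> n) \<xi>) \<longlonglongrightarrow> 1" by simp
      from tendsto_ennrealI[OF tendsto_mult[OF tendsto_const this]] show ?thesis by simp
    qed
  qed measurable
  have eq: "(\<integral>\<^sup>+\<xi>. ennreal ((cmod (fourier h \<xi>))\<^sup>2) \<partial>lborel) = ennreal ((L2_norm lborel h)\<^sup>2)"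
    using LIMSEQ_unique[OF lim2 lim1[unfolded nI]] .
  then show L2: "fourier h \<in> L2_space lborel" by (intro L2_spaceI) auto
  have "ennreal ((L2_norm lborel (fourier h))\<^sup>2) = ennreal ((L2_norm lborel h)\<^sup>2)"
    using eq nn_integral_L2[OF L2] by simp
  then show "L2_norm lborel (fourier h) = L2_norm lborel h" by simp
qed

section \<open>The transform relation: isometry, differences, existence, modulation\<close>

lemma L2_tendsto_bound:
  assumes "L2_tendsto M h f" "\<And>k. h k \<in> L2_space M" "f \<in> L2_space M"
    and "\<And>k. h' k \<in> L2_space N" "f' \<in> L2_space N"
    and "\<And>k. L2_norm N (\<lambda>x. h' k x - f' x) \<le> C * L2_norm M (\<lambda>x. h k x - f x)"
  shows "L2_tendsto N h' f'"
proof -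
  have "(\<lambda>k. L2_norm M (\<lambda>x. h k x - f x)) \<longlonglongrightarrow> 0" using assms(1) L2_tendsto_iff[OF assms(2,3)] by simp
  then have "(\<lambda>k. C * L2_norm M (\<lambda>x. h k x - f x)) \<longlonglongrightarrow> 0" using tendsto_mult[OF tendsto_const] by fastforce
  then have "(\<lambda>k. L2_norm N (\<lambda>x. h' k x - f' x)) \<longlonglongrightarrow> 0"
    by (rule tendsto_sandwich[OF _ _ tendsto_const, rotated 2]) (use assms(6) in auto)
  then show ?thesis using L2_tendsto_iff[OF assms(4,5)] by simp
qed

lemma has_fourierD:
  assumes "has_fourier_transform lborel (*) f g"
  shows "f \<in> L2_space lborel" "g \<in> L2_space lborel" "L2_norm lborel f = L2_norm lborel g"
proof -
  from assms obtain h where h: "\<And>k. h k \<in> L2_space lborel" "\<And>k. integrable lborel (h k)"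
    "L2_tendsto lborel h f" "L2_tendsto lborel (\<lambda>k. fourier (h k)) g"
    and f: "f \<in> L2_space lborel" and g: "g \<in> L2_space lborel"
    unfolding has_fourier_transform_def by blast
  show "f \<in> L2_space lborel" "g \<in> L2_space lborel" by fact+
  have "(\<lambda>k. L2_norm lborel (h k)) \<longlonglongrightarrow> L2_norm lborel f" by (rule L2_tendsto_norm[OF h(1) f h(3)])
  moreover have "(\<lambda>k. L2_norm lborel (fourier (h k))) \<longlonglongrightarrow> L2_norm lborel g"
    by (rule L2_tendsto_norm[OF plancherel_L1_L2(1)[OF h(2,1)] g h(4)])
  ultimately show "L2_norm lborel f = L2_norm lborel g"
    unfolding plancherel_L1_L2(2)[OF h(2,1)] by (rule LIMSEQ_unique)
qed

lemma measurable_char2pi_uminus [measurable]: "(\<lambda>x. char2pi (- (\<xi> * x))) \<in> borel_measurable borel"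
  by measurable

lemma integrable_mult_char2pi:
  assumes "integrable lborel f" shows "integrable lborel (\<lambda>x. f x * char2pi (- (\<xi> * x)))"
proof (rule integrable_mult_unimodular[OF assms])
  show "(\<lambda>x. char2pi (- (\<xi> * x))) \<in> borel_measurable lborel" by measurable
  show "cmod (char2pi (- (\<xi> * x))) \<le> 1" for x by (simp only: norm_char2pi)
qed

lemma fourier_diff:
  assumes "integrable lborel f" "integrable lborel g"
  shows "fourier (\<lambda>x. f x - g x) \<xi> = fourier f \<xi> - fourier g \<xi>"
proof -
  note i = integrable_mult_char2pi[OF assms(1), of \<xi>] integrable_mult_char2pi[OF assms(2), of \<xi>]
  show ?thesis unfolding fourier_eq left_diff_distrib by (rule Bochner_Integration.integral_diff[OF i])
qed

lemma L2_norm_diff_diff_le: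
  assumes "a \<in> L2_space M" "b \<in> L2_space M" "c \<in> L2_space M" "d \<in> L2_space M"
  shows "L2_norm M (\<lambda>x. (a x - b x) - (c x - d x)) \<le> L2_norm M (\<lambda>x. a x - c x) + L2_norm M (\<lambda>x. b x - d x)"
proof -
  have "L2_norm M (\<lambda>x. (a x - b x) - (c x - d x)) = L2_norm M (\<lambda>x. (a x - c x) + (d x - b x))" by (simp add: algebra_simps)
  also have "\<dots> \<le> L2_norm M (\<lambda>x. a x - c x) + L2_norm M (\<lambda>x. d x - b x)"
    using assms by (intro L2_minkowski L2_space_diff)
  also have "L2_norm M (\<lambda>x. d x - b x) = L2_norm M (\<lambda>x. b x - d x)" by (rule L2_norm_minus_commute)
  finally show ?thesis .
qed

lemma L2_tendsto_diff:
  assumes "L2_tendsto M h f" "\<And>k. h k \<in> L2_space M" "f \<in> L2_space M"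
    and "L2_tendsto M h' f'" "\<And>k. h' k \<in> L2_space M" "f' \<in> L2_space M"
  shows "L2_tendsto M (\<lambda>k x. h k x - h' k x) (\<lambda>x. f x - f' x)"
proof -
  have "(\<lambda>k. L2_norm M (\<lambda>x. h k x - f x) + L2_norm M (\<lambda>x. h' k x - f' x)) \<longlonglongrightarrow> 0 + 0"
    using assms L2_tendsto_iff[OF assms(2,3)] L2_tendsto_iff[OF assms(5,6)] by (intro tendsto_add) auto
  then have "(\<lambda>k. L2_norm M (\<lambda>x. h k x - f x) + L2_norm M (\<lambda>x. h' k x - f' x)) \<longlonglongrightarrow> 0" by simp
  then have "(\<lambda>k. L2_norm M (\<lambda>x. (h k x - h' k x) - (f x - f' x))) \<longlonglongrightarrow> 0"
    by (rule tendsto_sandwich[OF _ _ tendsto_const, rotated 2])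
       (use L2_norm_diff_diff_le[OF assms(2,5,3,6)] in auto)
  then show ?thesis by (subst L2_tendsto_iff) (auto intro: L2_space_diff assms)
qed

text \<open>Together with the isometry this shows that cutting off part of the spectrum perturbs
  \<open>f\<close> by exactly the norm of the removed part.\<close>

lemma has_fourier_diff:
  assumes "has_fourier_transform lborel (*) f g" "has_fourier_transform lborel (*) f' g'"
  shows "has_fourier_transform lborel (*) (\<lambda>x. f x - f' x) (\<lambda>x. g x - g' x)"
proof -
  from assms(1) obtain h where h: "\<And>k. h k \<in> L2_space lborel" "\<And>k. integrable lborel (h k)"
    "L2_tendsto lborel h f" "L2_tendsto lborel (\<lambda>k. fourier (h k)) g"
    unfolding has_fourier_transform_def by blast
  from assms(2) obtain h' where h': "\<And>k. h' k \<in> L2_space lborel" "\<And>k. integrable lborel (h' k)"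
    "L2_tendsto lborel h' f'" "L2_tendsto lborel (\<lambda>k. fourier (h' k)) g'"
    unfolding has_fourier_transform_def by blast
  note D = has_fourierD[OF assms(1)] has_fourierD[OF assms(2)]
  have "L2_tendsto lborel (\<lambda>k x. h k x - h' k x) (\<lambda>x. f x - f' x)"
    by (intro L2_tendsto_diff h h' D)
  moreover have "L2_tendsto lborel (\<lambda>k. fourier (\<lambda>x. h k x - h' k x)) (\<lambda>x. g x - g' x)"
  proof -
    have "(\<lambda>k. fourier (\<lambda>x. h k x - h' k x)) = (\<lambda>k x. fourier (h k) x - fourier (h' k) x)"
      using fourier_diff[OF h(2) h'(2)] by (intro ext) blast
    then show ?thesis using L2_tendsto_diff[OF h(4) _ _ h'(4)] plancherel_L1_L2(1)[OF h(2,1)] plancherel_L1_L2(1)[OF h'(2,1)] D by simp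
  qed
  ultimately show ?thesis unfolding has_fourier_transform_def
    using L2_space_diff[OF D(1) D(4)] L2_space_diff[OF D(2) D(5)] L2_space_diff[OF h(1) h'(1)] h(2) h'(2)
    by (intro conjI exI[of _ "\<lambda>k x. h k x - h' k x"] allI) auto
qed

lemma L2_space_reflect:
  fixes f :: "real \<Rightarrow> complex"
  assumes "f \<in> L2_space lborel" shows "(\<lambda>x. f (u - x)) \<in> L2_space lborel"
proof -
  have [measurable]: "f \<in> borel_measurable borel" using assms by (simp add: L2_space_def)
  have "integrable lborel (\<lambda>x. (cmod (f (u + (-1) * x)))\<^sup>2)"
    using assms by (intro lborel_integrable_real_affine[where f = "\<lambda>x. (cmod (f x))\<^sup>2"]) (auto simp: L2_space_def)
  then show ?thesis by (simp add: L2_space_def)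
qed

text \<open>The inverse transform of \<open>g\<close> is its reflected transform. It may fail to be
  integrable, but with a Gaussian weight it is, and the transforms of the weighted functions are the
  Gaussian means of \<open>g\<close>, which tend to \<open>g\<close>. The lemma produces functions
  with prescribed truncated spectrum.\<close>

lemma has_fourier_exists:
  assumes g1: "integrable lborel g" and g2: "g \<in> L2_space lborel"
  shows "\<exists>f. has_fourier_transform lborel (*) f g"
proof -
  have gm[measurable]: "g \<in> borel_measurable borel" using g1 by auto
  define f where "f x = fourier g (0 - x)" for x
  have fL2: "f \<in> L2_space lborel" unfolding f_def[abs_def] by (intro L2_space_reflect plancherel_L1_L2 g1 g2)
  have fm[measurable]: "f \<in> borel_measurable borel" using fL2 by (simp add: L2_space_def)
  define \<delta> where "\<delta> n = 1 / real (Suc n)" for n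
  have \<delta>: "\<delta> \<longlonglongrightarrow> 0" "\<delta> n > 0" for n unfolding \<delta>_def using LIMSEQ_Suc[OF lim_1_over_n] by auto
  define h where "h n x = f x * of_real (gauss_weight (\<delta> n) x)" for n x
  have even: "gauss_weight d (- x) = gauss_weight d x" for d x by (simp add: gauss_weight_def)
  have hI: "integrable lborel (h n)" for n
  proof -
    have "integrable lborel (\<lambda>x. fourier g (0 + (-1) * x) * of_real (gauss_weight (\<delta> n) (0 + (-1) * x)))"
      by (rule lborel_integrable_real_affine[OF fourier_gauss_integrable[OF g1 \<delta>(2)]]) simp
    then show ?thesis unfolding h_def f_def by (simp add: even)
  qed
  have hm: "h n \<in> borel_measurable lborel" for n unfolding h_def by measurable
  have hb: "cmod (h n x) \<le> 1 * cmod (f x)" for n x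
    unfolding h_def using gauss_weight_bounds[of "\<delta> n" x] by (simp add: norm_mult mult_left_le)
  have hL2: "h n \<in> L2_space lborel" for n by (rule L2_space_bound[OF fL2 hm hb])
  have lim1: "L2_tendsto lborel h f"
  proof (rule L2_tendsto_dominated[OF fL2 hm])
    show "AE x in lborel. (\<lambda>n. h n x) \<longlonglongrightarrow> f x"
    proof (rule AE_I2)
      fix x
      have "(\<lambda>n. gauss_weight (\<delta> n) x) \<longlonglongrightarrow> exp (- (2 * pi * 0 * x)\<^sup>2 / 2)"
        unfolding gauss_weight_def by (intro tendsto_intros \<delta>(1)) simp
      then have "(\<lambda>n. h n x) \<longlonglongrightarrow> f x * of_real (exp (- (2 * pi * 0 * x)\<^sup>2 / 2))"
        unfolding h_def by (intro tendsto_intros)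
      then show "(\<lambda>n. h n x) \<longlonglongrightarrow> f x" by simp
    qed
  qed (use hb in auto)
  have "fourier (h n) = gauss_smooth (\<delta> n) g" for n
  proof
    fix \<xi>
    have "fourier (h n) \<xi> = (LINT x|lborel. fourier g (- x) * of_real (gauss_weight (\<delta> n) x) * char2pi (- (\<xi> * x)))"
      unfolding fourier_eq[of "h n"] h_def f_def by simp
    also have "\<dots> = (LINT x|lborel. fourier g x * of_real (gauss_weight (\<delta> n) x) * char2pi (x * \<xi>))"
      by (subst lborel_integral_real_affine[where c = "-1" and t = 0]) (simp_all add: even mult.commute[of \<xi>] del: of_real_mult)
    finally show "fourier (h n) \<xi> = gauss_smooth (\<delta> n) g \<xi>" using gauss_smooth_fourier[OF g1 \<delta>(2)] by simp
  qed
  then have lim2: "L2_tendsto lborel (\<lambda>n. fourier (h n)) g"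
    using gauss_smooth_tendsto[OF g2 \<delta>(1)] by simp
  show ?thesis unfolding has_fourier_transform_def using fL2 g2 hL2 hI lim1 lim2 by blast
qed

lemma L2_norm_mult_unimodular:
  assumes "\<And>x. cmod (e x) = 1" shows "L2_norm M (\<lambda>x. e x * f x) = L2_norm M f"
  unfolding L2_norm_eq by (simp add: norm_mult assms)

lemma has_fourier_modulate:
  assumes "has_fourier_transform lborel (*) f g"
  shows "has_fourier_transform lborel (*) (\<lambda>x. char2pi (- (t * x)) * f x) (\<lambda>\<xi>. g (\<xi> - (- t)))"
proof -
  from assms obtain h where h: "\<And>k. h k \<in> L2_space lborel" "\<And>k. integrable lborel (h k)"
    "L2_tendsto lborel h f" "L2_tendsto lborel (\<lambda>k. fourier (h k)) g"
    unfolding has_fourier_transform_def by blast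
  note D = has_fourierD[OF assms]
  have L: "(\<lambda>x. char2pi (- (t * x)) * f x) \<in> L2_space lborel" if "f \<in> L2_space lborel" for f
  proof (rule L2_space_bound[OF that, where C = 1])
    have [measurable]: "f \<in> borel_measurable borel" using that by (simp add: L2_space_def)
    show "(\<lambda>x. char2pi (- (t * x)) * f x) \<in> borel_measurable lborel" by measurable
  qed (simp only: norm_mult norm_char2pi mult_1_left order_refl)
  have fh: "fourier (\<lambda>x. char2pi (- (t * x)) * h k x) \<xi> = fourier (h k) (\<xi> - (- t))" for k \<xi>
    unfolding fourier_eq by (intro Bochner_Integration.integral_cong) (auto simp: ring_distribs exp_diff exp_minus field_simps)
  show ?thesis unfolding has_fourier_transform_def
  proof (intro conjI exI[of _ "\<lambda>k x. char2pi (- (t * x)) * h k x"] allI)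
    show "(\<lambda>x. char2pi (- (t * x)) * f x) \<in> L2_space lborel" by (rule L[OF D(1)])
    show "(\<lambda>\<xi>. g (\<xi> - (- t))) \<in> L2_space lborel" by (rule L2_space_shift[OF D(2)])
    show "(\<lambda>x. char2pi (- (t * x)) * h k x) \<in> L2_space lborel" for k by (rule L[OF h(1)])
    show "integrable lborel (\<lambda>x. char2pi (- (t * x)) * h k x)" for k
      using integrable_mult_char2pi[OF h(2)[of k], of t] by (simp only: mult.commute)
    show "L2_tendsto lborel (\<lambda>k x. char2pi (- (t * x)) * h k x) (\<lambda>x. char2pi (- (t * x)) * f x)"
    proof (rule L2_tendsto_bound[OF h(3) h(1) D(1) L[OF h(1)] L[OF D(1)], where C = 1])
      fix k
      have "L2_norm lborel (\<lambda>x. char2pi (- (t * x)) * (h k x - f x)) = L2_norm lborel (\<lambda>x. h k x - f x)"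
        by (rule L2_norm_mult_unimodular) (rule norm_char2pi)
      then show "L2_norm lborel (\<lambda>x. char2pi (- (t * x)) * h k x - char2pi (- (t * x)) * f x) \<le> 1 * L2_norm lborel (\<lambda>x. h k x - f x)"
        by (simp add: right_diff_distrib)
    qed
    show "L2_tendsto lborel (\<lambda>k. fourier (\<lambda>x. char2pi (- (t * x)) * h k x)) (\<lambda>\<xi>. g (\<xi> - (- t)))"
    proof (rule L2_tendsto_bound[OF h(4) plancherel_L1_L2(1)[OF h(2,1)] D(2), where C = 1])
      have eta: "fourier (\<lambda>x. char2pi (- (t * x)) * h k x) = (\<lambda>\<xi>. fourier (h k) (\<xi> - (- t)))" for k using fh by blast
      show "fourier (\<lambda>x. char2pi (- (t * x)) * h k x) \<in> L2_space lborel" for k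
        unfolding eta by (rule L2_space_shift[OF plancherel_L1_L2(1)[OF h(2,1)]])
      show "L2_norm lborel (\<lambda>x. fourier (\<lambda>x. char2pi (- (t * x)) * h k x) x - g (x - (- t))) \<le> 1 * L2_norm lborel (\<lambda>x. fourier (h k) x - g x)" for k
        unfolding eta using L2_norm_shift[of "\<lambda>x. fourier (h k) x - g x" "- t"] by simp
    qed (rule L2_space_shift[OF D(2)])
  qed
qed

section \<open>Convolution with compactly supported kernels\<close>

definition convolve :: "(real \<Rightarrow> complex) \<Rightarrow> (real \<Rightarrow> complex) \<Rightarrow> real \<Rightarrow> complex" where
  "convolve \<Psi> f x = (LINT y|lborel. \<Psi> y * f (x - y))"

lemma measurable_convolve [measurable]:
  assumes [measurable]: "\<Psi> \<in> borel_measurable borel" "f \<in> borel_measurable borel"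
  shows "convolve \<Psi> f \<in> borel_measurable borel"
  unfolding convolve_def[abs_def] by measurable

lemma convolve_pointwise:
  assumes \<Psi>: "\<Psi> \<in> L2_space lborel" "\<And>y. y \<notin> {-\<delta>..\<delta>} \<Longrightarrow> \<Psi> y = 0" and f: "f \<in> L2_space lborel"
  shows "ennreal ((cmod (convolve \<Psi> f x))\<^sup>2) \<le> ennreal ((L2_norm lborel \<Psi>)\<^sup>2) * (\<integral>\<^sup>+ y. indicator {-\<delta>..\<delta>} y * ennreal ((cmod (f (x - y)))\<^sup>2) \<partial>lborel)"
proof -
  define k where "k y = indicator {-\<delta>..\<delta>} y * f (x - y)" for y
  have k: "k \<in> L2_space lborel" unfolding k_def by (intro L2_space_indicator L2_space_reflect f) simp
  have "convolve \<Psi> f x = (LINT y|lborel. \<Psi> y * k y)"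
    unfolding convolve_def k_def using \<Psi>(2) by (intro Bochner_Integration.integral_cong) (auto simp: indicator_def)
  then have "cmod (convolve \<Psi> f x) \<le> (LINT y|lborel. cmod (\<Psi> y) * cmod (k y))"
    using integral_norm_bound[of lborel "\<lambda>y. \<Psi> y * k y"] by (simp add: norm_mult)
  also have "\<dots> \<le> L2_norm lborel \<Psi> * L2_norm lborel k" by (rule L2_cauchy_schwarz[OF \<Psi>(1) k])
  finally have "ennreal ((cmod (convolve \<Psi> f x))\<^sup>2) \<le> ennreal ((L2_norm lborel \<Psi> * L2_norm lborel k)\<^sup>2)"
    by (intro ennreal_leI power_mono) auto
  also have "\<dots> = ennreal ((L2_norm lborel \<Psi>)\<^sup>2) * (\<integral>\<^sup>+ y. ennreal ((cmod (k y))\<^sup>2) \<partial>lborel)"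
    unfolding nn_integral_L2[OF k] by (simp add: power_mult_distrib ennreal_mult)
  also have "(\<integral>\<^sup>+ y. ennreal ((cmod (k y))\<^sup>2) \<partial>lborel) = (\<integral>\<^sup>+ y. indicator {-\<delta>..\<delta>} y * ennreal ((cmod (f (x - y)))\<^sup>2) \<partial>lborel)"
    unfolding k_def by (intro nn_integral_cong) (auto simp: indicator_def)
  finally show ?thesis .
qed

text \<open>Tonelli applied to the pointwise bound. Only continuity in \<open>f\<close> is drawn
  from this estimate later; the quantitative bounds on convolutions come from the frequency
  side.\<close>

lemma convolve_L2:
  assumes \<Psi>: "\<Psi> \<in> L2_space lborel" "\<And>y. y \<notin> {-\<delta>..\<delta>} \<Longrightarrow> \<Psi> y = 0" "\<delta> > 0" and f: "f \<in> L2_space lborel"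
  shows "convolve \<Psi> f \<in> L2_space lborel" 
    "L2_norm lborel (convolve \<Psi> f) \<le> sqrt (2 * \<delta>) * L2_norm lborel \<Psi> * L2_norm lborel f"
proof -
  have [measurable]: "f \<in> borel_measurable borel" "\<Psi> \<in> borel_measurable borel" using f \<Psi> by (auto simp: L2_space_def)
  let ?A = "ennreal ((L2_norm lborel \<Psi>)\<^sup>2)"
  have "(\<integral>\<^sup>+ x. ennreal ((cmod (convolve \<Psi> f x))\<^sup>2) \<partial>lborel)
    \<le> (\<integral>\<^sup>+ x. ?A * (\<integral>\<^sup>+ y. indicator {-\<delta>..\<delta>} y * ennreal ((cmod (f (x - y)))\<^sup>2) \<partial>lborel) \<partial>lborel)"
    by (intro nn_integral_mono convolve_pointwise \<Psi> f)
  also have "\<dots> = ?A * (\<integral>\<^sup>+ x. \<integral>\<^sup>+ y. indicator {-\<delta>..\<delta>} y * ennreal ((cmod (f (x - y)))\<^sup>2) \<partial>lborel \<partial>lborel)"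
    by (rule nn_integral_cmult) measurable
  also have "(\<integral>\<^sup>+ x. \<integral>\<^sup>+ y. indicator {-\<delta>..\<delta>} y * ennreal ((cmod (f (x - y)))\<^sup>2) \<partial>lborel \<partial>lborel)
    = (\<integral>\<^sup>+ y. \<integral>\<^sup>+ x. indicator {-\<delta>..\<delta>} y * ennreal ((cmod (f (x - y)))\<^sup>2) \<partial>lborel \<partial>lborel)"
    by (rule lborel_pair.Fubini'[symmetric]) measurable
  also have "\<dots> = (\<integral>\<^sup>+ y. ennreal ((L2_norm lborel f)\<^sup>2) * indicator {-\<delta>..\<delta>} y \<partial>lborel)"
  proof (rule nn_integral_cong)
    fix y
    have "(\<integral>\<^sup>+ x. indicator {-\<delta>..\<delta>} y * ennreal ((cmod (f (x - y)))\<^sup>2) \<partial>lborel) = indicator {-\<delta>..\<delta>} y * (\<integral>\<^sup>+ x. ennreal ((cmod (f (x - y)))\<^sup>2) \<partial>lborel)"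
      by (rule nn_integral_cmult) measurable
    then show "(\<integral>\<^sup>+ x. indicator {-\<delta>..\<delta>} y * ennreal ((cmod (f (x - y)))\<^sup>2) \<partial>lborel) = ennreal ((L2_norm lborel f)\<^sup>2) * indicator {-\<delta>..\<delta>} y"
      unfolding nn_integral_L2[OF L2_space_shift[OF f]] L2_norm_shift by (simp only: mult.commute)
  qed
  also have "\<dots> = ennreal ((L2_norm lborel f)\<^sup>2) * ennreal (2 * \<delta>)"
    using \<Psi>(3) by (subst nn_integral_cmult_indicator) auto
  also have "?A * (ennreal ((L2_norm lborel f)\<^sup>2) * ennreal (2 * \<delta>)) = ennreal ((sqrt (2 * \<delta>) * L2_norm lborel \<Psi> * L2_norm lborel f)\<^sup>2)"
    using \<Psi>(3) by (simp add: power_mult_distrib ennreal_mult[symmetric] ac_simps)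
  finally have *: "(\<integral>\<^sup>+ x. ennreal ((cmod (convolve \<Psi> f x))\<^sup>2) \<partial>lborel) \<le> ennreal ((sqrt (2 * \<delta>) * L2_norm lborel \<Psi> * L2_norm lborel f)\<^sup>2)" .
  also have "\<dots> < \<infinity>" by simp
  finally show L: "convolve \<Psi> f \<in> L2_space lborel" by (intro L2_spaceI) auto
  have "(L2_norm lborel (convolve \<Psi> f))\<^sup>2 \<le> (sqrt (2 * \<delta>) * L2_norm lborel \<Psi> * L2_norm lborel f)\<^sup>2"
    using *[unfolded nn_integral_L2[OF L]] by (subst (asm) ennreal_le_iff) auto
  then show "L2_norm lborel (convolve \<Psi> f) \<le> sqrt (2 * \<delta>) * L2_norm lborel \<Psi> * L2_norm lborel f"
    using \<Psi>(3) by (intro power2_le_imp_le[OF _ mult_nonneg_nonneg[OF mult_nonneg_nonneg]]) auto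
qed

lemma convolve_diff:
  assumes "\<Psi> \<in> L2_space lborel" "f \<in> L2_space lborel" "g \<in> L2_space lborel"
  shows "convolve \<Psi> (\<lambda>x. f x - g x) x = convolve \<Psi> f x - convolve \<Psi> g x"
  unfolding convolve_def right_diff_distrib
  by (intro Bochner_Integration.integral_diff L2_integrable_mult L2_space_reflect assms)

lemma convolve_L1:
  assumes \<Psi>: "integrable lborel \<Psi>" and f: "integrable lborel f"
  shows "integrable lborel (convolve \<Psi> f)" "fourier (convolve \<Psi> f) \<xi> = fourier f \<xi> * fourier \<Psi> \<xi>"
proof -
  have [measurable]: "f \<in> borel_measurable borel" "\<Psi> \<in> borel_measurable borel" using f \<Psi> by auto
  have fs: "integrable lborel (\<lambda>x. f (x - y))" for y
    using lborel_integrable_real_affine[OF f, of 1 "- y"] by simp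
  have int: "integrable (lborel \<Otimes>\<^sub>M lborel) (\<lambda>(y, x). \<Psi> y * f (x - y))"
  proof (rule lborel_pair.Fubini_integrable)
    show "AE y in lborel. integrable lborel (\<lambda>x. case (y, x) of (y, x) \<Rightarrow> \<Psi> y * f (x - y))" using fs by simp
    have "(LINT x|lborel. norm (case (y, x) of (y, x) \<Rightarrow> \<Psi> y * f (x - y))) = cmod (\<Psi> y) * (LINT x|lborel. cmod (f x))" for y
      using lborel_integral_shift[of "\<lambda>x. cmod (f x)" y] by (simp add: norm_mult)
    then show "integrable lborel (\<lambda>y. LINT x|lborel. norm (case (y, x) of (y, x) \<Rightarrow> \<Psi> y * f (x - y)))"
      using integrable_norm[OF \<Psi>] by simp
  qed measurable
  have "integrable lborel (\<lambda>x. LINT y|lborel. (case (y, x) of (y, x) \<Rightarrow> \<Psi> y * f (x - y)))"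
    using lborel_pair.integrable_snd[OF int] by simp
  then show "integrable lborel (convolve \<Psi> f)" by (simp add: convolve_def[abs_def])
  have int2: "integrable (lborel \<Otimes>\<^sub>M lborel) (\<lambda>(y, x). \<Psi> y * f (x - y) * char2pi (- (\<xi> * x)))"
  proof (rule Bochner_Integration.integrable_bound[OF int])
    show "AE x in lborel \<Otimes>\<^sub>M lborel. norm (case x of (y, x) \<Rightarrow> \<Psi> y * f (x - y) * char2pi (- (\<xi> * x))) \<le> norm (case x of (y, x) \<Rightarrow> \<Psi> y * f (x - y))"
      by (intro AE_I2) (simp only: split_beta norm_mult norm_char2pi mult_1_right order_refl)
  qed measurable
  have "fourier (convolve \<Psi> f) \<xi> = (LINT x|lborel. LINT y|lborel. \<Psi> y * f (x - y) * char2pi (- (\<xi> * x)))"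
    unfolding fourier_eq convolve_def by simp
  also have "\<dots> = (LINT y|lborel. LINT x|lborel. \<Psi> y * f (x - y) * char2pi (- (\<xi> * x)))"
    using lborel_pair.Fubini_integral[OF int2] by simp
  also have "\<dots> = (LINT y|lborel. fourier f \<xi> * (\<Psi> y * char2pi (- (\<xi> * y))))"
  proof (rule Bochner_Integration.integral_cong)
    fix y
    have "(LINT x|lborel. \<Psi> y * f (x - y) * char2pi (- (\<xi> * x))) = (LINT x|lborel. (\<lambda>x. \<Psi> y * char2pi (- (\<xi> * y)) * (f x * char2pi (- (\<xi> * x)))) (x - y))"
      by (intro Bochner_Integration.integral_cong) (auto simp: ring_distribs exp_diff exp_minus field_simps)
    also have "\<dots> = (LINT x|lborel. \<Psi> y * char2pi (- (\<xi> * y)) * (f x * char2pi (- (\<xi> * x))))"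
      by (rule lborel_integral_shift)
    also have "\<dots> = fourier f \<xi> * (\<Psi> y * char2pi (- (\<xi> * y)))" unfolding fourier_eq by simp
    finally show "(LINT x|lborel. \<Psi> y * f (x - y) * char2pi (- (\<xi> * x))) = fourier f \<xi> * (\<Psi> y * char2pi (- (\<xi> * y)))" .
  qed simp
  also have "\<dots> = fourier f \<xi> * fourier \<Psi> \<xi>" unfolding fourier_eq[of \<Psi>] by simp
  finally show "fourier (convolve \<Psi> f) \<xi> = fourier f \<xi> * fourier \<Psi> \<xi>" .
qed

lemma L2_norm_mult_bounded:
  assumes f: "f \<in> L2_space M" and e: "e \<in> borel_measurable M" "\<And>x. cmod (e x) \<le> B"
  shows "(\<lambda>x. f x * e x) \<in> L2_space M" "L2_norm M (\<lambda>x. f x * e x) \<le> B * L2_norm M f"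
proof -
  have [measurable]: "f \<in> borel_measurable M" using f by (simp add: L2_space_def)
  have b: "cmod (f x * e x) \<le> B * cmod (f x)" for x
    using mult_left_mono[OF e(2)[of x], of "cmod (f x)"] by (simp add: norm_mult mult.commute)
  have B: "B \<ge> 0" using order_trans[OF norm_ge_zero e(2)] .
  show L: "(\<lambda>x. f x * e x) \<in> L2_space M" by (rule L2_space_bound[OF f _ b]) (use e in measurable)
  have "(L2_norm M (\<lambda>x. f x * e x))\<^sup>2 \<le> (LINT x|M. B\<^sup>2 * (cmod (f x))\<^sup>2)"
    unfolding L2_norm_power2
  proof (rule integral_mono)
    show "(cmod (f x * e x))\<^sup>2 \<le> B\<^sup>2 * (cmod (f x))\<^sup>2" for x
      using power_mono[OF b[of x], of 2] by (simp add: power_mult_distrib)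
  qed (use L f in \<open>auto simp: L2_space_def\<close>)
  also have "\<dots> = (B * L2_norm M f)\<^sup>2" by (simp add: power_mult_distrib L2_norm_power2)
  finally have "(L2_norm M (\<lambda>x. f x * e x))\<^sup>2 \<le> (B * L2_norm M f)\<^sup>2" .
  moreover have "0 \<le> B * L2_norm M f" using B by (intro mult_nonneg_nonneg) auto
  ultimately show "L2_norm M (\<lambda>x. f x * e x) \<le> B * L2_norm M f" by (rule power2_le_imp_le)
qed

lemma has_fourier_convolve:
  assumes f: "has_fourier_transform lborel (*) f g"
    and \<Psi>: "integrable lborel \<Psi>" "\<Psi> \<in> L2_space lborel" "\<And>y. y \<notin> {-\<delta>..\<delta>} \<Longrightarrow> \<Psi> y = 0" "\<delta> > 0"
  shows "has_fourier_transform lborel (*) (convolve \<Psi> f) (\<lambda>\<xi>. g \<xi> * fourier \<Psi> \<xi>)"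
proof -
  from f obtain h where h: "\<And>k. h k \<in> L2_space lborel" "\<And>k. integrable lborel (h k)"
    "L2_tendsto lborel h f" "L2_tendsto lborel (\<lambda>k. fourier (h k)) g"
    unfolding has_fourier_transform_def by blast
  note D = has_fourierD[OF f]
  have [measurable]: "\<Psi> \<in> borel_measurable borel" using \<Psi>(1) by auto
  have C: "convolve \<Psi> k \<in> L2_space lborel" 
    "L2_norm lborel (convolve \<Psi> k) \<le> sqrt (2 * \<delta>) * L2_norm lborel \<Psi> * L2_norm lborel k" if "k \<in> L2_space lborel" for k
    using convolve_L2[of \<Psi> \<delta> k] \<Psi> that by auto
  let ?B = "LINT t|lborel. cmod (\<Psi> t)"
  have M: "fourier \<Psi> \<in> borel_measurable lborel" by measurable
  note MB = L2_norm_mult_bounded[OF _ M fourier_bound[OF \<Psi>(1)]]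
  have fh: "fourier (convolve \<Psi> (h k)) = (\<lambda>\<xi>. fourier (h k) \<xi> * fourier \<Psi> \<xi>)" for k
    using convolve_L1(2)[OF \<Psi>(1) h(2)] by blast
  show ?thesis unfolding has_fourier_transform_def
  proof (intro conjI exI[of _ "\<lambda>k. convolve \<Psi> (h k)"] allI)
    show "convolve \<Psi> f \<in> L2_space lborel" by (rule C(1)[OF D(1)])
    show "(\<lambda>\<xi>. g \<xi> * fourier \<Psi> \<xi>) \<in> L2_space lborel" by (rule MB(1)[OF D(2)])
    show "convolve \<Psi> (h k) \<in> L2_space lborel" for k by (rule C(1)[OF h(1)])
    show "integrable lborel (convolve \<Psi> (h k))" for k by (rule convolve_L1(1)[OF \<Psi>(1) h(2)])
    show "L2_tendsto lborel (\<lambda>k. convolve \<Psi> (h k)) (convolve \<Psi> f)"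
    proof (rule L2_tendsto_bound[OF h(3) h(1) D(1) C(1)[OF h(1)] C(1)[OF D(1)]])
      fix k
      show "L2_norm lborel (\<lambda>x. convolve \<Psi> (h k) x - convolve \<Psi> f x) \<le> (sqrt (2 * \<delta>) * L2_norm lborel \<Psi>) * L2_norm lborel (\<lambda>x. h k x - f x)"
        using C(2)[OF L2_space_diff[OF h(1)[of k] D(1)]] unfolding convolve_diff[OF \<Psi>(2) h(1) D(1), abs_def] by simp
    qed
    show "L2_tendsto lborel (\<lambda>k. fourier (convolve \<Psi> (h k))) (\<lambda>\<xi>. g \<xi> * fourier \<Psi> \<xi>)"
      unfolding fh
    proof (rule L2_tendsto_bound[OF h(4) plancherel_L1_L2(1)[OF h(2,1)] D(2) MB(1)[OF plancherel_L1_L2(1)[OF h(2,1)]] MB(1)[OF D(2)]])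
      fix k
      show "L2_norm lborel (\<lambda>\<xi>. fourier (h k) \<xi> * fourier \<Psi> \<xi> - g \<xi> * fourier \<Psi> \<xi>) \<le> ?B * L2_norm lborel (\<lambda>\<xi>. fourier (h k) \<xi> - g \<xi>)"
        using MB(2)[OF L2_space_diff[OF plancherel_L1_L2(1)[OF h(2,1), of k] D(2)]] by (simp add: left_diff_distrib)
    qed
  qed
qed

section \<open>Reduction to the PLS property\<close>

text \<open>The density, extended by 0, is the kernel in space. Real arguments suffice, as the move
  to Im z = 1 has been absorbed into the multiplier.\<close>

lemma bandlimited_kernel:
  assumes "bandlimited \<delta> F"
  obtains \<Psi> where "integrable lborel \<Psi>" "\<Psi> \<in> L2_space lborel" "\<And>y. y \<notin> {-\<delta>..\<delta>} \<Longrightarrow> \<Psi> y = 0"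
    "\<And>\<xi>. fourier \<Psi> \<xi> = F (of_real \<xi>)"
proof -
  obtain \<psi> where \<psi>: "continuous_on {-\<delta>..\<delta>} \<psi>"
    "\<And>z. F z = integral {-\<delta>..\<delta>} (\<lambda>t. \<psi> t * exp (- 2 * of_real pi * \<i> * z * of_real t))"
    using assms unfolding bandlimited_def by blast
  define \<Psi> where "\<Psi> y = indicator {-\<delta>..\<delta>} y *\<^sub>R \<psi> y" for y
  have int: "set_integrable lborel {-\<delta>..\<delta>} \<psi>" by (rule borel_integrable_atLeastAtMost'[OF \<psi>(1)])
  then have I: "integrable lborel \<Psi>" unfolding set_integrable_def \<Psi>_def by simp
  have supp: "\<Psi> y = 0" if "y \<notin> {-\<delta>..\<delta>}" for y using that by (simp add: \<Psi>_def)
  have "compact (\<psi> ` {-\<delta>..\<delta>})" using \<psi>(1) by (intro compact_continuous_image) auto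
  then obtain B where B: "\<And>y. y \<in> {-\<delta>..\<delta>} \<Longrightarrow> cmod (\<psi> y) \<le> B"
    using compact_imp_bounded bounded_iff by (metis image_eqI)
  have L2: "\<Psi> \<in> L2_space lborel"
    by (rule L2_space_bounded_support[where B = B and R = \<delta>]) (use I B in \<open>auto simp: \<Psi>_def indicator_def\<close>)
  have "fourier \<Psi> \<xi> = F (of_real \<xi>)" for \<xi>
  proof -
    have c: "continuous_on {-\<delta>..\<delta>} (\<lambda>t. \<psi> t * char2pi (- (\<xi> * t)))" by (intro continuous_intros \<psi>(1))
    have "fourier \<Psi> \<xi> = (LINT t:{-\<delta>..\<delta>}|lborel. \<psi> t * char2pi (- (\<xi> * t)))"
      unfolding fourier_eq set_lebesgue_integral_def \<Psi>_def by (simp only: scaleR_conv_of_real mult.assoc)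
    also have "\<dots> = integral {-\<delta>..\<delta>} (\<lambda>t. \<psi> t * char2pi (- (\<xi> * t)))"
      by (rule set_borel_integral_eq_integral(2)[OF borel_integrable_atLeastAtMost'[OF c]])
    also have "\<dots> = F (of_real \<xi>)" unfolding \<psi>(2) by (simp add: mult.assoc)
    finally show ?thesis .
  qed
  then show ?thesis using that I L2 supp by blast
qed

text \<open>The complement of the support is a union of possibly uncountably many open sets on each
  of which \<open>g\<close> vanishes almost everywhere; by Lindelof, countably many of them
  suffice.\<close>

lemma ess_support_AE:
  "AE x in lborel. x \<notin> ess_support g \<longrightarrow> g x = 0"
proof -
  define \<U> where "\<U> = {U. open U \<and> (AE x in lborel. x \<in> U \<longrightarrow> g x = 0)}"
  obtain \<V> where V: "\<V> \<subseteq> \<U>" "countable \<V>" "\<Union>\<V> = \<Union>\<U>"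
    using Lindelof[of \<U>] by (auto simp: \<U>_def)
  have "AE x in lborel. \<forall>U\<in>\<V>. x \<in> U \<longrightarrow> g x = 0"
    using V(1,2) by (subst AE_ball_countable) (auto simp: \<U>_def)
  then show ?thesis
  proof eventually_elim
    case (elim x)
    then show ?case using V(3) unfolding ess_support_def \<U>_def[symmetric] by blast
  qed
qed

section \<open>Transfer of the PLS property from the carrier of dimension 1 to the reals\<close>

lemma distr_lebesgue_Rd_1: 
  "(\<lambda>x. x 0) \<in> measurable (lebesgue_Rd 1) lborel" "distr (lebesgue_Rd 1) lborel (\<lambda>x. x 0) = lborel"
proof -
  interpret product_sigma_finite "\<lambda>_::nat. lborel :: real measure" ..
  have eq: "lebesgue_Rd 1 = Pi\<^sub>M {0} (\<lambda>_. lborel)" unfolding lebesgue_Rd_def by (simp add: lessThan_Suc)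
  show "(\<lambda>x. x 0) \<in> measurable (lebesgue_Rd 1) lborel" unfolding eq by (rule measurable_component_singleton) simp
  show "distr (lebesgue_Rd 1) lborel (\<lambda>x. x 0) = lborel" unfolding eq by (rule distr_singleton)
qed

lemma integral_lebesgue_Rd_1:
  fixes f :: "real \<Rightarrow> 'b::{banach, second_countable_topology}"
  assumes "f \<in> borel_measurable borel"
  shows "(LINT x|lebesgue_Rd 1. f (x 0)) = (LINT x|lborel. f x)"
  using integral_distr[OF distr_lebesgue_Rd_1(1), of f] assms unfolding distr_lebesgue_Rd_1(2) by simp

lemma integrable_lebesgue_Rd_1:
  fixes f :: "real \<Rightarrow> 'b::{banach, second_countable_topology}"
  assumes "f \<in> borel_measurable borel"
  shows "integrable (lebesgue_Rd 1) (\<lambda>x. f (x 0)) \<longleftrightarrow> integrable lborel f"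
  using integrable_distr_eq[OF distr_lebesgue_Rd_1(1), of f] assms unfolding distr_lebesgue_Rd_1(2) by simp

lemma nn_integral_lebesgue_Rd_1:
  assumes "f \<in> borel_measurable borel"
  shows "(\<integral>\<^sup>+x. f (x 0) \<partial>lebesgue_Rd 1) = (\<integral>\<^sup>+x. f x \<partial>lborel)"
  using nn_integral_distr[OF distr_lebesgue_Rd_1(1), of f] assms unfolding distr_lebesgue_Rd_1(2) by simp

lemma L2_space_lebesgue_Rd_1:
  assumes f: "f \<in> L2_space lborel" 
  shows "(\<lambda>x. f (x 0)) \<in> L2_space (lebesgue_Rd 1)" "L2_norm (lebesgue_Rd 1) (\<lambda>x. f (x 0)) = L2_norm lborel f"
proof -
  have [measurable]: "f \<in> borel_measurable borel" using f by (simp add: L2_space_def)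
  have "(\<lambda>x. f (x 0)) \<in> borel_measurable (lebesgue_Rd 1)"
    using measurable_compose[OF distr_lebesgue_Rd_1(1), of f borel] by simp
  then show "(\<lambda>x. f (x 0)) \<in> L2_space (lebesgue_Rd 1)"
    using f integrable_lebesgue_Rd_1[of "\<lambda>x. (cmod (f x))\<^sup>2"] by (simp add: L2_space_def)
  show "L2_norm (lebesgue_Rd 1) (\<lambda>x. f (x 0)) = L2_norm lborel f"
    unfolding L2_norm_eq by (subst integral_lebesgue_Rd_1[of "\<lambda>x. (cmod (f x))\<^sup>2"]) auto
qed

lemma L2_tendsto_lebesgue_Rd_1:
  assumes "L2_tendsto lborel h f" "\<And>k. h k \<in> L2_space lborel" "f \<in> L2_space lborel"
  shows "L2_tendsto (lebesgue_Rd 1) (\<lambda>k x. h k (x 0)) (\<lambda>x. f (x 0))"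
proof -
  have [measurable]: "f \<in> borel_measurable borel" "\<And>k. h k \<in> borel_measurable borel"
    using assms(2,3) by (auto simp: L2_space_def)
  show ?thesis
    using assms(1) unfolding L2_tendsto_def
    by (subst nn_integral_lebesgue_Rd_1[of "\<lambda>x. ennreal ((cmod (h _ x - f x))\<^sup>2)"]) auto
qed

lemma has_fourier_lebesgue_Rd_1:
  assumes "has_fourier_transform lborel (*) f g"
  shows "has_fourier_transform (lebesgue_Rd 1) (inner_Rd 1) (\<lambda>x. f (x 0)) (\<lambda>x. g (x 0))"
proof -
  from assms obtain h where h: "\<And>k. h k \<in> L2_space lborel" "\<And>k. integrable lborel (h k)"
    "L2_tendsto lborel h f" "L2_tendsto lborel (\<lambda>k. fourier (h k)) g"
    unfolding has_fourier_transform_def by blast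
  note D = has_fourierD[OF assms]
  have [measurable]: "h k \<in> borel_measurable borel" for k using h(2)[of k] by auto
  have "fourier_L1 (lebesgue_Rd 1) (inner_Rd 1) (\<lambda>x. h k (x 0)) \<xi> = fourier (h k) (\<xi> 0)" for k \<xi>
    unfolding fourier_L1_def inner_Rd_def
    using integral_lebesgue_Rd_1[of "\<lambda>t. h k t * exp (- 2 * of_real pi * \<i> * of_real (\<xi> 0 * t))"] by simp
  then have "(\<lambda>k. fourier_L1 (lebesgue_Rd 1) (inner_Rd 1) (\<lambda>x. h k (x 0))) = (\<lambda>k \<xi>. fourier (h k) (\<xi> 0))" by blast
  moreover have "L2_tendsto (lebesgue_Rd 1) (\<lambda>k \<xi>. fourier (h k) (\<xi> 0)) (\<lambda>x. g (x 0))"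
    by (rule L2_tendsto_lebesgue_Rd_1[OF h(4) plancherel_L1_L2(1)[OF h(2,1)] D(2)])
  moreover have "L2_tendsto (lebesgue_Rd 1) (\<lambda>k x. h k (x 0)) (\<lambda>x. f (x 0))"
    by (rule L2_tendsto_lebesgue_Rd_1[OF h(3,1) D(1)])
  moreover have "integrable (lebesgue_Rd 1) (\<lambda>x. h k (x 0))" for k
    using h(2)[of k] by (subst integrable_lebesgue_Rd_1) auto
  ultimately show ?thesis unfolding has_fourier_transform_def
    using L2_space_lebesgue_Rd_1(1)[OF D(1)] L2_space_lebesgue_Rd_1(1)[OF D(2)] L2_space_lebesgue_Rd_1(1)[OF h(1)]
    by (intro conjI exI[of _ "\<lambda>k x. h k (x 0)"] allI) simp_all
qed

lemma relatively_dense_lebesgue_Rd_1: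
  assumes "relatively_dense lborel (cubes_R l) \<gamma> E"
  shows "relatively_dense (lebesgue_Rd 1) (cubes_Rd 1 l) \<gamma> ((\<lambda>x. x 0) -` E \<inter> space (lebesgue_Rd 1))"
proof -
  have E: "E \<in> sets lborel" "\<And>a. ennreal \<gamma> \<le> emeasure lborel (E \<inter> {a..a + l})"
    using assms unfolding relatively_dense_def cubes_R_def by auto
  note m = distr_lebesgue_Rd_1
  have "ennreal \<gamma> \<le> emeasure (lebesgue_Rd 1) (((\<lambda>x. x 0) -` E \<inter> space (lebesgue_Rd 1)) \<inter> (\<Pi>\<^sub>E i\<in>{..<1}. {a i..a i + l}))" for a
  proof -
    have "((\<lambda>x. x 0) -` E \<inter> space (lebesgue_Rd 1)) \<inter> (\<Pi>\<^sub>E i\<in>{..<1}. {a i..a i + l}) = (\<lambda>x. x 0) -` (E \<inter> {a 0..a 0 + l}) \<inter> space (lebesgue_Rd 1)"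
      unfolding lebesgue_Rd_def by (auto simp: space_PiM PiE_iff)
    also have "emeasure (lebesgue_Rd 1) \<dots> = emeasure (distr (lebesgue_Rd 1) lborel (\<lambda>x. x 0)) (E \<inter> {a 0..a 0 + l})"
      using E(1) by (intro emeasure_distr[symmetric] m(1)) auto
    also have "\<dots> = emeasure lborel (E \<inter> {a 0..a 0 + l})" unfolding m(2) ..
    finally show ?thesis using E(2) by simp
  qed
  then show ?thesis unfolding relatively_dense_def cubes_Rd_def
    using measurable_sets[OF m(1) E(1)] by auto
qed

text \<open>The coordinate map pushes \<open>lebesgue_Rd 1\<close> forward to \<open>lborel\<close>,
  so functions, transforms and dense sets pulled back along it keep their norms and measures.
  Measurability of the weight is what lets the weighted integral be transported.\<close>

lemma PLS_property_real:
  assumes PLS: "PLS_property V" and [measurable]: "(\<lambda>x. V \<bar>x\<bar>) \<in> borel_measurable borel"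
    and "\<gamma> \<in> {0<..<1}" "l > 0" "C_V > 0"
  shows "\<exists>C>0. \<forall>f g E. has_fourier_transform lborel (*) f g \<longrightarrow>
    (\<integral>\<^sup>+ \<xi>. (ennreal (cmod (g \<xi>)) * V \<bar>\<xi>\<bar>)\<^sup>2 \<partial>lborel) \<le> ennreal (C_V\<^sup>2 * (L2_norm lborel f)\<^sup>2) \<longrightarrow>
    relatively_dense lborel (cubes_R l) \<gamma> E \<longrightarrow> L2_norm lborel f \<le> C * L2_norm_on lborel E f"
proof -
  from PLS[unfolded PLS_property_def, rule_format, of 1 \<gamma> l C_V] assms(3-5)
  obtain C where C: "C > 0" and P: "\<And>f g E. has_fourier_transform (lebesgue_Rd 1) (inner_Rd 1) f g \<Longrightarrow>
        (\<integral>\<^sup>+ \<xi>. (ennreal (cmod (g \<xi>)) * V (norm_Rd 1 \<xi>))\<^sup>2 \<partial>lebesgue_Rd 1)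
           \<le> ennreal (C_V\<^sup>2 * (L2_norm (lebesgue_Rd 1) f)\<^sup>2) \<Longrightarrow>
        relatively_dense (lebesgue_Rd 1) (cubes_Rd 1 l) \<gamma> E \<Longrightarrow>
        L2_norm (lebesgue_Rd 1) f \<le> C * L2_norm_on (lebesgue_Rd 1) E f"
    by auto
  show ?thesis
  proof (intro exI[of _ C] conjI C allI impI)
    fix f g E
    assume ft: "has_fourier_transform lborel (*) f g"
      and le: "(\<integral>\<^sup>+ \<xi>. (ennreal (cmod (g \<xi>)) * V \<bar>\<xi>\<bar>)\<^sup>2 \<partial>lborel) \<le> ennreal (C_V\<^sup>2 * (L2_norm lborel f)\<^sup>2)"
      and E: "relatively_dense lborel (cubes_R l) \<gamma> E"
    note D = has_fourierD[OF ft]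
    have [measurable]: "g \<in> borel_measurable borel" using D(2) by (simp add: L2_space_def)
    let ?E = "(\<lambda>x. x 0) -` E \<inter> space (lebesgue_Rd 1)"
    have Es: "E \<in> sets lborel" using E by (simp add: relatively_dense_def)
    have "norm_Rd 1 \<xi> = \<bar>\<xi> 0\<bar>" for \<xi> unfolding norm_Rd_def by (simp add: L2_set_def)
    then have "(\<integral>\<^sup>+ \<xi>. (ennreal (cmod (g (\<xi> 0))) * V (norm_Rd 1 \<xi>))\<^sup>2 \<partial>lebesgue_Rd 1) = (\<integral>\<^sup>+ \<xi>. (ennreal (cmod (g \<xi>)) * V \<bar>\<xi>\<bar>)\<^sup>2 \<partial>lborel)"
      using nn_integral_lebesgue_Rd_1[of "\<lambda>\<xi>. (ennreal (cmod (g \<xi>)) * V \<bar>\<xi>\<bar>)\<^sup>2"] by simp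
    also have "\<dots> \<le> ennreal (C_V\<^sup>2 * (L2_norm (lebesgue_Rd 1) (\<lambda>x. f (x 0)))\<^sup>2)"
      using le unfolding L2_space_lebesgue_Rd_1(2)[OF D(1)] .
    finally have "L2_norm (lebesgue_Rd 1) (\<lambda>x. f (x 0)) \<le> C * L2_norm_on (lebesgue_Rd 1) ?E (\<lambda>x. f (x 0))"
      by (intro P[OF has_fourier_lebesgue_Rd_1[OF ft] _ relatively_dense_lebesgue_Rd_1[OF E]])
    also have "L2_norm_on (lebesgue_Rd 1) ?E (\<lambda>x. f (x 0)) = L2_norm (lebesgue_Rd 1) (\<lambda>x. (\<lambda>y. indicator E y * f y) (x 0))"
      unfolding L2_norm_on_eq[of _ ?E] L2_norm_eq
      by (intro arg_cong[where f = sqrt] Bochner_Integration.integral_cong) (auto simp: indicator_def)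
    also have "\<dots> = L2_norm_on lborel E f"
      unfolding L2_norm_on_eq[of lborel E] by (rule L2_space_lebesgue_Rd_1(2)[OF L2_space_indicator[OF D(1) Es]])
    finally show "L2_norm lborel f \<le> C * L2_norm_on lborel E f" unfolding L2_space_lebesgue_Rd_1(2)[OF D(1)] .
  qed
qed

section \<open>Windows around integers and the pigeonhole argument\<close>

abbreviation modulate :: "real \<Rightarrow> (real \<Rightarrow> complex) \<Rightarrow> real \<Rightarrow> complex" where
  "modulate t f \<equiv> (\<lambda>x. char2pi (- (t * x)) * f x)"

lemma L2_space_modulate:
  assumes "f \<in> L2_space lborel" shows "modulate t f \<in> L2_space lborel"
proof (rule L2_space_bound[OF assms, where C = 1])
  have [measurable]: "f \<in> borel_measurable borel" using assms by (simp add: L2_space_def)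
  show "modulate t f \<in> borel_measurable lborel" by measurable
qed (simp only: norm_mult norm_char2pi mult_1_left order_refl)

lemma L2_norm_modulate: "L2_norm M (modulate t f) = L2_norm M f"
  by (rule L2_norm_mult_unimodular) (rule norm_char2pi)

lemma L2_bounded_support_integrable:
  fixes f :: "real \<Rightarrow> complex"
  assumes "f \<in> L2_space lborel" "\<And>x. \<bar>x\<bar> > R \<Longrightarrow> f x = 0"
  shows "integrable lborel f"
proof -
  have "(\<lambda>x. indicator {-R..R} x :: complex) \<in> L2_space lborel"
    by (rule L2_space_bounded_support[where B = 1 and R = R]) (auto simp: indicator_def)
  from L2_integrable_mult(1)[OF assms(1) this]
  have "integrable lborel (\<lambda>x. f x * indicator {-R..R} x)" .
  moreover have "f x * indicator {-R..R} x = f x" for x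
    using assms(2)[of x] by (cases "\<bar>x\<bar> > R") (auto simp: indicator_def)
  ultimately show ?thesis by simp
qed

lemma mode_transform:
  assumes ft: "has_fourier_transform lborel (*) f g"
    and \<Psi>: "integrable lborel \<Psi>" "\<Psi> \<in> L2_space lborel" "\<And>y. y \<notin> {-\<delta>..\<delta>} \<Longrightarrow> \<Psi> y = 0" "\<delta> > 0"
  shows "has_fourier_transform lborel (*) (convolve \<Psi> (modulate t f)) (\<lambda>\<xi>. g (\<xi> - (- t)) * fourier \<Psi> \<xi>)"
    and "integrable lborel (\<lambda>\<xi>. (cmod (g \<xi>))\<^sup>2 * (cmod (fourier \<Psi> (\<xi> - t)))\<^sup>2)"
    and "(L2_norm lborel (convolve \<Psi> (modulate t f)))\<^sup>2 = (LINT \<xi>|lborel. (cmod (g \<xi>))\<^sup>2 * (cmod (fourier \<Psi> (\<xi> - t)))\<^sup>2)"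
proof -
  show ft': "has_fourier_transform lborel (*) (convolve \<Psi> (modulate t f)) (\<lambda>\<xi>. g (\<xi> - (- t)) * fourier \<Psi> \<xi>)"
    by (rule has_fourier_convolve[OF has_fourier_modulate[OF ft] \<Psi>])
  note D = has_fourierD[OF ft']
  have i: "integrable lborel (\<lambda>\<xi>. (cmod (g (\<xi> - (- t)) * fourier \<Psi> \<xi>))\<^sup>2)"
    using D(2) by (simp add: L2_space_def)
  from lborel_integrable_real_affine[OF i, of 1 "- t"]
  show "integrable lborel (\<lambda>\<xi>. (cmod (g \<xi>))\<^sup>2 * (cmod (fourier \<Psi> (\<xi> - t)))\<^sup>2)"
    by (simp add: norm_mult power_mult_distrib)
  have "(L2_norm lborel (convolve \<Psi> (modulate t f)))\<^sup>2 = (LINT \<xi>|lborel. (cmod (g (\<xi> - (- t)) * fourier \<Psi> \<xi>))\<^sup>2)"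
    unfolding D(3) L2_norm_power2 ..
  also have "\<dots> = (LINT \<xi>|lborel. (\<lambda>\<xi>. (cmod (g (\<xi> - (- t)) * fourier \<Psi> \<xi>))\<^sup>2) (\<xi> - t))"
    by (rule lborel_integral_shift[symmetric])
  also have "\<dots> = (LINT \<xi>|lborel. (cmod (g \<xi>))\<^sup>2 * (cmod (fourier \<Psi> (\<xi> - t)))\<^sup>2)"
    by (simp add: norm_mult power_mult_distrib)
  finally show "(L2_norm lborel (convolve \<Psi> (modulate t f)))\<^sup>2 = (LINT \<xi>|lborel. (cmod (g \<xi>))\<^sup>2 * (cmod (fourier \<Psi> (\<xi> - t)))\<^sup>2)" .
qed

lemma convolve_modulate_tendsto:
  assumes \<Psi>: "\<Psi> \<in> L2_space lborel" "\<And>y. y \<notin> {-\<delta>..\<delta>} \<Longrightarrow> \<Psi> y = 0" "\<delta> > 0"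
    and h: "L2_tendsto lborel h f" "\<And>k. h k \<in> L2_space lborel" "f \<in> L2_space lborel"
  shows "(\<lambda>k. L2_norm lborel (convolve \<Psi> (modulate t (h k)))) \<longlonglongrightarrow> L2_norm lborel (convolve \<Psi> (modulate t f))"
proof -
  have C: "convolve \<Psi> k \<in> L2_space lborel" 
    "L2_norm lborel (convolve \<Psi> k) \<le> sqrt (2 * \<delta>) * L2_norm lborel \<Psi> * L2_norm lborel k" if "k \<in> L2_space lborel" for k
    using convolve_L2[of \<Psi> \<delta> k] \<Psi> that by auto
  note hm = L2_space_modulate[OF h(2)] and fm = L2_space_modulate[OF h(3)]
  have "L2_tendsto lborel (\<lambda>k. convolve \<Psi> (modulate t (h k))) (convolve \<Psi> (modulate t f))"
  proof (rule L2_tendsto_bound[OF h C(1)[OF hm] C(1)[OF fm]])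
    fix k
    have "L2_norm lborel (\<lambda>x. convolve \<Psi> (modulate t (h k)) x - convolve \<Psi> (modulate t f) x)
      = L2_norm lborel (convolve \<Psi> (\<lambda>x. modulate t (h k) x - modulate t f x))"
      unfolding convolve_diff[OF \<Psi>(1) hm fm, abs_def] ..
    also have "\<dots> \<le> sqrt (2 * \<delta>) * L2_norm lborel \<Psi> * L2_norm lborel (\<lambda>x. modulate t (h k) x - modulate t f x)"
      by (rule C(2)[OF L2_space_diff[OF hm fm]])
    also have "L2_norm lborel (\<lambda>x. modulate t (h k) x - modulate t f x) = L2_norm lborel (\<lambda>x. h k x - f x)"
      using L2_norm_modulate[of lborel t "\<lambda>x. h k x - f x"] by (simp add: right_diff_distrib)
    finally show "L2_norm lborel (\<lambda>x. convolve \<Psi> (modulate t (h k)) x - convolve \<Psi> (modulate t f) x)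
       \<le> (sqrt (2 * \<delta>) * L2_norm lborel \<Psi>) * L2_norm lborel (\<lambda>x. h k x - f x)" .
  qed
  then show ?thesis by (intro L2_tendsto_norm C hm fm)
qed

lemma has_fourier_L1_L2:
  assumes "integrable lborel h" "h \<in> L2_space lborel"
  shows "has_fourier_transform lborel (*) h (fourier h)"
  unfolding has_fourier_transform_def using assms plancherel_L1_L2(1)[OF assms]
  by (intro conjI exI[of _ "\<lambda>_. h"]) (auto simp: L2_tendsto_def)

text \<open>\<open>fourier (\<Psi> t)\<close> is the multiplier for the window at \<open>t\<close>.
  \<open>A\<close> is finite because the spectra considered are bounded; \<open>B\<close> and
  \<open>Z\<close> will be the same for all such \<open>A\<close>.\<close>

locale modes =
  fixes \<Psi> :: "int \<Rightarrow> real \<Rightarrow> complex" and A :: "int set" and \<delta> B Z :: real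
  assumes \<delta>: "\<delta> > 0" and A: "finite A" and B: "B > 0"
    and \<Psi>_L1: "integrable lborel (\<Psi> t)" and \<Psi>_L2: "\<Psi> t \<in> L2_space lborel" and \<Psi>_supp: "y \<notin> {-\<delta>..\<delta>} \<Longrightarrow> \<Psi> t y = 0"
    and \<Psi>_bound: "cmod (fourier (\<Psi> t) x) \<le> B / (1 + x\<^sup>2)"
    and Z: "(\<Sum>j\<in>A. 1 / (1 + (y - of_int j)\<^sup>2)) \<le> Z"
begin

text \<open>Modulation brings the frequency \<open>t\<close> to 0, so on the frequency side a mode
  is \<open>g\<close> times the window \<open>fourier (\<Psi> t)\<close> centred at
  \<open>t\<close>.\<close>

definition mode :: "int \<Rightarrow> (real \<Rightarrow> complex) \<Rightarrow> real \<Rightarrow> complex" where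
  "mode t f = convolve (\<Psi> t) (modulate (of_int t) f)"

lemma mode_L2: "f \<in> L2_space lborel \<Longrightarrow> mode t f \<in> L2_space lborel"
  unfolding mode_def using convolve_L2(1)[OF \<Psi>_L2 \<Psi>_supp \<delta> L2_space_modulate] by blast

lemma transform_mode:
  assumes ft: "has_fourier_transform lborel (*) f g"
  shows "has_fourier_transform lborel (*) (mode t f) (\<lambda>\<xi>. g (\<xi> - (- of_int t)) * fourier (\<Psi> t) \<xi>)"
    and "integrable lborel (\<lambda>\<xi>. (cmod (g \<xi>))\<^sup>2 * (cmod (fourier (\<Psi> t) (\<xi> - of_int t)))\<^sup>2)"
    and "(L2_norm lborel (mode t f))\<^sup>2 = (LINT \<xi>|lborel. (cmod (g \<xi>))\<^sup>2 * (cmod (fourier (\<Psi> t) (\<xi> - of_int t)))\<^sup>2)"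
  unfolding mode_def by (rule mode_transform[OF ft \<Psi>_L1 \<Psi>_L2 \<Psi>_supp \<delta>]; assumption)+

lemma square_bound: "(B / (1 + x\<^sup>2))\<^sup>2 \<le> B\<^sup>2 * (1 / (1 + x\<^sup>2))" for x :: real
proof -
  have "1 * (1 + x\<^sup>2) \<le> (1 + x\<^sup>2) * (1 + x\<^sup>2)" by (intro mult_right_mono) auto
  then have "1 / (1 + x\<^sup>2)\<^sup>2 \<le> 1 / (1 + x\<^sup>2)"
    unfolding power2_eq_square[of "1 + x\<^sup>2"] by (intro divide_left_mono mult_pos_pos) (auto simp: add_pos_nonneg)
  then have "B\<^sup>2 * (1 / (1 + x\<^sup>2)\<^sup>2) \<le> B\<^sup>2 * (1 / (1 + x\<^sup>2))" by (intro mult_left_mono) auto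
  then show ?thesis by (simp add: power_divide)
qed

text \<open>A common majorant for the plain and the weighted energies of the modes. The windows
  overlap, but by \<open>Z\<close> only boundedly, so the sum stays comparable to the squared norm
  of \<open>g\<close>.\<close>

lemma envelope_sum:
  assumes g: "g \<in> L2_space lborel"
  shows "integrable lborel (\<lambda>\<xi>. (cmod (g \<xi>))\<^sup>2 * (B\<^sup>2 * (1 / (1 + (\<xi> - of_int t)\<^sup>2))))"
    and "(\<Sum>t\<in>A. LINT \<xi>|lborel. (cmod (g \<xi>))\<^sup>2 * (B\<^sup>2 * (1 / (1 + (\<xi> - of_int t)\<^sup>2)))) \<le> B\<^sup>2 * Z * (L2_norm lborel g)\<^sup>2"
proof -
  have [measurable]: "g \<in> borel_measurable borel" using g by (simp add: L2_space_def)
  have gi: "integrable lborel (\<lambda>\<xi>. (cmod (g \<xi>))\<^sup>2)" using g by (simp add: L2_space_def)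
  show i: "integrable lborel (\<lambda>\<xi>. (cmod (g \<xi>))\<^sup>2 * (B\<^sup>2 * (1 / (1 + (\<xi> - of_int t)\<^sup>2))))" for t
  proof (rule Bochner_Integration.integrable_bound)
    show "integrable lborel (\<lambda>\<xi>. B\<^sup>2 * (cmod (g \<xi>))\<^sup>2)" using gi by simp
    show "AE \<xi> in lborel. norm ((cmod (g \<xi>))\<^sup>2 * (B\<^sup>2 * (1 / (1 + (\<xi> - of_int t)\<^sup>2)))) \<le> norm (B\<^sup>2 * (cmod (g \<xi>))\<^sup>2)"
    proof (rule AE_I2)
      fix \<xi> :: real
      have "1 / (1 + (\<xi> - of_int t)\<^sup>2) \<le> 1" by (simp add: add_pos_nonneg)
      then have "(B\<^sup>2 * (cmod (g \<xi>))\<^sup>2) * (1 / (1 + (\<xi> - of_int t)\<^sup>2)) \<le> (B\<^sup>2 * (cmod (g \<xi>))\<^sup>2) * 1"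
        by (intro mult_left_mono) auto
      then show "norm ((cmod (g \<xi>))\<^sup>2 * (B\<^sup>2 * (1 / (1 + (\<xi> - of_int t)\<^sup>2)))) \<le> norm (B\<^sup>2 * (cmod (g \<xi>))\<^sup>2)"
        by (simp add: abs_mult ac_simps)
    qed
  qed measurable
  have "(\<Sum>t\<in>A. LINT \<xi>|lborel. (cmod (g \<xi>))\<^sup>2 * (B\<^sup>2 * (1 / (1 + (\<xi> - of_int t)\<^sup>2))))
    = (LINT \<xi>|lborel. (\<Sum>t\<in>A. (cmod (g \<xi>))\<^sup>2 * (B\<^sup>2 * (1 / (1 + (\<xi> - of_int t)\<^sup>2)))))"
    by (rule Bochner_Integration.integral_sum[symmetric]) (rule i)
  also have "\<dots> \<le> (LINT \<xi>|lborel. B\<^sup>2 * Z * (cmod (g \<xi>))\<^sup>2)"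
  proof (rule integral_mono)
    fix \<xi> :: real
    have "(\<Sum>t\<in>A. (cmod (g \<xi>))\<^sup>2 * (B\<^sup>2 * (1 / (1 + (\<xi> - of_int t)\<^sup>2)))) = (cmod (g \<xi>))\<^sup>2 * (B\<^sup>2 * (\<Sum>t\<in>A. 1 / (1 + (\<xi> - of_int t)\<^sup>2)))"
      by (simp only: sum_distrib_left)
    also have "\<dots> \<le> (cmod (g \<xi>))\<^sup>2 * (B\<^sup>2 * Z)" by (intro mult_left_mono Z) auto
    finally show "(\<Sum>t\<in>A. (cmod (g \<xi>))\<^sup>2 * (B\<^sup>2 * (1 / (1 + (\<xi> - of_int t)\<^sup>2)))) \<le> B\<^sup>2 * Z * (cmod (g \<xi>))\<^sup>2" by (simp only: ac_simps)
  qed (use i gi in auto)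
  also have "\<dots> = B\<^sup>2 * Z * (L2_norm lborel g)\<^sup>2" unfolding L2_norm_power2 by simp
  finally show "(\<Sum>t\<in>A. LINT \<xi>|lborel. (cmod (g \<xi>))\<^sup>2 * (B\<^sup>2 * (1 / (1 + (\<xi> - of_int t)\<^sup>2)))) \<le> B\<^sup>2 * Z * (L2_norm lborel g)\<^sup>2" .
qed

lemma sum_modes_transform:
  assumes ft: "has_fourier_transform lborel (*) f g"
  shows "(\<Sum>t\<in>A. (L2_norm lborel (mode t f))\<^sup>2) \<le> B\<^sup>2 * Z * (L2_norm lborel f)\<^sup>2"
proof -
  note D = has_fourierD[OF ft]
  have "(\<Sum>t\<in>A. (L2_norm lborel (mode t f))\<^sup>2) \<le> (\<Sum>t\<in>A. LINT \<xi>|lborel. (cmod (g \<xi>))\<^sup>2 * (B\<^sup>2 * (1 / (1 + (\<xi> - of_int t)\<^sup>2))))"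
    unfolding transform_mode(3)[OF ft]
  proof (rule sum_mono, rule integral_mono)
    fix t \<xi>
    have "(cmod (fourier (\<Psi> t) (\<xi> - of_int t)))\<^sup>2 \<le> (B / (1 + (\<xi> - of_int t)\<^sup>2))\<^sup>2" by (intro power_mono \<Psi>_bound) auto
    then have "(cmod (fourier (\<Psi> t) (\<xi> - of_int t)))\<^sup>2 \<le> B\<^sup>2 * (1 / (1 + (\<xi> - of_int t)\<^sup>2))"
      using square_bound by (rule order_trans)
    then show "(cmod (g \<xi>))\<^sup>2 * (cmod (fourier (\<Psi> t) (\<xi> - of_int t)))\<^sup>2 \<le> (cmod (g \<xi>))\<^sup>2 * (B\<^sup>2 * (1 / (1 + (\<xi> - of_int t)\<^sup>2)))"
      by (intro mult_left_mono) auto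
  next
    show "integrable lborel (\<lambda>\<xi>. (cmod (g \<xi>))\<^sup>2 * (cmod (fourier (\<Psi> t) (\<xi> - of_int t)))\<^sup>2)" for t
      by (rule transform_mode(2)[OF ft])
    show "integrable lborel (\<lambda>\<xi>. (cmod (g \<xi>))\<^sup>2 * (B\<^sup>2 * (1 / (1 + (\<xi> - of_int t)\<^sup>2))))" for t
      by (rule envelope_sum(1)[OF D(2)])
  qed
  also have "\<dots> \<le> B\<^sup>2 * Z * (L2_norm lborel g)\<^sup>2" by (rule envelope_sum(2)[OF D(2)])
  finally show ?thesis unfolding D(3) .
qed

text \<open>The bound is wanted for \<open>f\<close> cut off to a set, for which no transform is at
  hand. Truncations are both integrable and square integrable, hence have one, and each mode depends
  continuously on the function.\<close>

lemma sum_modes_L2: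
  assumes f: "f \<in> L2_space lborel"
  shows "(\<Sum>t\<in>A. (L2_norm lborel (mode t f))\<^sup>2) \<le> B\<^sup>2 * Z * (L2_norm lborel f)\<^sup>2"
proof -
  have [measurable]: "f \<in> borel_measurable borel" using f by (simp add: L2_space_def)
  define h where "h n x = (if \<bar>x\<bar> \<le> real n \<and> cmod (f x) \<le> real n then f x else 0)" for n x
  have hL: "h n \<in> L2_space lborel" for n unfolding h_def by (rule L2_space_bound[OF f, where C = 1]) auto
  have hI: "integrable lborel (h n)" for n by (rule L2_bounded_support_integrable[OF hL, where R = "real n"]) (simp add: h_def)
  have lim: "L2_tendsto lborel h f" using L2_truncate_tendsto[OF f] unfolding h_def[abs_def] .
  have "(\<Sum>t\<in>A. (L2_norm lborel (mode t (h n)))\<^sup>2) \<le> B\<^sup>2 * Z * (L2_norm lborel (h n))\<^sup>2" for n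
    by (rule sum_modes_transform[OF has_fourier_L1_L2[OF hI hL]])
  moreover have "(\<lambda>n. \<Sum>t\<in>A. (L2_norm lborel (mode t (h n)))\<^sup>2) \<longlonglongrightarrow> (\<Sum>t\<in>A. (L2_norm lborel (mode t f))\<^sup>2)"
    unfolding mode_def by (intro tendsto_sum tendsto_power convolve_modulate_tendsto[OF \<Psi>_L2 \<Psi>_supp \<delta> lim hL f])
  moreover have "(\<lambda>n. B\<^sup>2 * Z * (L2_norm lborel (h n))\<^sup>2) \<longlonglongrightarrow> B\<^sup>2 * Z * (L2_norm lborel f)\<^sup>2"
    by (intro tendsto_mult tendsto_const tendsto_power L2_tendsto_norm hL f lim)
  ultimately show ?thesis by (meson LIMSEQ_le)
qed

lemma mode_local:
  assumes "\<And>y. \<bar>y\<bar> \<le> \<delta> \<Longrightarrow> x - y \<in> U"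
  shows "mode t f x = mode t (\<lambda>x. indicator U x * f x) x"
  unfolding mode_def convolve_def
proof (rule Bochner_Integration.integral_cong)
  fix y
  show "\<Psi> t y * modulate (of_int t) f (x - y) = \<Psi> t y * modulate (of_int t) (\<lambda>x. indicator U x * f x) (x - y)"
    using assms[of y] \<Psi>_supp[of y t] by (cases "y \<in> {-\<delta>..\<delta>}") (auto simp: abs_le_iff)
qed simp

text \<open>By \<open>loc\<close> every frequency of \<open>g\<close> lies in a window where the
  multiplier is at least \<open>b\<close>, so the squared norms of the modes add up to at least b^2
  times that of \<open>g\<close>; upper bounds use the overlap constant \<open>Z\<close>. Both
  directions work without orthogonality of the modes.\<close>

lemma observability:
  assumes ft: "has_fourier_transform lborel (*) f g"
    and loc: "\<And>\<xi>. g \<xi> \<noteq> 0 \<Longrightarrow> \<exists>t\<in>A. \<bar>\<xi> - of_int t\<bar> \<le> 1"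
    and b: "b > 0" "\<And>t x. \<bar>x\<bar> \<le> 1 \<Longrightarrow> b \<le> cmod (fourier (\<Psi> t) x)" and Zpos: "Z > 0"
    and V0: "\<And>x. V x \<ge> 0" and Vm[measurable]: "(\<lambda>x. V \<bar>x\<bar>) \<in> borel_measurable borel"
    and V: "\<And>t. t \<in> A \<Longrightarrow> AE \<xi> in lborel. g \<xi> \<noteq> 0 \<longrightarrow> 
       cmod (fourier (\<Psi> t) (\<xi> - of_int t)) * V \<bar>\<xi> - of_int t\<bar> \<le> B / (1 + (\<xi> - of_int t)\<^sup>2)"
    and K: "K > 0" "K\<^sup>2 = 2 * B\<^sup>2 * Z / b\<^sup>2" and C: "C \<ge> 0"
    and pls: "\<And>f g. has_fourier_transform lborel (*) f g \<Longrightarrow>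
      (\<integral>\<^sup>+ \<xi>. (ennreal (cmod (g \<xi>)) * ennreal (V \<bar>\<xi>\<bar>))\<^sup>2 \<partial>lborel) \<le> ennreal (K\<^sup>2 * (L2_norm lborel f)\<^sup>2) \<Longrightarrow>
      L2_norm lborel f \<le> C * L2_norm_on lborel E f"
    and E: "E \<in> sets lborel" "U \<in> sets lborel" "\<And>x y. x \<in> E \<Longrightarrow> \<bar>y\<bar> \<le> \<delta> \<Longrightarrow> x - y \<in> U"
  shows "b\<^sup>2 * (L2_norm lborel f)\<^sup>2 \<le> 2 * C\<^sup>2 * B\<^sup>2 * Z * (L2_norm_on lborel U f)\<^sup>2"
proof -
  note D = has_fourierD[OF ft]
  have gm[measurable]: "g \<in> borel_measurable borel" using D(2) by (simp add: L2_space_def)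
  have \<Psi>m[measurable]: "\<Psi> t \<in> borel_measurable borel" for t using \<Psi>_L1[of t] by auto
  define n where "n t = (L2_norm lborel (mode t f))\<^sup>2" for t
  define i where "i t = (LINT \<xi>|lborel. (cmod (g \<xi>))\<^sup>2 * (B\<^sup>2 * (1 / (1 + (\<xi> - of_int t)\<^sup>2))))" for t
  define w where "w t = (\<integral>\<^sup>+ \<xi>. (ennreal (cmod (g (\<xi> - (- of_int t)) * fourier (\<Psi> t) \<xi>)) * ennreal (V \<bar>\<xi>\<bar>))\<^sup>2 \<partial>lborel)" for t
  have i0: "i t \<ge> 0" for t unfolding i_def using B by (intro Bochner_Integration.integral_nonneg) auto
  \<comment> \<open>Where \<open>g\<close> does not vanish, the multiplier pays for the weight: the
    weighted energy of a mode obeys the same envelope as the unweighted one.\<close>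
  have w_le: "w t \<le> ennreal (i t)" if t: "t \<in> A" for t
  proof -
    define q where "q \<xi> = (ennreal (cmod (g \<xi> * fourier (\<Psi> t) (\<xi> - of_int t))) * ennreal (V \<bar>\<xi> - of_int t\<bar>))\<^sup>2" for \<xi>
    have "(\<lambda>x. V \<bar>x - of_int t\<bar>) \<in> borel_measurable borel"
      by (rule measurable_compose[OF _ Vm]) measurable
    then have [measurable]: "q \<in> borel_measurable borel" unfolding q_def[abs_def] by measurable
    have "w t = (\<integral>\<^sup>+ \<xi>. q (of_int t + 1 * \<xi>) \<partial>lborel)"
      unfolding w_def q_def by (simp add: add.commute)
    also have "\<dots> = (\<integral>\<^sup>+ \<xi>. q \<xi> \<partial>lborel)" using nn_integral_real_affine[of q 1 "of_int t"] by simp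
    also have "\<dots> \<le> (\<integral>\<^sup>+ \<xi>. ennreal ((cmod (g \<xi>))\<^sup>2 * (B\<^sup>2 * (1 / (1 + (\<xi> - of_int t)\<^sup>2)))) \<partial>lborel)"
    proof (rule nn_integral_mono_AE)
      show "AE \<xi> in lborel. q \<xi> \<le> ennreal ((cmod (g \<xi>))\<^sup>2 * (B\<^sup>2 * (1 / (1 + (\<xi> - of_int t)\<^sup>2))))"
        using V[OF t]
      proof eventually_elim
        case (elim \<xi>)
        show ?case
        proof (cases "g \<xi> = 0")
          case False
          let ?m = "cmod (fourier (\<Psi> t) (\<xi> - of_int t))" and ?v = "V \<bar>\<xi> - of_int t\<bar>"
          have "(?m * ?v)\<^sup>2 \<le> (B / (1 + (\<xi> - of_int t)\<^sup>2))\<^sup>2" using elim False V0 by (intro power_mono) auto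
          then have "(?m * ?v)\<^sup>2 \<le> B\<^sup>2 * (1 / (1 + (\<xi> - of_int t)\<^sup>2))" using square_bound by (rule order_trans)
          then have "(cmod (g \<xi>))\<^sup>2 * (?m * ?v)\<^sup>2 \<le> (cmod (g \<xi>))\<^sup>2 * (B\<^sup>2 * (1 / (1 + (\<xi> - of_int t)\<^sup>2)))"
            by (intro mult_left_mono) auto
          moreover have "q \<xi> = ennreal ((cmod (g \<xi>))\<^sup>2 * (?m * ?v)\<^sup>2)"
            unfolding q_def using V0 by (simp add: ennreal_mult[symmetric] ennreal_power norm_mult power_mult_distrib mult.assoc)
          ultimately show ?thesis by (simp add: ennreal_leI)
        qed (simp add: q_def)
      qed
    qed
    also have "\<dots> = ennreal (i t)" unfolding i_def
      by (rule nn_integral_eq_integral[OF envelope_sum(1)[OF D(2)]]) simp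
    finally show ?thesis .
  qed
  have lower: "b\<^sup>2 * (L2_norm lborel g)\<^sup>2 \<le> (\<Sum>t\<in>A. n t)"
  proof -
    have "b\<^sup>2 * (L2_norm lborel g)\<^sup>2 = (LINT \<xi>|lborel. b\<^sup>2 * (cmod (g \<xi>))\<^sup>2)" unfolding L2_norm_power2 by simp
    also have "\<dots> \<le> (LINT \<xi>|lborel. (\<Sum>t\<in>A. (cmod (g \<xi>))\<^sup>2 * (cmod (fourier (\<Psi> t) (\<xi> - of_int t)))\<^sup>2))"
    proof (rule integral_mono)
      show "integrable lborel (\<lambda>\<xi>. b\<^sup>2 * (cmod (g \<xi>))\<^sup>2)" using D(2) by (simp add: L2_space_def)
      show "integrable lborel (\<lambda>\<xi>. \<Sum>t\<in>A. (cmod (g \<xi>))\<^sup>2 * (cmod (fourier (\<Psi> t) (\<xi> - of_int t)))\<^sup>2)"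
        by (intro Bochner_Integration.integrable_sum transform_mode(2)[OF ft])
      fix \<xi>
      show "b\<^sup>2 * (cmod (g \<xi>))\<^sup>2 \<le> (\<Sum>t\<in>A. (cmod (g \<xi>))\<^sup>2 * (cmod (fourier (\<Psi> t) (\<xi> - of_int t)))\<^sup>2)"
      proof (cases "g \<xi> = 0")
        case False
        then obtain t where t: "t \<in> A" "\<bar>\<xi> - of_int t\<bar> \<le> 1" using loc by blast
        have "b\<^sup>2 \<le> (cmod (fourier (\<Psi> t) (\<xi> - of_int t)))\<^sup>2" using b t by (intro power_mono) auto
        then have "b\<^sup>2 * (cmod (g \<xi>))\<^sup>2 \<le> (cmod (g \<xi>))\<^sup>2 * (cmod (fourier (\<Psi> t) (\<xi> - of_int t)))\<^sup>2"
          unfolding mult.commute[of "b\<^sup>2"] by (intro mult_left_mono) auto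
        also have "\<dots> \<le> (\<Sum>t\<in>A. (cmod (g \<xi>))\<^sup>2 * (cmod (fourier (\<Psi> t) (\<xi> - of_int t)))\<^sup>2)"
          using t A by (intro member_le_sum[where f = "\<lambda>t. (cmod (g \<xi>))\<^sup>2 * (cmod (fourier (\<Psi> t) (\<xi> - of_int t)))\<^sup>2"]) auto
        finally show ?thesis .
      qed simp
    qed
    also have "\<dots> = (\<Sum>t\<in>A. n t)" unfolding n_def transform_mode(3)[OF ft]
      by (intro Bochner_Integration.integral_sum transform_mode(2)[OF ft])
    finally show ?thesis .
  qed
  \<comment> \<open>A bad \<open>t\<close> satisfies K^2 n t \<le> i t, and the i t add up to at
    most B^2 Z times the squared norm of \<open>g\<close>. The 2 in the choice of \<open>K\<close>
    therefore leaves to the bad windows at most half of \<open>lower\<close>.\<close>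
  define good where "good = {t\<in>A. w t \<le> ennreal (K\<^sup>2 * n t)}"
  have bad: "(\<Sum>t\<in>A - good. n t) \<le> b\<^sup>2 * (L2_norm lborel g)\<^sup>2 / 2"
  proof -
    have "K\<^sup>2 * n t \<le> i t" if "t \<in> A - good" for t
    proof -
      have "ennreal (K\<^sup>2 * n t) \<le> ennreal (i t)" using that w_le[of t] by (auto simp: good_def)
      then show ?thesis using i0 by simp
    qed
    then have "(\<Sum>t\<in>A - good. K\<^sup>2 * n t) \<le> (\<Sum>t\<in>A - good. i t)" by (rule sum_mono)
    also have "\<dots> \<le> (\<Sum>t\<in>A. i t)" using A i0 by (intro sum_mono2) auto
    also have "\<dots> \<le> B\<^sup>2 * Z * (L2_norm lborel g)\<^sup>2" unfolding i_def by (rule envelope_sum(2)[OF D(2)])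
    also have "\<dots> = K\<^sup>2 * (b\<^sup>2 * (L2_norm lborel g)\<^sup>2 / 2)" unfolding K(2) using b(1) by simp
    finally have "K\<^sup>2 * (\<Sum>t\<in>A - good. n t) \<le> K\<^sup>2 * (b\<^sup>2 * (L2_norm lborel g)\<^sup>2 / 2)" by (simp only: sum_distrib_left)
    then show ?thesis using K(1) by (simp only: mult_le_cancel_left_pos zero_less_power)
  qed
  \<comment> \<open>On \<open>E\<close> a mode of \<open>f\<close> coincides with the same mode of
    \<open>h\<close>, whose norm only involves \<open>f\<close> on \<open>U\<close>; this is where
    the neighbourhood enters.\<close>
  define h where "h x = indicator U x * f x" for x
  have h: "h \<in> L2_space lborel" unfolding h_def by (rule L2_space_indicator[OF D(1) E(2)])
  have good_le: "n t \<le> C\<^sup>2 * (L2_norm lborel (mode t h))\<^sup>2" if "t \<in> good" for t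
  proof -
    have "L2_norm lborel (mode t f) \<le> C * L2_norm_on lborel E (mode t f)"
      using that by (intro pls[OF transform_mode(1)[OF ft]]) (auto simp: good_def w_def n_def)
    also have "L2_norm_on lborel E (mode t f) = L2_norm lborel (\<lambda>x. mode t h x * indicator E x)"
    proof -
      have "indicator E x * mode t f x = mode t h x * indicator E x" for x
        using mode_local[of x U t f] E(3)[of x] unfolding h_def by (cases "x \<in> E") auto
      then have "(\<lambda>x. indicator E x * mode t f x) = (\<lambda>x. mode t h x * indicator E x)" by blast
      then show ?thesis unfolding L2_norm_on_eq[of lborel E] by (rule arg_cong)
    qed
    also have "\<dots> \<le> 1 * L2_norm lborel (mode t h)"
      using E(1) by (intro L2_norm_mult_bounded(2) mode_L2 h) (auto simp: indicator_def)
    finally have "L2_norm lborel (mode t f) \<le> C * L2_norm lborel (mode t h)" using C by (simp add: mult_left_mono)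
    from power_mono[OF this, of 2] show ?thesis unfolding n_def by (simp add: power_mult_distrib)
  qed
  have "(\<Sum>t\<in>good. n t) \<le> (\<Sum>t\<in>good. C\<^sup>2 * (L2_norm lborel (mode t h))\<^sup>2)" by (rule sum_mono) (rule good_le)
  also have "\<dots> \<le> (\<Sum>t\<in>A. C\<^sup>2 * (L2_norm lborel (mode t h))\<^sup>2)" using A by (intro sum_mono2) (auto simp: good_def)
  also have "\<dots> = C\<^sup>2 * (\<Sum>t\<in>A. (L2_norm lborel (mode t h))\<^sup>2)" by (rule sum_distrib_left[symmetric])
  also have "\<dots> \<le> C\<^sup>2 * (B\<^sup>2 * Z * (L2_norm lborel h)\<^sup>2)" by (intro mult_left_mono sum_modes_L2 h) simp
  finally have good: "(\<Sum>t\<in>good. n t) \<le> C\<^sup>2 * (B\<^sup>2 * Z * (L2_norm lborel h)\<^sup>2)" .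
  have "(\<Sum>t\<in>A. n t) = (\<Sum>t\<in>A - good. n t) + (\<Sum>t\<in>good. n t)"
    using A by (intro sum.subset_diff) (auto simp: good_def)
  then have "b\<^sup>2 * (L2_norm lborel g)\<^sup>2 / 2 \<le> C\<^sup>2 * (B\<^sup>2 * Z * (L2_norm lborel h)\<^sup>2)" using lower bad good by linarith
  then show ?thesis unfolding D(3) L2_norm_on_eq[of lborel U] h_def by (simp add: mult.assoc)
qed

end

theorem theorem5p2:
  fixes W :: "real \<Rightarrow> real" and C_doub :: real
  assumes "mono_on {0..} W"
    and "\<And>t. t \<ge> 0 \<Longrightarrow> W t \<ge> 1"
    and "\<And>t. t \<ge> 1 \<Longrightarrow> W t > 1"
    and "\<And>\<alpha>. \<alpha> > 0 \<Longrightarrow> PLS_property (\<lambda>t. ennreal (W t powr \<alpha>))"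
    and "\<And>t. t > 1 \<Longrightarrow> ln (W (exp 1 * t)) \<le> C_doub * ln (W t)"
    and "\<And>t. t > 1 \<Longrightarrow> ln (W t) \<le> t / 4"
  shows "\<forall>\<Lambda>>0. \<forall>\<gamma>>0. \<forall>\<sigma>>0. \<exists>C>0. \<forall>Q E f g.
           W_sparse W Q \<longrightarrow> sparse_norm W Q \<le> ennreal \<Lambda> \<longrightarrow>
           relatively_dense lborel (cubes_R 1) \<gamma> E \<longrightarrow>
           has_fourier_transform lborel (*) f g \<longrightarrow> ess_support g \<subseteq> Q \<longrightarrow>
           L2_norm lborel f \<le> C * L2_norm_on lborel (open_nbhd \<sigma> E) f"
proof (intro allI impI)
  fix \<Lambda> \<gamma> \<sigma> :: real
  assume pos: "\<Lambda> > 0" "\<gamma> > 0" "\<sigma> > 0"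
  \<comment> \<open>The infimum over covers need not be attained; the extra 1 leaves room to pick a
    cover for each translate.\<close>
  define M where "M = \<Lambda> + 1"
  have M: "M > 0" using pos by (simp add: M_def)
  obtain \<beta> B b where \<beta>: "\<beta> > 0" and B: "B > 0" and b: "b > 0" and mult:
    "\<And>Q J N. W_short_cover W J Q \<Longrightarrow> cover_norm W J \<le> ennreal M \<Longrightarrow>
       \<exists>F. bandlimited (\<sigma> / 2) F \<and> (\<forall>x::real. cmod (F x) \<le> B / (1 + x\<^sup>2)) \<and>
         (\<forall>x::real. x \<in> Q \<longrightarrow> \<bar>x\<bar> \<le> exp (real N + 1) \<longrightarrow> cmod (F x) * W \<bar>x\<bar> powr \<beta> \<le> B / (1 + x\<^sup>2)) \<and>
         (\<forall>x::real. \<bar>x\<bar> \<le> 1 \<longrightarrow> b \<le> cmod (F x))"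
    using cover_multiplier[OF assms(1,3,5,6,2) pos(3) M] by metis
  obtain Z :: real where Zb: "Z > 0"
    "\<And>y (A :: int set). finite A \<Longrightarrow> (\<Sum>j\<in>A. 1 / (1 + (y - of_int j)\<^sup>2)) \<le> Z"
    using lattice_sum_bound by blast
  define V where "V x = W x powr \<beta>" for x
  have Vm: "(\<lambda>x. V \<bar>x\<bar>) \<in> borel_measurable borel"
  proof -
    \<comment> \<open>Monotonicity is known on the half-line only, and the values of
      \<open>W\<close> at negative arguments are arbitrary.\<close>
    have "mono (\<lambda>x. W (max 0 x))" using assms(1) by (intro monoI) (auto intro!: mono_onD[OF assms(1)])
    then have "(\<lambda>x. W (max 0 x)) \<in> borel_measurable borel" by (rule borel_measurable_mono)
    then have "(\<lambda>x. W (max 0 \<bar>x\<bar>)) \<in> borel_measurable borel" by (rule measurable_compose[rotated]) measurable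
    then have "(\<lambda>x. W \<bar>x\<bar>) \<in> borel_measurable borel" by simp
    then show ?thesis unfolding V_def by measurable
  qed
  define K where "K = sqrt (2 * B\<^sup>2 * Z / b\<^sup>2)"
  have K: "K > 0" "K\<^sup>2 = 2 * B\<^sup>2 * Z / b\<^sup>2" unfolding K_def using B b Zb(1) by auto
  \<comment> \<open>The PLS property speaks of densities in (0, 1), while \<gamma> is any positive
    number; lowering \<gamma> preserves relative density.\<close>
  define \<gamma>' where "\<gamma>' = min \<gamma> (1 / 2)"
  have \<gamma>': "\<gamma>' \<in> {0<..<1}" "\<gamma>' \<le> \<gamma>" using pos by (auto simp: \<gamma>'_def)
  have "\<exists>C>0. \<forall>f g E. has_fourier_transform lborel (*) f g \<longrightarrow>
    (\<integral>\<^sup>+ \<xi>. (ennreal (cmod (g \<xi>)) * ennreal (V \<bar>\<xi>\<bar>))\<^sup>2 \<partial>lborel) \<le> ennreal (K\<^sup>2 * (L2_norm lborel f)\<^sup>2) \<longrightarrow>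
    relatively_dense lborel (cubes_R 1) \<gamma>' E \<longrightarrow> L2_norm lborel f \<le> C * L2_norm_on lborel E f"
    using PLS_property_real[OF assms(4)[OF \<beta>] _ \<gamma>'(1) zero_less_one K(1)] Vm unfolding V_def by simp
  then obtain C where C: "C > 0" and pls: "\<And>f g E. has_fourier_transform lborel (*) f g \<Longrightarrow>
    (\<integral>\<^sup>+ \<xi>. (ennreal (cmod (g \<xi>)) * ennreal (V \<bar>\<xi>\<bar>))\<^sup>2 \<partial>lborel) \<le> ennreal (K\<^sup>2 * (L2_norm lborel f)\<^sup>2) \<Longrightarrow>
    relatively_dense lborel (cubes_R 1) \<gamma>' E \<Longrightarrow> L2_norm lborel f \<le> C * L2_norm_on lborel E f" by blast
  \<comment> \<open>The constant of \<open>observability\<close> after a square root. It is built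
    from \<open>C\<close>, \<open>B\<close>, \<open>b\<close> and \<open>Z\<close>, all fixed before
    \<open>Q\<close>, \<open>E\<close> and \<open>f\<close>.\<close>
  define D where "D = sqrt (2 * C\<^sup>2 * B\<^sup>2 * Z / b\<^sup>2)"
  have D: "D > 0" "b\<^sup>2 * D\<^sup>2 = 2 * C\<^sup>2 * B\<^sup>2 * Z" unfolding D_def using B b C Zb(1) by auto
  show "\<exists>C>0. \<forall>Q E f g.
           W_sparse W Q \<longrightarrow> sparse_norm W Q \<le> ennreal \<Lambda> \<longrightarrow>
           relatively_dense lborel (cubes_R 1) \<gamma> E \<longrightarrow>
           has_fourier_transform lborel (*) f g \<longrightarrow> ess_support g \<subseteq> Q \<longrightarrow>
           L2_norm lborel f \<le> C * L2_norm_on lborel (open_nbhd \<sigma> E) f"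
  proof (intro exI[of _ D] conjI D(1) allI impI)
    fix Q E f g
    assume sparse: "sparse_norm W Q \<le> ennreal \<Lambda>"
      and dense: "relatively_dense lborel (cubes_R 1) \<gamma> E"
      and ft: "has_fourier_transform lborel (*) f g" and supp: "ess_support g \<subseteq> Q"
    define U where "U = open_nbhd \<sigma> E"
    have Us: "U \<in> sets lborel" unfolding U_def open_nbhd_def by (simp add: open_UN borel_open)
    have Es: "E \<in> sets lborel" using dense by (simp add: relatively_dense_def)
    have dense': "relatively_dense lborel (cubes_R 1) \<gamma>' E"
      using dense ennreal_leI[OF \<gamma>'(2)] unfolding relatively_dense_def by (blast intro: order_trans)
    have EU: "x - y \<in> U" if "x \<in> E" "\<bar>y\<bar> \<le> \<sigma> / 2" for x y
    proof -
      have "x - y \<in> ball x \<sigma>" using that pos by (simp add: dist_real_def)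
      then show ?thesis using that(1) unfolding U_def open_nbhd_def by blast
    qed
    have cover: "\<exists>J. W_short_cover W J ((\<lambda>x. x - t) ` Q) \<and> cover_norm W J \<le> ennreal M" for t
    proof -
      have "(INF J\<in>{J. W_short_cover W J ((\<lambda>x. x - t) ` Q)}. cover_norm W J) \<le> sparse_norm W Q"
        unfolding sparse_norm_def by (rule SUP_upper) simp
      also have "\<dots> \<le> ennreal \<Lambda>" by (rule sparse)
      also have "\<dots> < ennreal M" using pos by (simp add: M_def ennreal_less_iff)
      finally show ?thesis unfolding INF_less_iff by (auto intro: less_imp_le)
    qed
    \<comment> \<open>For bounded spectrum. The support condition is taken in the almost everywhere
      form, which truncations of \<open>g\<close> inherit. \<open>R\<close> only selects windows and
      scales and does not enter \<open>D\<close>.\<close>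
    have core: "L2_norm lborel f \<le> D * L2_norm_on lborel U f"
      if ft: "has_fourier_transform lborel (*) f g" and gQ: "AE x in lborel. x \<notin> Q \<longrightarrow> g x = 0"
        and gR: "\<And>x. \<bar>x\<bar> > R \<Longrightarrow> g x = 0" and R: "R \<ge> 0" for f g R
    proof -
      \<comment> \<open>A frequency \<xi> is served by the window at its floor.\<close>
      define A where "A = {\<lfloor>- R\<rfloor>..\<lfloor>R\<rfloor>}"
      \<comment> \<open>For |\<xi>| \<le> R and \<open>t \<in> A\<close> one has |\<xi> - t| \<le> 2
        R + 1, which must stay below e^(N+1), the reach of the weighted bound on the
        multiplier.\<close>
      define N where "N = nat \<lceil>2 * R + 2\<rceil>"
      have "2 * R + 2 \<le> real N" unfolding N_def by linarith
      then have N: "2 * R + 2 \<le> exp (real N + 1)" using exp_ge_add_one_self[of "real N + 1"] by linarith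
      define good where "good t \<Psi> \<longleftrightarrow> integrable lborel \<Psi> \<and> \<Psi> \<in> L2_space lborel \<and> (\<forall>y. y \<notin> {-(\<sigma>/2)..\<sigma>/2} \<longrightarrow> \<Psi> y = 0) \<and>
         (\<forall>x. cmod (fourier \<Psi> x) \<le> B / (1 + x\<^sup>2)) \<and>
         (\<forall>x. x \<in> (\<lambda>x. x - of_int t) ` Q \<longrightarrow> \<bar>x\<bar> \<le> exp (real N + 1) \<longrightarrow> cmod (fourier \<Psi> x) * V \<bar>x\<bar> \<le> B / (1 + x\<^sup>2)) \<and>
         (\<forall>x. \<bar>x\<bar> \<le> 1 \<longrightarrow> b \<le> cmod (fourier \<Psi> x))" for t :: int and \<Psi>
      have "\<exists>\<Psi>. good t \<Psi>" for t
      proof -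
        obtain J where J: "W_short_cover W J ((\<lambda>x. x - of_int t) ` Q)" "cover_norm W J \<le> ennreal M"
          using cover by blast
        from mult[OF J, of N] obtain F where F: "bandlimited (\<sigma> / 2) F"
          "\<forall>x::real. cmod (F x) \<le> B / (1 + x\<^sup>2)"
          "\<forall>x::real. x \<in> (\<lambda>x. x - of_int t) ` Q \<longrightarrow> \<bar>x\<bar> \<le> exp (real N + 1) \<longrightarrow> cmod (F x) * W \<bar>x\<bar> powr \<beta> \<le> B / (1 + x\<^sup>2)"
          "\<forall>x::real. \<bar>x\<bar> \<le> 1 \<longrightarrow> b \<le> cmod (F x)" by blast
        obtain \<Psi> where \<Psi>: "integrable lborel \<Psi>" "\<Psi> \<in> L2_space lborel" "\<And>y. y \<notin> {-(\<sigma>/2)..\<sigma>/2} \<Longrightarrow> \<Psi> y = 0"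
          "\<And>\<xi>. fourier \<Psi> \<xi> = F (of_real \<xi>)" using bandlimited_kernel[OF F(1)] by metis
        have "good t \<Psi>" unfolding good_def \<Psi>(4) V_def using \<Psi>(1-3) F(2-4) by blast
        then show ?thesis by blast
      qed
      then have "\<forall>t. \<exists>\<Psi>. good t \<Psi>" by blast
      from choice[OF this] obtain \<Psi> where P: "\<And>t. good t (\<Psi> t)" by blast
      have \<Psi>: "integrable lborel (\<Psi> t)" "\<Psi> t \<in> L2_space lborel" "y \<notin> {-(\<sigma>/2)..\<sigma>/2} \<Longrightarrow> \<Psi> t y = 0"
         "cmod (fourier (\<Psi> t) x) \<le> B / (1 + x\<^sup>2)" for t x y
        using P[of t] unfolding good_def by blast+
      have \<Psi>V: "x \<in> (\<lambda>x. x - of_int t) ` Q \<Longrightarrow> \<bar>x\<bar> \<le> exp (real N + 1) \<Longrightarrow> cmod (fourier (\<Psi> t) x) * V \<bar>x\<bar> \<le> B / (1 + x\<^sup>2)" for t x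
        using P[of t] unfolding good_def by blast
      have \<Psi>b: "\<bar>x\<bar> \<le> 1 \<Longrightarrow> b \<le> cmod (fourier (\<Psi> t) x)" for t x
        using P[of t] unfolding good_def by blast
      interpret modes \<Psi> A "\<sigma> / 2" B Z
      proof
        show "\<sigma> / 2 > 0" "B > 0" "finite A" using pos B by (auto simp: A_def)
        show "(\<Sum>j\<in>A. 1 / (1 + (y - of_int j)\<^sup>2)) \<le> Z" for y by (rule Zb(2)) (simp add: A_def)
      qed (rule \<Psi>; assumption)+
      have "b\<^sup>2 * (L2_norm lborel f)\<^sup>2 \<le> 2 * C\<^sup>2 * B\<^sup>2 * Z * (L2_norm_on lborel U f)\<^sup>2"
      proof (rule observability[where V = V and K = K and E = E, OF ft])
        show "b > 0" "Z > 0" "K > 0" "K\<^sup>2 = 2 * B\<^sup>2 * Z / b\<^sup>2" "C \<ge> 0" by (fact b Zb(1) K less_imp_le[OF C])+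
        show "E \<in> sets lborel" "U \<in> sets lborel" "(\<lambda>x. V \<bar>x\<bar>) \<in> borel_measurable borel" by (fact Es Us Vm)+
        show "b \<le> cmod (fourier (\<Psi> t) x)" if "\<bar>x\<bar> \<le> 1" for t x using \<Psi>b[OF that] .
        show "x - y \<in> U" if "x \<in> E" "\<bar>y\<bar> \<le> \<sigma> / 2" for x y using EU[OF that] .
        show "V x \<ge> 0" for x by (simp add: V_def)
        show "L2_norm lborel f \<le> C * L2_norm_on lborel E f" 
          if "has_fourier_transform lborel (*) f g" 
            "(\<integral>\<^sup>+ \<xi>. (ennreal (cmod (g \<xi>)) * ennreal (V \<bar>\<xi>\<bar>))\<^sup>2 \<partial>lborel) \<le> ennreal (K\<^sup>2 * (L2_norm lborel f)\<^sup>2)" for f g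
          by (rule pls[OF that dense'])
      next
        fix \<xi> assume "g \<xi> \<noteq> 0"
        then have "\<bar>\<xi>\<bar> \<le> R" using gR[of \<xi>] by (cases "\<bar>\<xi>\<bar> \<le> R") auto
        then have "\<lfloor>- R\<rfloor> \<le> \<lfloor>\<xi>\<rfloor>" "\<lfloor>\<xi>\<rfloor> \<le> \<lfloor>R\<rfloor>" by (auto intro!: floor_mono)
        moreover have "\<bar>\<xi> - of_int \<lfloor>\<xi>\<rfloor>\<bar> \<le> 1" by linarith
        ultimately show "\<exists>t\<in>A. \<bar>\<xi> - of_int t\<bar> \<le> 1" unfolding A_def by (intro bexI[of _ "\<lfloor>\<xi>\<rfloor>"]) auto
      next
        fix t assume t: "t \<in> A"
        have tR: "\<bar>real_of_int t\<bar> \<le> R + 1" using t unfolding A_def by simp linarith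
        show "AE \<xi> in lborel. g \<xi> \<noteq> 0 \<longrightarrow> cmod (fourier (\<Psi> t) (\<xi> - of_int t)) * V \<bar>\<xi> - of_int t\<bar> \<le> B / (1 + (\<xi> - of_int t)\<^sup>2)"
          using gQ
        proof eventually_elim
          case (elim \<xi>)
          show ?case
          proof
            assume g: "g \<xi> \<noteq> 0"
            then have 1: "\<xi> - of_int t \<in> (\<lambda>x. x - of_int t) ` Q" using elim by blast
            have "\<bar>\<xi>\<bar> \<le> R" using gR[of \<xi>] g by (cases "\<bar>\<xi>\<bar> \<le> R") auto
            then have "\<bar>\<xi> - of_int t\<bar> \<le> exp (real N + 1)" using tR N by linarith
            from \<Psi>V[OF 1 this] show "cmod (fourier (\<Psi> t) (\<xi> - of_int t)) * V \<bar>\<xi> - of_int t\<bar> \<le> B / (1 + (\<xi> - of_int t)\<^sup>2)" .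
          qed
        qed
      qed
      then have "b\<^sup>2 * (L2_norm lborel f)\<^sup>2 \<le> b\<^sup>2 * (D * L2_norm_on lborel U f)\<^sup>2"
        unfolding D(2)[symmetric] power_mult_distrib by (simp only: mult.assoc)
      then have "(L2_norm lborel f)\<^sup>2 \<le> (D * L2_norm_on lborel U f)\<^sup>2" using b by (simp only: mult_le_cancel_left_pos zero_less_power)
      then show ?thesis by (rule power2_le_imp_le) (use D(1) in simp)
    qed
    note F = has_fourierD[OF ft]
    have gm[measurable]: "g \<in> borel_measurable borel" using F(2) by (simp add: L2_space_def)
    have gQ: "AE x in lborel. x \<notin> Q \<longrightarrow> g x = 0" using ess_support_AE[of g] supp by (auto elim!: eventually_mono)
    \<comment> \<open>Cutting \<open>g\<close> to [-k, k] gives spectra to which \<open>core\<close>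
      applies with a constant independent of \<open>k\<close>.\<close>
    define gk where "gk k x = (if \<bar>x\<bar> \<le> real k then g x else 0)" for k x
    have gkL: "gk k \<in> L2_space lborel" for k unfolding gk_def by (rule L2_space_bound[OF F(2), where C = 1]) auto
    have gkI: "integrable lborel (gk k)" for k by (rule L2_bounded_support_integrable[OF gkL, where R = "real k"]) (simp add: gk_def)
    have "\<forall>k. \<exists>h. has_fourier_transform lborel (*) h (gk k)" using has_fourier_exists[OF gkI gkL] by blast
    from choice[OF this] obtain fk where fk: "\<And>k. has_fourier_transform lborel (*) (fk k) (gk k)" by blast
    have fkL: "fk k \<in> L2_space lborel" for k by (rule has_fourierD(1)[OF fk])
    have "L2_tendsto lborel gk g"
    proof (rule L2_tendsto_dominated[OF F(2)])
      show "gk k \<in> borel_measurable lborel" for k unfolding gk_def by measurable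
      show "AE x in lborel. (\<lambda>k. gk k x) \<longlonglongrightarrow> g x"
      proof (rule AE_I2)
        fix x
        obtain n where n: "\<bar>x\<bar> \<le> real n" using real_arch_simple by blast
        have "\<forall>\<^sub>F k in sequentially. gk k x = g x"
          using eventually_ge_at_top[of n]
        proof eventually_elim
          case (elim k)
          then have "real n \<le> real k" by simp
          then show ?case using n by (auto simp: gk_def)
        qed
        then show "(\<lambda>k. gk k x) \<longlonglongrightarrow> g x" by (rule tendsto_eventually)
      qed
    qed (auto simp: gk_def)
    then have "(\<lambda>k. L2_norm lborel (\<lambda>x. gk k x - g x)) \<longlonglongrightarrow> 0"
      by (rule L2_tendsto_iff[OF gkL F(2), THEN iffD1])
    moreover have "L2_norm lborel (\<lambda>x. fk k x - f x) = L2_norm lborel (\<lambda>x. gk k x - g x)" for k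
      by (rule has_fourierD(3)[OF has_fourier_diff[OF fk ft]])
    ultimately have lim: "(\<lambda>k. L2_norm lborel (\<lambda>x. fk k x - f x)) \<longlonglongrightarrow> 0" by simp
    \<comment> \<open>The truncated function \<open>fk k\<close> is compared with \<open>f\<close>
      twice, over \<open>U\<close> and over the whole line, which gives the coefficient D + 1 of an
      error that tends to 0.\<close>
    have step: "L2_norm lborel f \<le> D * L2_norm_on lborel U f + (D + 1) * L2_norm lborel (\<lambda>x. fk k x - f x)" for k
    proof -
      let ?e = "L2_norm lborel (\<lambda>x. fk k x - f x)"
      have "L2_norm lborel (fk k) \<le> D * L2_norm_on lborel U (fk k)"
        by (rule core[OF fk, where R = "real k"]) (use gQ in \<open>auto simp: gk_def elim!: eventually_mono\<close>)
      moreover have "L2_norm_on lborel U (fk k) \<le> L2_norm_on lborel U f + ?e"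
      proof -
        note I = L2_space_indicator[OF _ Us]
        have "L2_norm lborel (\<lambda>x. indicator U x * fk k x) - L2_norm lborel (\<lambda>x. indicator U x * f x)
          \<le> L2_norm lborel (\<lambda>x. indicator U x * fk k x - indicator U x * f x)"
          using L2_norm_triangle_diff[OF I[OF fkL[of k]] I[OF F(1)]] by linarith
        also have "(\<lambda>x. indicator U x * fk k x - indicator U x * f x) = (\<lambda>x. (fk k x - f x) * indicator U x)"
          by (auto simp: algebra_simps)
        also have "L2_norm lborel (\<lambda>x. (fk k x - f x) * indicator U x) \<le> 1 * ?e"
          using Us by (intro L2_norm_mult_bounded(2) L2_space_diff fkL F(1)) (auto simp: indicator_def)
        finally show ?thesis unfolding L2_norm_on_eq[of lborel U] by simp
      qed
      then have "D * L2_norm_on lborel U (fk k) \<le> D * L2_norm_on lborel U f + D * ?e"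
        unfolding distrib_left[symmetric] using D(1) by (intro mult_left_mono) auto
      moreover have "L2_norm lborel f - L2_norm lborel (fk k) \<le> ?e"
        using L2_norm_triangle_diff[OF fkL[of k] F(1)] by linarith
      ultimately show ?thesis by (simp add: distrib_right)
    qed
    have "(\<lambda>k. D * L2_norm_on lborel U f + (D + 1) * L2_norm lborel (\<lambda>x. fk k x - f x)) \<longlonglongrightarrow> D * L2_norm_on lborel U f + (D + 1) * 0"
      by (intro tendsto_add tendsto_mult tendsto_const lim)
    then have "L2_norm lborel f \<le> D * L2_norm_on lborel U f + (D + 1) * 0"
      by (rule LIMSEQ_le_const) (use step in blast)
    then show "L2_norm lborel f \<le> D * L2_norm_on lborel (open_nbhd \<sigma> E) f" by (simp add: U_def)
  qed
qed

end
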